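(* Let $\mathcal T_n$ be a random generalized split tree (with $n$ balls) with asymptotic split vector $\mathcal V=(V_1,\dots,V_b)$, satisfying conditions (ST1)–(ST3) stated in the context, and let $\chi:=\sum_{i=1}^b\mathbb E[V_i\log(1/V_i)]$. Then, as $n\to\infty$, $$\frac{d(\xi^{(n)}_1,\xi^{(n)}_2)}{\log n}\to\frac2\chi\quad\text{in probability},$$ where $d$ is the graph distance in $\mathcal T_n$ and, conditionally on $\mathcal T_n$, $\xi^{(n)}_1,\xi^{(n)}_2$ are i.i.d. uniformly random vertices of $\mathcal T_n$. Consequently, $$\frac1{\log n}\mathcal T_n\to\Upsilon_{1/\chi}\quad\text{in probability}.$$
   Context: Generalized split trees. Let $2\le b<\infty$ be fixed, and for every integer $n\ge1$ let $\mathcal N^{(n)}=(N^{(n)}_i)_{i=0}^b$ be a random vector with $N^{(n)}_i\in\{0,1,2,\dots\}$ and $\sum_{i=0}^bN^{(n)}_i=n$. In the infinite $b$-ary tree, start with $n$ balls at the root; $N^{(n)}_0$ balls remain in the root for ever and $N^{(n)}_i$ balls are passed to the $i$th child, $1\le i\le b$. Continue recursively in each subtree that has received at least one ball, using an independent copy of $\mathcal N^{(m)}$ at each vertex that has received $m\ge1$ balls. $\mathcal T_n$ is the set of all vertices that have received at least one ball (whether or not any ball remains there); it is a.s. finite under the assumptions below, and $|\mathcal T_n|$ is random. Assumptions: (ST1) There is a constant $C_0$ such that for every $n$, a.s. $0\le N^{(n)}_0\le C_0$. (ST2) $\frac1n\mathcal N^{(n)}=(N^{(n)}_i/n)_{i=0}^b$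 converges in distribution as $n\to\infty$ to a random vector $\mathcal V=(V_i)_{i=0}^b$ (the asymptotic split vector; necessarily $V_0=0$ and $\sum_{i=1}^bV_i=1$ a.s.). (ST3) For every $n\ge1$, $\mathbb P(\max_{1\le i\le b}N^{(n)}_i=n)<1$, and $\mathbb P(\max_{1\le i\le b}V_i=1)<1$. Convention: $0\log(1/0)=0$. $M_\infty$ is the Polish space of infinite real matrices $(a_{ij})_{i,j\ge1}$ with the product topology, and $\mathcal P(M_\infty)$ is the space of Borel probability measures on it with the weak topology. For a finite tree $T$ and $c>0$, $\tau_\infty(cT)\in\mathcal P(M_\infty)$ is the distribution of $(c\,d_T(\xi_i,\xi_j)\mathbf 1\{i\ne j\})_{i,j\ge1}$, where $d_T$ is graph distance and $\xi_1,\xi_2,\dots$ are i.i.d. uniformly random vertices of $T$. $\Upsilon_a$ ($a\ge0$) is the long dendron whose base is a one-point real tree and whose measure on $\{\bullet\}\times[0,\infty)\cong[0,\infty)$ is $\delta_a$; its sampling measure $\tau_\infty(\Upsilon_a)$ is the point mass at the constant matrix $(2a\mathbf 1\{i\ne j\})_{i,j\ge1}$. For random trees, "$c_n\mathcal T_n\to\Upsilon_a$ in probability" means that the random elements $\tau_\infty(c_n\mathcal T_n)$ of $\mathcal P(M_\infty)$ converge in probability to $\tau_\infty(\Upsilon_a)$. *)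

theory Defs
  imports "HOL-Probability.Probability"
begin

section \<open>Weak topology and convergence in probability\<close>

text \<open>The space of Borel probability measures on a topological space, with the coarsest topology
  making all maps \<open>\<mu> \<mapsto> \<integral> f d\<mu>\<close>, for \<open>f\<close> bounded and continuous, continuous.\<close>

definition weak_topology :: "'a::topological_space measure topology" where
  "weak_topology = topology_generated_by
     {{\<mu>. prob_space \<mu> \<and> sets \<mu> = sets borel \<and> (\<integral>x. f x \<partial>\<mu>) \<in> U} | (f :: 'a \<Rightarrow> real) U.
        continuous_on UNIV f \<and> bounded (range f) \<and> open U}"

lemma topspace_weak_topology:
  "topspace (weak_topology :: 'a::topological_space measure topology)
     = {\<mu>. prob_space \<mu> \<and> sets \<mu> = sets borel}"
proof -
  have "\<exists>A. (\<exists>(f :: 'a \<Rightarrow> real) U. A = {\<mu>. prob_space \<mu> \<and> sets \<mu> = sets borel \<and> (\<integral>x. f x \<partial>\<mu>) \<in> U} \<and>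
          continuous_on UNIV f \<and> bounded (range f) \<and> open U) \<and> \<mu> \<in> A"
    if "prob_space \<mu>" "sets \<mu> = sets borel" for \<mu> :: "'a measure"
    using that
    by (intro exI[of _ "{\<mu>. prob_space \<mu> \<and> sets \<mu> = sets borel \<and> (\<integral>x. (\<lambda>_. 0::real) x \<partial>\<mu>) \<in> UNIV}"]
          conjI exI[of _ "\<lambda>_. 0::real"] exI[of _ "UNIV :: real set"]) (auto simp: bounded_iff)
  then show ?thesis
    unfolding weak_topology_def topology_generated_by_topspace by blast
qed

lemma limitin_weak_topology:
  fixes \<mu> :: "nat \<Rightarrow> 'a::topological_space measure"
  assumes \<mu>: "\<forall>\<^sub>F n in sequentially. prob_space (\<mu> n) \<and> sets (\<mu> n) = sets borel"
    and \<nu>: "prob_space \<nu>" "sets \<nu> = sets borel"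
  shows "limitin weak_topology \<mu> \<nu> sequentially \<longleftrightarrow>
    (\<forall>f :: 'a \<Rightarrow> real. continuous_on UNIV f \<and> bounded (range f) \<longrightarrow>
       (\<lambda>n. \<integral>x. f x \<partial>\<mu> n) \<longlonglongrightarrow> (\<integral>x. f x \<partial>\<nu>))"
proof (intro iffI allI impI)
  fix f :: "'a \<Rightarrow> real"
  assume L: "limitin weak_topology \<mu> \<nu> sequentially"
    and f: "continuous_on UNIV f \<and> bounded (range f)"
  show "(\<lambda>n. \<integral>x. f x \<partial>\<mu> n) \<longlonglongrightarrow> (\<integral>x. f x \<partial>\<nu>)"
  proof (rule topological_tendstoI)
    fix U :: "real set" assume U: "open U" "(\<integral>x. f x \<partial>\<nu>) \<in> U"
    let ?W = "{\<mu>. prob_space \<mu> \<and> sets \<mu> = sets borel \<and> (\<integral>x. f x \<partial>\<mu>) \<in> U}"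
    have "openin weak_topology ?W"
      unfolding weak_topology_def by (rule topology_generated_by_Basis) (use f U in blast)
    with L \<nu> U have "\<forall>\<^sub>F n in sequentially. \<mu> n \<in> ?W"
      unfolding limitin_def by blast
    then show "\<forall>\<^sub>F n in sequentially. (\<integral>x. f x \<partial>\<mu> n) \<in> U"
      by eventually_elim auto
  qed
next
  assume R: "\<forall>f :: 'a \<Rightarrow> real. continuous_on UNIV f \<and> bounded (range f) \<longrightarrow>
       (\<lambda>n. \<integral>x. f x \<partial>\<mu> n) \<longlonglongrightarrow> (\<integral>x. f x \<partial>\<nu>)"
  let ?S = "{{\<mu>. prob_space \<mu> \<and> sets \<mu> = sets borel \<and> (\<integral>x. f x \<partial>\<mu>) \<in> U} | (f :: 'a \<Rightarrow> real) U.
        continuous_on UNIV f \<and> bounded (range f) \<and> open U}"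
  have "\<forall>\<^sub>F n in sequentially. \<mu> n \<in> W" if "generate_topology_on ?S W" "\<nu> \<in> W" for W
    using that
  proof (induction rule: generate_topology_on.induct)
    case Empty
    then show ?case by simp
  next
    case (Int a b)
    then show ?case by (auto intro: eventually_conj)
  next
    case (UN K)
    then obtain k where "k \<in> K" "\<nu> \<in> k" by blast
    with UN.IH have "\<forall>\<^sub>F n in sequentially. \<mu> n \<in> k" by blast
    then show ?case
      by eventually_elim (use \<open>k \<in> K\<close> in blast)
  next
    case (Basis s)
    then obtain f :: "'a \<Rightarrow> real" and U where
      s: "s = {\<mu>. prob_space \<mu> \<and> sets \<mu> = sets borel \<and> (\<integral>x. f x \<partial>\<mu>) \<in> U}"
      and f: "continuous_on UNIV f" "bounded (range f)" and U: "open U"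
      by auto
    from R f have "(\<lambda>n. \<integral>x. f x \<partial>\<mu> n) \<longlonglongrightarrow> (\<integral>x. f x \<partial>\<nu>)" by blast
    moreover have "(\<integral>x. f x \<partial>\<nu>) \<in> U" using Basis s by simp
    ultimately have "\<forall>\<^sub>F n in sequentially. (\<integral>x. f x \<partial>\<mu> n) \<in> U"
      using U by (simp add: tendsto_def)
    with \<mu> show ?case
      by eventually_elim (simp add: s)
  qed
  then show "limitin weak_topology \<mu> \<nu> sequentially"
    unfolding limitin_def using \<nu>
    by (simp add: topspace_weak_topology) (simp add: weak_topology_def openin_topology_generated_by_iff)
qed

text \<open>Convergence in probability to a non-random point \<open>c\<close>; \<open>Y n\<close> lives on its own probability
  space \<open>M n\<close>.  Only the indices \<open>n \<ge> 1\<close> are meaningful.\<close>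

definition tends_in_prob ::
    "'s topology \<Rightarrow> (nat \<Rightarrow> 'a measure) \<Rightarrow> (nat \<Rightarrow> 'a \<Rightarrow> 's) \<Rightarrow> 's \<Rightarrow> bool" where
  "tends_in_prob S M Y c \<longleftrightarrow>
     c \<in> topspace S \<and>
     (\<forall>n\<ge>1. \<forall>U. openin S U \<longrightarrow> {\<omega> \<in> space (M n). Y n \<omega> \<in> U} \<in> sets (M n)) \<and>
     (\<forall>U. openin S U \<and> c \<in> U \<longrightarrow>
        (\<lambda>n. measure (M n) {\<omega> \<in> space (M n). Y n \<omega> \<notin> U}) \<longlonglongrightarrow> 0)"

lemma tends_in_prob_metric:
  fixes Y :: "nat \<Rightarrow> 'a \<Rightarrow> 's::metric_space"
  assumes M: "\<And>n. n \<ge> 1 \<Longrightarrow> prob_space (M n)"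
  shows "tends_in_prob euclidean M Y c \<longleftrightarrow>
    (\<forall>n\<ge>1. Y n \<in> borel_measurable (M n)) \<and>
    (\<forall>\<epsilon>>0. (\<lambda>n. measure (M n) {\<omega> \<in> space (M n). dist (Y n \<omega>) c \<ge> \<epsilon>}) \<longlonglongrightarrow> 0)"
    (is "?L \<longleftrightarrow> ?R")
proof -
  have meas: "(\<forall>n\<ge>1. \<forall>U. openin euclidean U \<longrightarrow> {\<omega> \<in> space (M n). Y n \<omega> \<in> U} \<in> sets (M n))
      \<longleftrightarrow> (\<forall>n\<ge>1. Y n \<in> borel_measurable (M n))"
  proof (intro iffI allI impI)
    fix n :: nat and U :: "'s set"
    assume *: "\<forall>n\<ge>1. Y n \<in> borel_measurable (M n)" and "1 \<le> n" "openin euclidean U"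
    then have [measurable]: "Y n \<in> borel_measurable (M n)" "U \<in> sets borel" by auto
    show "{\<omega> \<in> space (M n). Y n \<omega> \<in> U} \<in> sets (M n)" by measurable
  qed (auto simp: vimage_def Int_def conj_commute intro!: borel_measurableI)
  show ?thesis
  proof
    assume L: ?L
    have "(\<lambda>n. measure (M n) {\<omega> \<in> space (M n). dist (Y n \<omega>) c \<ge> \<epsilon>}) \<longlonglongrightarrow> 0" if "\<epsilon> > 0" for \<epsilon>
    proof -
      have "(\<lambda>n. measure (M n) {\<omega> \<in> space (M n). Y n \<omega> \<notin> ball c \<epsilon>}) \<longlonglongrightarrow> 0"
        using L that open_ball[of c \<epsilon>] centre_in_ball[of c \<epsilon>]
        unfolding tends_in_prob_def open_openin[symmetric] by blast
      then show ?thesis by (simp add: dist_commute not_less)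
    qed
    with L meas show ?R unfolding tends_in_prob_def by blast
  next
    assume R: ?R
    have "(\<lambda>n. measure (M n) {\<omega> \<in> space (M n). Y n \<omega> \<notin> U}) \<longlonglongrightarrow> 0"
      if U: "open U" "c \<in> U" for U
    proof -
      from U obtain \<epsilon> where e: "\<epsilon> > 0" "ball c \<epsilon> \<subseteq> U"
        using open_contains_ball by blast
      have "\<forall>\<^sub>F n in sequentially. norm (measure (M n) {\<omega> \<in> space (M n). Y n \<omega> \<notin> U}) \<le>
          measure (M n) {\<omega> \<in> space (M n). dist (Y n \<omega>) c \<ge> \<epsilon>}"
        using eventually_ge_at_top[of 1]
      proof eventually_elim
        case (elim n)
        then interpret prob_space "M n" by (rule M)
        have [measurable]: "Y n \<in> borel_measurable (M n)" using R elim by blast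
        have "{\<omega> \<in> space (M n). Y n \<omega> \<in> - ball c \<epsilon>} \<in> sets (M n)" by measurable
        then have "{\<omega> \<in> space (M n). dist (Y n \<omega>) c \<ge> \<epsilon>} \<in> sets (M n)"
          by (simp add: dist_commute not_less)
        moreover have "{\<omega> \<in> space (M n). Y n \<omega> \<notin> U} \<subseteq> {\<omega> \<in> space (M n). dist (Y n \<omega>) c \<ge> \<epsilon>}"
          using e by (auto simp: dist_commute subset_iff not_less[symmetric])
        ultimately show ?case by (simp add: finite_measure_mono)
      qed
      moreover have "(\<lambda>n. measure (M n) {\<omega> \<in> space (M n). dist (Y n \<omega>) c \<ge> \<epsilon>}) \<longlonglongrightarrow> 0"
        using R e by blast
      ultimately show ?thesis
        by (rule Lim_null_comparison)
    qed
    with R meas show ?L unfolding tends_in_prob_def by simp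
  qed
qed


section \<open>Graph distance in subtrees of the infinite ordered tree\<close>

text \<open>The children of a vertex are indexed by the elements of the finite type \<open>'b\<close>, so
  \<open>b = CARD('b)\<close>.  A vertex is the list of child indices on the path from the root, the last
  step first: \<open>i # v\<close> is the \<open>i\<close>-th child of \<open>v\<close>.\<close>

definition tree_edges :: "'b list set \<Rightarrow> ('b list \<times> 'b list) set" where
  "tree_edges T = {(u, v). u \<in> T \<and> v \<in> T \<and> (\<exists>i. u = i # v \<or> v = i # u)}"

definition graph_dist :: "'b list set \<Rightarrow> 'b list \<Rightarrow> 'b list \<Rightarrow> nat" where
  "graph_dist T u v = (LEAST k. (u, v) \<in> tree_edges T ^^ k)"


section \<open>Sampling measures of trees and long dendrons\<close>

text \<open>Infinite matrices are functions \<open>nat \<Rightarrow> nat \<Rightarrow> real\<close> with the product topology; rows and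
  columns are numbered from 0.  The measure \<open>\<tau>\<^sub>\<infinity>(cT)\<close> is meaningful for finite nonempty \<open>T\<close>; otherwise
  it is the point mass at the zero matrix, so that every value is a Borel probability measure.\<close>

definition sampling_measure :: "real \<Rightarrow> 'b list set \<Rightarrow> (nat \<Rightarrow> nat \<Rightarrow> real) measure" where
  "sampling_measure c T =
     (if finite T \<and> T \<noteq> {} then
        distr (\<Pi>\<^sub>M i\<in>(UNIV :: nat set). measure_pmf (pmf_of_set T)) borel
          (\<lambda>\<xi> i j. if i = j then 0 else c * real (graph_dist T (\<xi> i) (\<xi> j)))
      else return borel (\<lambda>_ _. 0))"

text \<open>A long dendron is a real tree with metric \<open>d\<close> together with a probability measure on
  (tree) \<open>\<times> [0, \<infinity>)\<close>; two sample points \<open>(x, s)\<close> and \<open>(y, t)\<close> are at distance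
  \<open>d x y + s + t\<close>.\<close>

type_synonym 'x long_dendron = "('x \<Rightarrow> 'x \<Rightarrow> real) \<times> ('x \<times> real) measure"

definition dendron_sampling_measure :: "'x long_dendron \<Rightarrow> (nat \<Rightarrow> nat \<Rightarrow> real) measure" where
  "dendron_sampling_measure D =
     distr (\<Pi>\<^sub>M i\<in>(UNIV :: nat set). snd D) borel
       (\<lambda>p i j. if i = j then 0 else fst D (fst (p i)) (fst (p j)) + snd (p i) + snd (p j))"

definition Upsilon :: "real \<Rightarrow> unit long_dendron" where
  "Upsilon a = ((\<lambda>_ _. 0), return (count_space UNIV \<Otimes>\<^sub>M borel) ((), a))"

lemma measurable_matrixI:
  fixes f :: "'a \<Rightarrow> nat \<Rightarrow> nat \<Rightarrow> real"
  assumes "\<And>i j. (\<lambda>\<omega>. f \<omega> i j) \<in> borel_measurable M"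
  shows "f \<in> borel_measurable M"
  using assms by (intro measurable_coordinatewise_then_product)

lemma dendron_sampling_measure_Upsilon:
  "dendron_sampling_measure (Upsilon a) = return borel (\<lambda>i j. if i = j then 0 else 2 * a)"
proof -
  let ?R = "return (count_space UNIV \<Otimes>\<^sub>M borel) ((), a)"
  let ?P = "\<Pi>\<^sub>M i\<in>(UNIV :: nat set). ?R"
  let ?f = "\<lambda>p :: nat \<Rightarrow> unit \<times> real. \<lambda>i j.
    if i = j then 0 else (\<lambda>_ _. 0) (fst (p i)) (fst (p j)) + snd (p i) + snd (p j)"
  let ?c = "\<lambda>i j :: nat. if i = j then 0 else 2 * a"
  interpret R: prob_space ?R by (intro prob_space_return) (simp add: space_pair_measure)
  interpret P: product_prob_space "\<lambda>_. ?R" "UNIV :: nat set" ..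
  have coord: "AE p in ?P. snd (p i) = a" for i
  proof -
    have "AE x in ?R. snd x = a"
      by (subst AE_return) (auto simp: space_pair_measure)
    then have "AE x in distr ?P ?R (\<lambda>p. p i). snd x = a"
      by (subst P.PiM_component) auto
    moreover have "(\<lambda>p. p i) \<in> measurable ?P ?R"
      by (rule measurable_component_singleton) simp
    ultimately show ?thesis by (subst (asm) AE_distr_iff) auto
  qed
  then have "AE p in ?P. \<forall>i. snd (p i) = a" by (simp add: AE_all_countable)
  then have ae: "AE p in ?P. ?f p = ?c"
    by eventually_elim (auto simp: fun_eq_iff)
  have [measurable]: "(\<lambda>p. snd (p i)) \<in> borel_measurable ?P" for i
  proof (rule measurable_compose[where f = "\<lambda>p. p i" and g = snd])
    show "(\<lambda>p. p i) \<in> measurable ?P ?R"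
      by (rule measurable_component_singleton) simp
    show "snd \<in> borel_measurable ?R" by simp
  qed
  have [measurable]: "?f \<in> borel_measurable ?P"
  proof (rule measurable_matrixI)
    show "(\<lambda>p. ?f p i j) \<in> borel_measurable ?P" for i j
      by (cases "i = j") simp_all
  qed
  have "distr ?P borel ?f = distr ?P borel (\<lambda>_. ?c)"
    by (intro distr_cong_AE ae) auto
  also have "\<dots> = return borel ?c"
    by (intro P.distr_const) auto
  finally show ?thesis
    unfolding dendron_sampling_measure_def Upsilon_def fst_conv snd_conv .
qed


section \<open>Generalized split trees\<close>

text \<open>The law of the split vector \<open>\<N>\<^sup>(\<^sup>n\<^sup>)\<close> is \<open>N n\<close>.  Vectors \<open>(x\<^sub>0, \<dots>, x\<^sub>b)\<close> are functions on
  \<open>'b option\<close>: the component \<open>x\<^sub>0\<close> is \<open>x None\<close> and the components of the children are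
  \<open>x (Some i)\<close>.\<close>

definition split_vectors :: "(nat \<Rightarrow> ('b::finite option \<Rightarrow> nat) pmf) \<Rightarrow> bool" where
  "split_vectors N \<longleftrightarrow> (\<forall>n\<ge>1. \<forall>x \<in> set_pmf (N n). (\<Sum>i\<in>UNIV. x i) = n)"

definition ST1 :: "(nat \<Rightarrow> ('b::finite option \<Rightarrow> nat) pmf) \<Rightarrow> bool" where
  "ST1 N \<longleftrightarrow> (\<exists>C\<^sub>0. \<forall>n\<ge>1. \<forall>x \<in> set_pmf (N n). x None \<le> C\<^sub>0)"

text \<open>\<open>V\<close> is the law of the asymptotic split vector.\<close>

definition ST2 ::
    "(nat \<Rightarrow> ('b::finite option \<Rightarrow> nat) pmf) \<Rightarrow> ('b option \<Rightarrow> real) measure \<Rightarrow> bool" where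
  "ST2 N V \<longleftrightarrow>
     limitin weak_topology
       (\<lambda>n. distr (measure_pmf (N n)) borel (\<lambda>x i. real (x i) / real n)) V sequentially"

definition ST3 ::
    "(nat \<Rightarrow> ('b::finite option \<Rightarrow> nat) pmf) \<Rightarrow> ('b option \<Rightarrow> real) measure \<Rightarrow> bool" where
  "ST3 N V \<longleftrightarrow>
     (\<forall>n\<ge>1. measure_pmf.prob (N n) {x. Max (range (\<lambda>i. x (Some i))) = n} < 1) \<and>
     measure V {x. Max (range (\<lambda>i. x (Some i))) = 1} < 1"

text \<open>The convention \<open>0 log (1/0) = 0\<close> is built in, as the summand contains the factor \<open>0\<close>.\<close>

definition split_entropy :: "('b::finite option \<Rightarrow> real) measure \<Rightarrow> real" where
  "split_entropy V = (\<Sum>i\<in>UNIV. \<integral>x. x (Some i) * ln (1 / x (Some i)) \<partial>V)"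

text \<open>Here \<open>x v m\<close> is the split vector used at the vertex \<open>v\<close> if \<open>v\<close> receives \<open>m \<ge> 1\<close> balls.\<close>

primrec num_balls :: "nat \<Rightarrow> ('b list \<Rightarrow> nat \<Rightarrow> 'b option \<Rightarrow> nat) \<Rightarrow> 'b list \<Rightarrow> nat" where
  "num_balls n x [] = n"
| "num_balls n x (i # v) =
     (if num_balls n x v = 0 then 0 else x v (num_balls n x v) (Some i))"

definition split_tree :: "nat \<Rightarrow> ('b list \<Rightarrow> nat \<Rightarrow> 'b option \<Rightarrow> nat) \<Rightarrow> 'b list set" where
  "split_tree n x = {v. num_balls n x v \<ge> 1}"

text \<open>\<open>T\<close> is a random generalized split tree with \<open>n\<close> balls on the probability space \<open>M\<close>: it is
  built from independent \<open>X v m\<close> (over all vertices \<open>v\<close> and \<open>m \<ge> 1\<close>), where \<open>X v m\<close> has the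
  law \<open>N m\<close>.  At each vertex at most one of the \<open>X v m\<close> is actually used.\<close>

definition random_split_tree ::
    "(nat \<Rightarrow> ('b::finite option \<Rightarrow> nat) pmf) \<Rightarrow> nat \<Rightarrow> 'a measure \<Rightarrow> ('a \<Rightarrow> 'b list set) \<Rightarrow> bool" where
  "random_split_tree N n M T \<longleftrightarrow>
     prob_space M \<and>
     (\<exists>X :: 'b list \<Rightarrow> nat \<Rightarrow> 'a \<Rightarrow> 'b option \<Rightarrow> nat.
        prob_space.indep_vars M (\<lambda>_. count_space UNIV) (\<lambda>(v, m). X v m) (UNIV \<times> {1..}) \<and>
        (\<forall>v. \<forall>m\<ge>1. distr M (count_space UNIV) (X v m) = measure_pmf (N m)) \<and>
        (\<forall>\<omega> \<in> space M. T \<omega> = split_tree n (\<lambda>v m. X v m \<omega>)))"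

text \<open>Conditionally on \<open>T\<close>, the vertices \<open>\<xi>\<^sub>1\<close> and \<open>\<xi>\<^sub>2\<close> are i.i.d. uniform on \<open>T\<close>.  This is stated
  by elementary conditioning, since there are only countably many finite trees; it determines the
  joint law when \<open>T\<close> is almost surely finite.\<close>

definition iid_uniform_vertices ::
    "'a measure \<Rightarrow> ('a \<Rightarrow> 'b list set) \<Rightarrow> ('a \<Rightarrow> 'b list) \<Rightarrow> ('a \<Rightarrow> 'b list) \<Rightarrow> bool" where
  "iid_uniform_vertices M T \<xi>\<^sub>1 \<xi>\<^sub>2 \<longleftrightarrow>
     \<xi>\<^sub>1 \<in> measurable M (count_space UNIV) \<and> \<xi>\<^sub>2 \<in> measurable M (count_space UNIV) \<and>
     (\<forall>t. finite t \<longrightarrow> (\<forall>u\<in>t. \<forall>v\<in>t.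
        measure M {\<omega> \<in> space M. T \<omega> = t \<and> \<xi>\<^sub>1 \<omega> = u \<and> \<xi>\<^sub>2 \<omega> = v} =
        measure M {\<omega> \<in> space M. T \<omega> = t} * (1 / real (card t)) * (1 / real (card t))))"

end

theory Submission
  imports Defs "HOL-Library.Sublist" "HOL-Real_Asymp.Real_Asymp"
begin

text \<open>The proof only uses first moments.  Write \<open>n\<^sub>v\<close> for the number of balls that reach the vertex \<open>v\<close>.  If
  \<open>\<phi> 0 = 0\<close> and \<open>E \<Sum>\<^sub>i \<phi> (N\<^sub>i\<^sup>(\<^sup>m\<^sup>)) \<le> \<rho> \<phi> m\<close> for all \<open>m \<ge> 1\<close>, then \<open>E \<Sum>\<^sub>|\<^sub>v\<^sub>|\<^sub>=\<^sub>k \<phi> (n\<^sub>v) \<le> \<rho>\<^sup>k \<phi> n\<close>.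
  Since \<open>E \<Sum>\<^sub>i V\<^sub>i\<^sup>1\<^sup>+\<^sup>t = 1 - t \<chi> + O(t\<^sup>2)\<close>, suitable \<open>\<phi> m\<close> of order \<open>m\<^sup>1\<^sup>+\<^sup>t\<close>, with small \<open>t > 0\<close> and small \<open>t < 0\<close>,
  show that the expected number of vertices whose depth differs from \<open>log n / \<chi>\<close> by at least \<open>\<epsilon> log n\<close> is
  \<open>o(n)\<close>, whereas the tree has at least \<open>n / C\<^sub>0\<close> vertices.

  Two such vertices are at distance about \<open>2 log n / \<chi>\<close> unless they have a common ancestor \<open>w\<close> at depth
  \<open>k = \<epsilon> log n\<close>.  As each generation below \<open>w\<close> has at most \<open>n\<^sub>w\<close> vertices, the number of exceptional pairs is at most
  \<open>O(log\<^sup>2 n) \<Sum>\<^sub>|\<^sub>w\<^sub>|\<^sub>=\<^sub>k n\<^sub>w\<^sup>2\<close>, whose expectation is at most \<open>O(log\<^sup>2 n) s\<^sup>k n\<^sup>2 = o(n\<^sup>2)\<close> with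
  \<open>s = sup\<^sub>m E \<Sum>\<^sub>i (N\<^sub>i\<^sup>(\<^sup>m\<^sup>) / m)\<^sup>2 < 1\<close>.  So the fraction of pairs of vertices at an untypical distance tends
  to 0 in expectation, and this gives both claims.\<close>

section \<open>Distances and ball counts in a fixed tree\<close>

text \<open>(ST2) says nothing about vectors with few balls, whereas the recursion always ends at
  vertices with few balls. A rate read off from the limit law therefore holds only above some
  threshold, and (ST3) has to handle the finitely many ball numbers m below it: each of them has E
  \<Sum> (N_i / m)^2 < 1. This is why the weight \<phi> is a minimum of two powers instead of a
  single one. For t < 0 the rate exceeds 1, and the plain bound \<Sum> N_i \<le> m suffices below
  the threshold.

  The exponent t only has to be small: moving the slope away from \<chi> gains a term linear in t,
  while the error of the expansion is quadratic. A generation number off by \<epsilon> log n then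
  costs a factor n^(-c), which absorbs all powers of log n.

  The lower bound for the size of the tree holds pathwise, since each vertex keeps at most C_0
  balls. Hence an expected number of vertices of order o(n) is directly an expected fraction of
  order o(1).\<close>

lemma finite_level [simp]: "finite {v :: 'b::finite list. length v = k}"
  using finite_lists_length_eq[of "UNIV :: 'b set" k] by simp

lemma bounded_length_of_finite:
  assumes "finite T"
  shows "\<exists>k. \<forall>v\<in>T. length v < k"
proof -
  have "finite (length ` T)" using assms by simp
  then obtain k where "\<forall>l\<in>length ` T. l < k" using finite_nat_set_iff_bounded by blast
  then show ?thesis by blast
qed

lemma sum_level_Suc:
  fixes f :: "'b::finite list \<Rightarrow> 'c::comm_monoid_add"
  shows "(\<Sum>v | length v = Suc k. f v) = (\<Sum>v | length v = k. \<Sum>i\<in>UNIV. f (i # v))"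
proof -
  have "(\<Sum>v | length v = k. \<Sum>i\<in>UNIV. f (i # v)) = (\<Sum>(v, i)\<in>{v. length v = k} \<times> UNIV. f (i # v))"
    by (rule sum.cartesian_product)
  also have "\<dots> = (\<Sum>v | length v = Suc k. f v)"
    by (rule sum.reindex_bij_witness[where i = "\<lambda>v. (tl v, hd v)" and j = "\<lambda>(v, i). i # v"])
      (auto simp: length_Suc_conv)
  finally show ?thesis by simp
qed

lemma tree_edges_relpow_sym:
  assumes "(u, v) \<in> tree_edges T ^^ k"
  shows "(v, u) \<in> tree_edges T ^^ k"
  using assms
proof (induction k arbitrary: v)
  case (Suc k)
  then obtain w where "(u, w) \<in> tree_edges T ^^ k" and w: "(w, v) \<in> tree_edges T" by auto
  then have "(w, u) \<in> tree_edges T ^^ k" using Suc.IH by blast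
  moreover have "(v, w) \<in> tree_edges T" using w by (auto simp: tree_edges_def)
  ultimately show ?case by (rule relpow_Suc_I2[rotated])
qed simp

text \<open>The ancestors of a vertex are its suffixes, so a nonempty set of this kind is a subtree
  containing the root.\<close>

definition suffix_closed :: "'b list set \<Rightarrow> bool" where
  "suffix_closed T \<longleftrightarrow> (\<forall>i v. i # v \<in> T \<longrightarrow> v \<in> T)"

lemma suffix_closed_append: "suffix_closed T \<Longrightarrow> u @ c \<in> T \<Longrightarrow> c \<in> T"
  by (induction u) (auto simp: suffix_closed_def)

lemma tree_edges_relpow_ancestor:
  assumes "suffix_closed T" "u @ c \<in> T"
  shows "(u @ c, c) \<in> tree_edges T ^^ length u"
  using assms(2)
proof (induction u)
  case (Cons i u)
  then have "u @ c \<in> T" using assms(1) by (auto simp: suffix_closed_def)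
  then have "(i # u @ c, u @ c) \<in> tree_edges T" "(u @ c, c) \<in> tree_edges T ^^ length u"
    using Cons by (auto simp: tree_edges_def)
  then show ?case by (simp only: append_Cons length_Cons) (rule relpow_Suc_I2)
qed simp

lemma tree_edges_relpow_common_suffix:
  assumes "suffix_closed T" "u \<in> T" "v \<in> T" "suffix c u" "suffix c v"
    and "length u + length v = k + 2 * length c"
  shows "(u, v) \<in> tree_edges T ^^ k"
proof -
  obtain u' v' where uv: "u = u' @ c" "v = v' @ c" using assms by (auto simp: suffix_def)
  have "(u, c) \<in> tree_edges T ^^ length u'" "(c, v) \<in> tree_edges T ^^ length v'"
    using assms uv tree_edges_relpow_ancestor tree_edges_relpow_sym by blast+
  moreover have "k = length u' + length v'" using assms uv by simp
  ultimately show ?thesis by (auto simp: relpow_add)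
qed

text \<open>A common ancestor \<open>c\<close> of the start and the current point is carried along
  the walk. It must be shortened only when the walk moves from \<open>c\<close> itself to its
  parent, and then one more step pays for the loss. No closure of \<open>T\<close> is assumed, so
  this is the lower bound for the distance.\<close>

lemma common_suffix_of_relpow:
  assumes "(u, v) \<in> tree_edges T ^^ k"
  shows "\<exists>c. suffix c u \<and> suffix c v \<and> length u + length v \<le> k + 2 * length c"
  using assms
proof (induction k arbitrary: v)
  case (Suc k)
  then obtain w where w: "(u, w) \<in> tree_edges T ^^ k" "(w, v) \<in> tree_edges T" by auto
  from Suc.IH[OF w(1)] obtain c where
    c: "suffix c u" "suffix c w" "length u + length w \<le> k + 2 * length c" by blast
  from w(2) consider i where "v = i # w" | i where "w = i # v"
    by (auto simp: tree_edges_def)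
  then show ?case
  proof cases
    case 1
    then show ?thesis using c by (intro exI[of _ c]) (auto simp: suffix_Cons)
  next
    case 2
    show ?thesis
    proof (cases "c = w")
      case True
      then show ?thesis using 2 c by (intro exI[of _ v]) (auto simp: suffix_ConsD)
    next
      case False
      then show ?thesis using 2 c by (intro exI[of _ c]) (auto simp: suffix_Cons)
    qed
  qed
qed auto

text \<open>The least \<open>k\<close> belongs to the longest common suffix. The right side does not
  mention \<open>T\<close>: distances inside a subtree are those of the infinite tree, which later
  makes the distance measurable.\<close>

lemma graph_dist_common_suffix:
  assumes T: "suffix_closed T" "u \<in> T" "v \<in> T"
  shows "graph_dist T u v =
    (LEAST k. \<exists>c. suffix c u \<and> suffix c v \<and> length u + length v = k + 2 * length c)"
    (is "_ = (LEAST k. ?P k)")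
proof -
  have P: "?P (length u + length v)" by (intro exI[of _ "[]"]) simp
  show ?thesis
    unfolding graph_dist_def
  proof (rule Least_equality)
    from LeastI[of ?P, OF P] obtain c where "suffix c u" "suffix c v"
      "length u + length v = (LEAST k. ?P k) + 2 * length c" by blast
    then show "(u, v) \<in> tree_edges T ^^ (LEAST k. ?P k)"
      by (rule tree_edges_relpow_common_suffix[OF T])
  next
    fix l assume "(u, v) \<in> tree_edges T ^^ l"
    from common_suffix_of_relpow[OF this] obtain c where
      c: "suffix c u" "suffix c v" "length u + length v \<le> l + 2 * length c" by blast
    have "length c \<le> length u" "length c \<le> length v"
      using c suffix_length_le by blast+
    with c have "?P (length u + length v - 2 * length c)" by (intro exI[of _ c]) auto
    from Least_le[of ?P, OF this] show "(LEAST k. ?P k) \<le> l" using c(3) by linarith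
  qed
qed

lemma graph_dist_witness:
  assumes T: "suffix_closed T" "u \<in> T" "v \<in> T"
  obtains c where "suffix c u" "suffix c v" "length u + length v = graph_dist T u v + 2 * length c"
proof -
  let ?P = "\<lambda>k. \<exists>c. suffix c u \<and> suffix c v \<and> length u + length v = k + 2 * length c"
  have P: "?P (length u + length v)" by (intro exI[of _ "[]"]) simp
  from LeastI[of ?P, OF P] that show ?thesis
    unfolding graph_dist_common_suffix[OF T] by blast
qed

text \<open>Only the empty walk can start or end outside the tree, so the default value depends on
  \<open>u\<close> and \<open>v\<close> alone. The sampled vertices lie in the tree only almost
  surely, but measurability is required at every sample point.\<close>

lemma graph_dist_outside:
  assumes "u \<notin> T \<or> v \<notin> T"
  shows "graph_dist T u v = graph_dist {} u v"
proof -
  have "(u, v) \<in> tree_edges T ^^ k \<longleftrightarrow> (u, v) \<in> tree_edges {} ^^ k" for k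
  proof (cases k)
    case (Suc l)
    have "(u, v) \<notin> tree_edges T ^^ Suc l" 
    proof
      assume A: "(u, v) \<in> tree_edges T ^^ Suc l"
      then have "v \<in> T" by (auto simp: tree_edges_def)
      moreover have "u \<in> T" using relpow_Suc_D2[OF A] by (auto simp: tree_edges_def)
      ultimately show False using assms by simp
    qed
    moreover have "(u, v) \<notin> tree_edges {} ^^ Suc l" by (auto simp: tree_edges_def)
    ultimately show ?thesis using Suc by blast
  qed simp
  then show ?thesis by (simp add: graph_dist_def)
qed

lemma suffix_closed_split_tree [simp]: "suffix_closed (split_tree n x)"
  by (auto simp: suffix_closed_def split_tree_def split: if_splits)

lemma Nil_in_split_tree: "n \<ge> 1 \<Longrightarrow> [] \<in> split_tree n x"
  by (simp add: split_tree_def)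

section \<open>Conservation of balls\<close>

lemma sum_UNIV_option:
  "(\<Sum>i\<in>UNIV. f i) = f None + (\<Sum>i\<in>UNIV. f (Some i :: 'b::finite option))"
  unfolding UNIV_option_conv by (subst sum.insert) (auto simp: sum.reindex)

definition ball_conserving :: "('b::finite list \<Rightarrow> nat \<Rightarrow> 'b option \<Rightarrow> nat) \<Rightarrow> bool" where
  "ball_conserving x \<longleftrightarrow> (\<forall>v. \<forall>m\<ge>1. (\<Sum>i\<in>UNIV. x v m i) = m)"

lemma num_balls_split:
  assumes "ball_conserving x"
  shows "num_balls n x v =
    (if v \<in> split_tree n x then x v (num_balls n x v) None else 0) + (\<Sum>i\<in>UNIV. num_balls n x (i # v))"
proof (cases "num_balls n x v = 0")
  case False
  then have "(\<Sum>i\<in>UNIV. x v (num_balls n x v) i) = num_balls n x v"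
    using assms by (auto simp: ball_conserving_def)
  with False show ?thesis by (simp add: sum_UNIV_option split_tree_def)
qed (simp add: split_tree_def)

lemma sum_num_balls_descendants_le:
  assumes "ball_conserving x"
  shows "(\<Sum>u | length u = j. num_balls n x (u @ w)) \<le> num_balls n x w"
proof (induction j)
  case (Suc j)
  have "(\<Sum>u | length u = Suc j. num_balls n x (u @ w))
      = (\<Sum>u | length u = j. \<Sum>i\<in>UNIV. num_balls n x (i # u @ w))"
    by (simp add: sum_level_Suc del: num_balls.simps)
  also have "\<dots> \<le> (\<Sum>u | length u = j. num_balls n x (u @ w))"
    by (intro sum_mono) (subst (2) num_balls_split[OF assms], simp del: num_balls.simps)
  also note Suc.IH
  finally show ?case .
qed simp

text \<open>Every ball has either stopped before generation \<open>k\<close>, where each vertex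
  keeps at most \<open>C\<close>, or is still present in generation \<open>k\<close>. In a finite
  tree some generation is empty, so all balls have stopped.\<close>

lemma num_balls_le_card_tree:
  assumes x: "ball_conserving x" and C: "\<And>v m. m \<ge> 1 \<Longrightarrow> x v m None \<le> C"
    and fin: "finite (split_tree n x)"
  shows "n \<le> C * card (split_tree n x)"
proof -
  let ?T = "split_tree n x"
  have step: "(\<Sum>v | length v = k. num_balls n x v)
      \<le> C * card {v \<in> ?T. length v = k} + (\<Sum>v | length v = Suc k. num_balls n x v)" for k
  proof -
    have "(\<Sum>v | length v = k. num_balls n x v)
        = (\<Sum>v | length v = k. if v \<in> ?T then x v (num_balls n x v) None else 0)
          + (\<Sum>v | length v = Suc k. num_balls n x v)"
      unfolding sum_level_Suc sum.distrib[symmetric]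
      by (intro sum.cong refl num_balls_split[OF x])
    also have "(\<Sum>v | length v = k. if v \<in> ?T then x v (num_balls n x v) None else 0)
        \<le> (\<Sum>v | length v = k. if v \<in> ?T then C else 0)"
      by (intro sum_mono) (auto simp: split_tree_def intro!: C)
    also have "\<dots> = C * card {v \<in> ?T. length v = k}"
      by (subst sum.inter_filter[symmetric]) (auto intro!: arg_cong[where f = card])
    finally show ?thesis by simp
  qed
  have le: "n \<le> C * card {v \<in> ?T. length v < k} + (\<Sum>v | length v = k. num_balls n x v)" for k
  proof (induction k)
    case 0
    then show ?case by simp
  next
    case (Suc k)
    have "{v \<in> ?T. length v < Suc k} = {v \<in> ?T. length v < k} \<union> {v \<in> ?T. length v = k}"
      by auto
    then have "card {v \<in> ?T. length v < Suc k}
        = card {v \<in> ?T. length v < k} + card {v \<in> ?T. length v = k}"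
      using fin by (simp add: card_Un_disjoint disjoint_iff)
    then show ?case using Suc step[of k] by (simp add: algebra_simps)
  qed
  obtain k where k: "\<And>v. v \<in> ?T \<Longrightarrow> length v < k"
    using bounded_length_of_finite[OF fin] by blast
  then have "num_balls n x v = 0" if "length v = k" for v
    using that k[of v] by (cases "num_balls n x v") (auto simp: split_tree_def)
  then have "(\<Sum>v | length v = k. num_balls n x v) = 0" by (simp del: num_balls.simps)
  moreover have "card {v \<in> ?T. length v < k} \<le> card ?T" by (intro card_mono fin) auto
  ultimately show ?thesis using le[of k] mult_le_mono2 order_trans by (metis add_0_right)
qed

text \<open>The vertices of one generation below \<open>w\<close> hold disjoint nonempty groups of
  the balls that reached \<open>w\<close>, so each of the \<open>H\<close> generations has at most
  \<open>num_balls n x w\<close> of them.\<close>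

lemma card_descendants_le:
  assumes x: "ball_conserving x" 
  shows "card {v \<in> split_tree n x. suffix w v \<and> length v < H} \<le> H * num_balls n x w"
    (is "card ?A \<le> _")
proof -
  have sub: "?A \<subseteq> (\<Union>j<H. (\<lambda>u. u @ w) ` {u. length u = j \<and> u @ w \<in> split_tree n x})"
  proof
    fix v assume "v \<in> ?A"
    then obtain u where "v = u @ w" "v \<in> split_tree n x" "length v < H" by (auto simp: suffix_def)
    then show "v \<in> (\<Union>j<H. (\<lambda>u. u @ w) ` {u. length u = j \<and> u @ w \<in> split_tree n x})"
      by (intro UN_I[of "length u"]) auto
  qed
  have fin: "finite {u. length u = j \<and> u @ w \<in> split_tree n x}" for j
    by (rule finite_subset[OF _ finite_level[of j]]) auto
  have "card {u. length u = j \<and> u @ w \<in> split_tree n x} \<le> num_balls n x w" for j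
  proof -
    have "card {u. length u = j \<and> u @ w \<in> split_tree n x}
        = (\<Sum>u | length u = j \<and> u @ w \<in> split_tree n x. 1)" by simp
    also have "\<dots> \<le> (\<Sum>u | length u = j \<and> u @ w \<in> split_tree n x. num_balls n x (u @ w))"
      by (intro sum_mono) (auto simp: split_tree_def)
    also have "\<dots> \<le> (\<Sum>u | length u = j. num_balls n x (u @ w))"
      by (intro sum_mono2) auto
    also note sum_num_balls_descendants_le[OF x]
    finally show ?thesis .
  qed
  then have le: "card ((\<lambda>u. u @ w) ` {u. length u = j \<and> u @ w \<in> split_tree n x}) \<le> num_balls n x w" for j
    using card_image_le[OF fin] order_trans by blast
  have "card ?A \<le> card (\<Union>j<H. (\<lambda>u. u @ w) ` {u. length u = j \<and> u @ w \<in> split_tree n x})"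
    by (intro card_mono sub) (use fin in auto)
  also have "\<dots> \<le> (\<Sum>j<H. card ((\<lambda>u. u @ w) ` {u. length u = j \<and> u @ w \<in> split_tree n x}))"
    by (rule card_UN_le) simp
  also have "\<dots> \<le> (\<Sum>j<H. num_balls n x w)" by (intro sum_mono le)
  finally show ?thesis by simp
qed

text \<open>If both depths lie strictly between \<open>lo\<close> and \<open>hi\<close>, the
  distance is below \<open>2 * hi\<close> in any case, and it can only be as small as
  \<open>2 * lo - 2 * k\<close> if the deepest common ancestor has depth at least \<open>k\<close>.
  Restricting to depths below \<open>hi\<close> keeps the number of descendants of an ancestor under
  control.\<close>

lemma card_bad_pairs_le:
  assumes x: "ball_conserving x" and fin: "finite (split_tree n x)"
  defines "t \<equiv> split_tree n x"
  shows "real (card {(u, v) \<in> t \<times> t. real (graph_dist t u v) \<notin> {2 * lo - 2 * real k <..< 2 * hi}})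
    \<le> 2 * real (card t) * real (card {v \<in> t. real (length v) \<notin> {lo <..< hi}})
      + (\<Sum>w | length w = k. (real (nat \<lceil>hi\<rceil>) * real (num_balls n x w))\<^sup>2)"
proof -
  define D where "D = {v \<in> t. real (length v) \<notin> {lo <..< hi}}"
  define H where "H = nat \<lceil>hi\<rceil>"
  define A where "A w = {v \<in> t. suffix w v \<and> length v < H}" for w
  have fin': "finite t" "finite D" "finite (A w)" for w
    using fin by (auto simp: t_def D_def A_def)
  have "{(u, v) \<in> t \<times> t. real (graph_dist t u v) \<notin> {2 * lo - 2 * real k <..< 2 * hi}}
      \<subseteq> D \<times> t \<union> t \<times> D \<union> (\<Union>w\<in>{w. length w = k}. A w \<times> A w)" (is "?B \<subseteq> ?R")
  proof (rule subrelI)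
    fix u v assume "(u, v) \<in> ?B"
    then have uv: "u \<in> t" "v \<in> t"
      and bad: "real (graph_dist t u v) \<notin> {2 * lo - 2 * real k <..< 2 * hi}" by auto
    have sc: "suffix_closed t" by (simp add: t_def)
    show "(u, v) \<in> ?R"
    proof (rule ccontr)
      assume "(u, v) \<notin> ?R"
      then have nA: "(u, v) \<notin> (\<Union>w\<in>{w. length w = k}. A w \<times> A w)"
        and nD: "u \<notin> D" "v \<notin> D" using uv by blast+
      with uv have len: "lo < length u" "length u < hi" "lo < length v" "length v < hi"
        by (auto simp: D_def)
      obtain c where c: "suffix c u" "suffix c v"
        "length u + length v = graph_dist t u v + 2 * length c"
        using graph_dist_witness[OF sc uv] .
      from c(3) have c3: "real (length u) + real (length v) = real (graph_dist t u v) + 2 * real (length c)"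
        by (metis of_nat_add of_nat_mult of_nat_numeral)
      have "k \<le> length c"
      proof (rule ccontr)
        assume "\<not> k \<le> length c"
        then have "real (length c) \<le> real k" by simp
        then show False using bad c3 len by auto
      qed
      \<comment> \<open>The ancestor of \<open>c\<close> in generation exactly \<open>k\<close>, so
        that the union runs over a single generation.\<close>
      define w where "w = drop (length c - k) c"
      have w: "length w = k" "suffix w c" using \<open>k \<le> length c\<close> by (auto simp: w_def suffix_drop)
      have "length u < H" "length v < H" using len by (auto simp: H_def; linarith)+
      with w c uv have "u \<in> A w" "v \<in> A w" by (auto simp: A_def intro: suffix_order.trans)
      with nA w(1) show False by blast
    qed
  qed
  then have "card ?B \<le> card ?R" by (intro card_mono) (use fin' in auto)
  also have "\<dots> \<le> card (D \<times> t) + card (t \<times> D) + card (\<Union>w\<in>{w. length w = k}. A w \<times> A w)"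
    using card_Un_le[of "D \<times> t \<union> t \<times> D"] card_Un_le[of "D \<times> t" "t \<times> D"]
    by (meson add_mono order_refl order_trans)
  also have "card (\<Union>w\<in>{w. length w = k}. A w \<times> A w) \<le> (\<Sum>w | length w = k. card (A w \<times> A w))"
    by (rule card_UN_le) simp
  also have "\<dots> \<le> (\<Sum>w | length w = k. (H * num_balls n x w)\<^sup>2)"
    unfolding card_cartesian_product power2_eq_square
    by (intro sum_mono mult_mono) (auto simp: A_def t_def card_descendants_le[OF x])
  finally have "card ?B \<le> 2 * card t * card D + (\<Sum>w | length w = k. (H * num_balls n x w)\<^sup>2)"
    by (simp add: card_cartesian_product algebra_simps)
  then have "real (card ?B) \<le> real (2 * card t * card D + (\<Sum>w | length w = k. (H * num_balls n x w)\<^sup>2))"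
    using of_nat_le_iff by blast
  then show ?thesis by (simp add: H_def D_def)
qed

section \<open>First moments of the ball counts\<close>

lemma (in prob_space) indep_var_nn_integral:
  fixes f g :: "_ \<Rightarrow> ennreal"
  assumes ind: "indep_var S X T Y"
    and [measurable]: "f \<in> borel_measurable S" "g \<in> borel_measurable T"
  shows "(\<integral>\<^sup>+\<omega>. f (X \<omega>) * g (Y \<omega>) \<partial>M) = (\<integral>\<^sup>+\<omega>. f (X \<omega>) \<partial>M) * (\<integral>\<^sup>+\<omega>. g (Y \<omega>) \<partial>M)"
proof -
  from ind have [measurable]: "X \<in> measurable M S" "Y \<in> measurable M T"
    and eq: "distr M S X \<Otimes>\<^sub>M distr M T Y = distr M (S \<Otimes>\<^sub>M T) (\<lambda>\<omega>. (X \<omega>, Y \<omega>))"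
    by (auto simp: indep_var_distribution_eq)
  interpret Y: prob_space "distr M T Y" by (rule prob_space_distr) simp
  have "(\<integral>\<^sup>+\<omega>. f (X \<omega>) * g (Y \<omega>) \<partial>M) = (\<integral>\<^sup>+z. f (fst z) * g (snd z) \<partial>distr M (S \<Otimes>\<^sub>M T) (\<lambda>\<omega>. (X \<omega>, Y \<omega>)))"
    by (subst nn_integral_distr) auto
  also have "\<dots> = (\<integral>\<^sup>+z. f (fst z) * g (snd z) \<partial>(distr M S X \<Otimes>\<^sub>M distr M T Y))"
    by (simp only: eq)
  also have "\<dots> = (\<integral>\<^sup>+x. \<integral>\<^sup>+y. f x * g y \<partial>distr M T Y \<partial>distr M S X)"
    by (subst Y.nn_integral_fst[symmetric]) auto
  also have "\<dots> = (\<integral>\<^sup>+x. f x \<partial>distr M S X) * (\<integral>\<^sup>+y. g y \<partial>distr M T Y)"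
    by (simp add: nn_integral_cmult nn_integral_multc)
  finally show ?thesis by (simp add: nn_integral_distr)
qed

text \<open>The vector used at a vertex has a random index, namely the number of balls there;
  splitting over the countably many values of this index gives measurability. The family
  \<open>y\<close> is general because the lemma is applied both to the environment and to the
  coordinates of a product space.\<close>

lemma measurable_num_balls:
  fixes y :: "'c \<Rightarrow> 'b::finite list \<Rightarrow> nat \<Rightarrow> 'b option \<Rightarrow> nat"
  assumes "\<And>u m. length u < length v \<Longrightarrow> m \<ge> 1 \<Longrightarrow> (\<lambda>\<omega>. y \<omega> u m) \<in> measurable K (count_space UNIV)"
  shows "(\<lambda>\<omega>. num_balls n (y \<omega>) v) \<in> measurable K (count_space UNIV)"
  using assms
proof (induction v)
  case (Cons i v)
  let ?f = "\<lambda>m \<omega>. if m = 0 then 0 else y \<omega> v m (Some i)"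
  have [measurable]: "(\<lambda>\<omega>. num_balls n (y \<omega>) v) \<in> measurable K (count_space UNIV)"
    by (rule Cons.IH) (use Cons.prems in auto)
  have [measurable]: "?f m \<in> measurable K (count_space UNIV)" for m
  proof (cases "m = 0")
    case False
    then have "(\<lambda>\<omega>. y \<omega> v m) \<in> measurable K (count_space UNIV)" by (intro Cons.prems) auto
    from measurable_compose[OF this, of "\<lambda>z. z (Some i)" "count_space UNIV"] False
    show ?thesis by simp
  qed simp
  have "(\<lambda>\<omega>. ?f (num_balls n (y \<omega>) v) \<omega>) \<in> measurable K (count_space UNIV)"
    by (rule measurable_compose_countable) measurable
  then show ?case by simp
qed simp

text \<open>If generation \<open>k\<close> were empty, \<open>T\<close> would lie in the first
  \<open>k\<close> generations, which are finite because the branching is finite.\<close>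

lemma exists_level_of_infinite:
  fixes T :: "'b::finite list set"
  assumes "suffix_closed T" "infinite T"
  shows "\<exists>v\<in>T. length v = k"
proof (rule ccontr)
  assume *: "\<not> ?thesis"
  have "length v < k" if "v \<in> T" for v
  proof (rule ccontr)
    assume "\<not> length v < k"
    then have "length (drop (length v - k) v) = k" by simp
    moreover have "drop (length v - k) v \<in> T"
      using suffix_closed_append[of T "take (length v - k) v"] assms that by simp
    ultimately show False using * by blast
  qed
  then have "T \<subseteq> (\<Union>j<k. {v. length v = j})" by auto
  moreover have "finite (\<Union>j<k. {v :: 'b list. length v = j})" by simp
  ultimately show False using assms(2) finite_subset by blast
qed

text \<open>A series over generations with values in \<open>ennreal\<close>, since
  \<open>card\<close> is 0 on infinite sets. Each single generation is finite, so the series is the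
  true count, and its finiteness proves that the tree is finite.\<close>

definition count_depth :: "(nat \<Rightarrow> bool) \<Rightarrow> 'b list set \<Rightarrow> ennreal" where
  "count_depth P T = (\<Sum>k. if P k then ennreal (real (card {v \<in> T. length v = k})) else 0)"

lemma count_depth_disj_le: "count_depth (\<lambda>k. P k \<or> Q k) T \<le> count_depth P T + count_depth Q T"
  unfolding count_depth_def by (subst suminf_add[OF summableI summableI]) (auto intro!: suminf_le)

lemma card_depth_le:
  assumes "finite T"
  shows "ennreal (real (card {v \<in> T. P (length v)})) \<le> count_depth P T"
proof -
  obtain K where K: "\<And>v. v \<in> T \<Longrightarrow> length v < K"
    using bounded_length_of_finite[OF assms] by blast
  have "card {v \<in> T. P (length v)} = card (\<Union>k\<in>{k. k < K \<and> P k}. {v \<in> T. length v = k})"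
    by (intro arg_cong[where f = card]) (use K in auto)
  also have "\<dots> = (\<Sum>k | k < K \<and> P k. card {v \<in> T. length v = k})"
    using assms by (intro card_UN_disjoint) auto
  also have "real \<dots> = (\<Sum>k<K. if P k then real (card {v \<in> T. length v = k}) else 0)"
    by (simp add: sum.inter_filter[symmetric])
  also have "ennreal \<dots> = (\<Sum>k<K. if P k then ennreal (real (card {v \<in> T. length v = k})) else 0)"
    by (simp add: sum_ennreal[symmetric] if_distrib[where f = ennreal] del: sum_ennreal cong: if_cong)
  also have "\<dots> \<le> count_depth P T"
    unfolding count_depth_def by (rule sum_le_suminf) auto
  finally show ?thesis .
qed

lemma finite_of_count_depth:
  fixes T :: "'b::finite list set"
  assumes T: "suffix_closed T" and "count_depth (\<lambda>_. True) T < \<infinity>"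
  shows "finite T"
proof (rule ccontr)
  assume inf: "infinite T"
  have "(1::ennreal) \<le> ennreal (real (card {v \<in> T. length v = k}))" for k
  proof -
    obtain v where "v \<in> {v \<in> T. length v = k}"
      using exists_level_of_infinite[OF T inf] by blast
    moreover have "finite {v \<in> T. length v = k}"
      by (rule finite_subset[OF _ finite_level[of k]]) auto
    ultimately have "card {v \<in> T. length v = k} > 0" using card_gt_0_iff by blast
    then have "1 \<le> real (card {v \<in> T. length v = k})" by linarith
    then show ?thesis by simp
  qed
  then have "(\<Sum>k<K. 1) \<le> (\<Sum>k<K. ennreal (real (card {v \<in> T. length v = k})))" for K
    by (intro sum_mono)
  also have "\<dots> K \<le> count_depth (\<lambda>_. True) T" for K
    unfolding count_depth_def if_True by (rule sum_le_suminf) auto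
  finally have "of_nat K \<le> count_depth (\<lambda>_. True) T" for K by simp
  then have "count_depth (\<lambda>_. True) T = \<infinity>"
    by (metis ennreal_Ex_less_of_nat infinity_ennreal_def linorder_not_less top.not_eq_extremum)
  then show False using assms by simp
qed

section \<open>One-step drift of the ball counts\<close>

locale split_environment = prob_space M
  for M :: "'a measure" +
  fixes N :: "nat \<Rightarrow> ('b::finite option \<Rightarrow> nat) pmf"
    and X :: "'b list \<Rightarrow> nat \<Rightarrow> 'a \<Rightarrow> 'b option \<Rightarrow> nat"
    and n :: nat
  assumes indep: "indep_vars (\<lambda>_. count_space UNIV) (\<lambda>(v, m). X v m) (UNIV \<times> {1..})"
    and law: "m \<ge> 1 \<Longrightarrow> distr M (count_space UNIV) (X v m) = measure_pmf (N m)"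
begin

abbreviation balls :: "'b list \<Rightarrow> 'a \<Rightarrow> nat" where
  "balls v \<omega> \<equiv> num_balls n (\<lambda>u m. X u m \<omega>) v"

abbreviation tree :: "'a \<Rightarrow> 'b list set" where
  "tree \<omega> \<equiv> split_tree n (\<lambda>u m. X u m \<omega>)"

lemma measurable_X: "m \<ge> 1 \<Longrightarrow> X v m \<in> measurable M (count_space UNIV)"
  using indep unfolding indep_vars_def by auto

lemma measurable_balls [measurable]: "balls v \<in> measurable M (count_space UNIV)"
  using measurable_X by (intro measurable_num_balls) simp

lemma sets_tree_eq: "{\<omega> \<in> space M. tree \<omega> = t} \<in> sets M"
proof -
  have "{\<omega> \<in> space M. tree \<omega> = t} = {\<omega> \<in> space M. \<forall>v. (balls v \<omega> \<ge> 1) = (v \<in> t)}"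
    by (auto simp: split_tree_def)
  also have "\<dots> \<in> sets M" by measurable
  finally show ?thesis .
qed

text \<open>The number of balls at \<open>v\<close> is a function of the vectors at strictly shorter
  vertices, hence independent of the vectors at \<open>v\<close> itself.\<close>

lemma nn_integral_balls_X:
  fixes f :: "nat \<Rightarrow> ennreal" and h :: "('b option \<Rightarrow> nat) \<Rightarrow> ennreal"
  assumes "m \<ge> 1"
  shows "(\<integral>\<^sup>+\<omega>. f (balls v \<omega>) * h (X v m \<omega>) \<partial>M) = (\<integral>\<^sup>+\<omega>. f (balls v \<omega>) \<partial>M) * (\<integral>\<^sup>+\<omega>. h (X v m \<omega>) \<partial>M)"
proof -
  let ?K = "\<lambda>_::'b list \<times> nat. count_space (UNIV :: ('b option \<Rightarrow> nat) set)"
  let ?A = "{u. length u < length v} \<times> {1::nat..}" and ?B = "{(v, m)}"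
  let ?X = "\<lambda>(v, m). X v m"
  have ind: "indep_var (PiM ?A ?K) (\<lambda>\<omega>. restrict (\<lambda>i. ?X i \<omega>) ?A) (PiM ?B ?K) (\<lambda>\<omega>. restrict (\<lambda>i. ?X i \<omega>) ?B)"
    using assms by (intro indep_var_restrict[OF indep]) auto
  \<comment> \<open>The same ball count as a function on the product over \<open>?A\<close>.
    Arguments outside this index set are replaced by the zero vector; the count at \<open>v\<close>
    never reads them.\<close>
  define g where "g y = num_balls n (\<lambda>u m. if m \<ge> 1 \<and> length u < length v then y (u, m) else (\<lambda>_. 0)) v"
    for y :: "'b list \<times> nat \<Rightarrow> 'b option \<Rightarrow> nat"
  have g: "g \<in> measurable (PiM ?A ?K) (count_space UNIV)"
    unfolding g_def by (rule measurable_num_balls) (auto intro!: measurable_component_singleton)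
  have "(\<lambda>y. y (v, m)) \<in> measurable (PiM ?B ?K) (count_space UNIV)"
    by (rule measurable_component_singleton) simp
  from measurable_compose[OF this, of h borel] measurable_compose[OF g, of f borel]
  have fh: "(\<lambda>y. f (g y)) \<in> borel_measurable (PiM ?A ?K)"
    "(\<lambda>y. h (y (v, m))) \<in> borel_measurable (PiM ?B ?K)" by simp_all
  have cong: "num_balls n x w = num_balls n (\<lambda>u m. if m \<ge> 1 \<and> length u < length v then x u m else (\<lambda>_. 0)) w"
    if "length w \<le> length v" for x :: "'b list \<Rightarrow> nat \<Rightarrow> 'b option \<Rightarrow> nat" and w
    using that by (induction w) auto
  have "g (restrict (\<lambda>i. ?X i \<omega>) ?A) = balls v \<omega>" for \<omega>
  proof -
    have "balls v \<omega> = num_balls n (\<lambda>u m. if m \<ge> 1 \<and> length u < length v then X u m \<omega> else (\<lambda>_. 0)) v"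
      by (rule cong) simp
    also have "\<dots> = g (restrict (\<lambda>i. ?X i \<omega>) ?A)"
      unfolding g_def by (intro arg_cong[where f = "\<lambda>x. num_balls n x v"] ext) auto
    finally show ?thesis ..
  qed
  then show ?thesis using indep_var_nn_integral[OF ind fh] by simp
qed

lemma nn_integral_X:
  "m \<ge> 1 \<Longrightarrow> (\<integral>\<^sup>+\<omega>. f (X v m \<omega>) \<partial>M) = (\<integral>\<^sup>+x. f x \<partial>measure_pmf (N m))"
  by (subst law[symmetric, of m v], assumption, rule nn_integral_distr[symmetric])
    (auto intro: measurable_X)

lemma AE_X_in_set_pmf: "AE \<omega> in M. \<forall>v. \<forall>m\<ge>1. X v m \<omega> \<in> set_pmf (N m)"
proof -
  have "AE \<omega> in M. m \<ge> 1 \<longrightarrow> X v m \<omega> \<in> set_pmf (N m)" for v m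
  proof (cases "m \<ge> 1")
    case True
    have "AE x in distr M (count_space UNIV) (X v m). x \<in> set_pmf (N m)"
      by (subst law[OF True]) (rule AE_measure_pmf)
    then show ?thesis using measurable_X[OF True] by (subst (asm) AE_distr_iff) auto
  qed simp
  then show ?thesis by (simp add: AE_all_countable)
qed

text \<open>Conditioning on the number \<open>m\<close> of balls at \<open>v\<close>: the vector
  \<open>X v m\<close> is independent of the event that \<open>v\<close> receives \<open>m\<close>
  balls, so the drift hypothesis applies for each \<open>m\<close>.\<close>

lemma nn_integral_children_le:
  fixes \<phi> :: "nat \<Rightarrow> ennreal"
  assumes "\<phi> 0 = 0"
    and \<phi>: "\<And>m. m \<ge> 1 \<Longrightarrow> (\<integral>\<^sup>+x. (\<Sum>i\<in>UNIV. \<phi> (x (Some i))) \<partial>measure_pmf (N m)) \<le> \<rho> * \<phi> m"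
  shows "(\<integral>\<^sup>+\<omega>. (\<Sum>i\<in>UNIV. \<phi> (balls (i # v) \<omega>)) \<partial>M) \<le> \<rho> * (\<integral>\<^sup>+\<omega>. \<phi> (balls v \<omega>) \<partial>M)"
proof -
  let ?g = "\<lambda>x. \<Sum>i\<in>UNIV. \<phi> (x (Some i))"
  have ind [measurable]: "(\<lambda>\<omega>. indicator {m} (balls v \<omega>) :: ennreal) \<in> borel_measurable M" for m
    by (rule measurable_compose[OF measurable_balls]) simp
  \<comment> \<open>Turns a quantity with the random index \<open>balls v\<close> into a sum over
    fixed indices. The index 0 is set to zero by hand, since nothing is assumed about
    \<open>X v 0\<close>.\<close>
  have pick: "(\<Sum>m. indicator {m} (k::nat) * h m) = h k" for k and h :: "nat \<Rightarrow> ennreal"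
    by (subst suminf_finite[of "{k}"]) (auto simp: indicator_def)
  have "(\<integral>\<^sup>+\<omega>. (\<Sum>i\<in>UNIV. \<phi> (balls (i # v) \<omega>)) \<partial>M)
      = (\<integral>\<^sup>+\<omega>. (\<Sum>m. indicator {m} (balls v \<omega>) * (if m = 0 then 0 else ?g (X v m \<omega>))) \<partial>M)"
    by (subst pick) (auto intro!: nn_integral_cong simp: assms(1))
  also have "\<dots> = (\<Sum>m. \<integral>\<^sup>+\<omega>. indicator {m} (balls v \<omega>) * (if m = 0 then 0 else ?g (X v m \<omega>)) \<partial>M)"
  proof (rule nn_integral_suminf)
    fix m
    have "(\<lambda>\<omega>. if m = 0 then 0 else ?g (X v m \<omega>)) \<in> borel_measurable M"
    proof (cases "m = 0")
      case False
      then have "X v m \<in> measurable M (count_space UNIV)" by (intro measurable_X) simp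
      from measurable_compose[OF this, of ?g borel] False show ?thesis by simp
    qed simp
    with ind show "(\<lambda>\<omega>. indicator {m} (balls v \<omega>) * (if m = 0 then 0 else ?g (X v m \<omega>))) \<in> borel_measurable M"
      by (intro borel_measurable_times_ennreal)
  qed
  also have "\<dots> \<le> (\<Sum>m. \<integral>\<^sup>+\<omega>. \<rho> * (indicator {m} (balls v \<omega>) * \<phi> m) \<partial>M)"
  proof (intro suminf_le allI)
    fix m
    show "(\<integral>\<^sup>+\<omega>. indicator {m} (balls v \<omega>) * (if m = 0 then 0 else ?g (X v m \<omega>)) \<partial>M)
        \<le> (\<integral>\<^sup>+\<omega>. \<rho> * (indicator {m} (balls v \<omega>) * \<phi> m) \<partial>M)"
    proof (cases "m = 0")
      case False
      then have m: "m \<ge> 1" by simp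
      have "(\<integral>\<^sup>+\<omega>. indicator {m} (balls v \<omega>) * ?g (X v m \<omega>) \<partial>M)
          = (\<integral>\<^sup>+\<omega>. indicator {m} (balls v \<omega>) \<partial>M) * (\<integral>\<^sup>+\<omega>. ?g (X v m \<omega>) \<partial>M)"
        by (rule nn_integral_balls_X[OF m])
      also have "\<dots> \<le> (\<integral>\<^sup>+\<omega>. indicator {m} (balls v \<omega>) \<partial>M) * (\<rho> * \<phi> m)"
        using \<phi>[OF m] nn_integral_X[OF m, of ?g] by (intro mult_left_mono) auto
      also have "\<dots> = (\<integral>\<^sup>+\<omega>. indicator {m} (balls v \<omega>) * (\<rho> * \<phi> m) \<partial>M)"
        by (rule nn_integral_multc[symmetric]) measurable
      finally show ?thesis using False by (simp add: mult_ac)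
    qed simp
  qed auto
  also have "\<dots> = (\<integral>\<^sup>+\<omega>. (\<Sum>m. indicator {m} (balls v \<omega>) * (\<rho> * \<phi> m)) \<partial>M)"
    by (subst nn_integral_suminf[symmetric]) (auto simp: mult_ac)
  also have "\<dots> = (\<integral>\<^sup>+\<omega>. \<rho> * \<phi> (balls v \<omega>) \<partial>M)" by (simp only: pick)
  also have "\<dots> = \<rho> * (\<integral>\<^sup>+\<omega>. \<phi> (balls v \<omega>) \<partial>M)" by (rule nn_integral_cmult) measurable
  finally show ?thesis .
qed

lemma nn_integral_generation_le:
  fixes \<phi> :: "nat \<Rightarrow> ennreal"
  assumes "\<phi> 0 = 0"
    and "\<And>m. m \<ge> 1 \<Longrightarrow> (\<integral>\<^sup>+x. (\<Sum>i\<in>UNIV. \<phi> (x (Some i))) \<partial>measure_pmf (N m)) \<le> \<rho> * \<phi> m"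
  shows "(\<integral>\<^sup>+\<omega>. (\<Sum>v | length v = k. \<phi> (balls v \<omega>)) \<partial>M) \<le> \<rho> ^ k * \<phi> n"
proof (induction k)
  case 0
  then show ?case by (simp add: emeasure_space_1)
next
  case (Suc k)
  have "(\<integral>\<^sup>+\<omega>. (\<Sum>v | length v = Suc k. \<phi> (balls v \<omega>)) \<partial>M)
      = (\<Sum>v | length v = k. \<integral>\<^sup>+\<omega>. (\<Sum>i\<in>UNIV. \<phi> (balls (i # v) \<omega>)) \<partial>M)"
    unfolding sum_level_Suc by (rule nn_integral_sum) measurable
  also have "\<dots> \<le> (\<Sum>v | length v = k. \<rho> * (\<integral>\<^sup>+\<omega>. \<phi> (balls v \<omega>) \<partial>M))"
    by (intro sum_mono nn_integral_children_le assms)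
  also have "\<dots> = \<rho> * (\<integral>\<^sup>+\<omega>. (\<Sum>v | length v = k. \<phi> (balls v \<omega>)) \<partial>M)"
    by (subst nn_integral_sum) (auto simp: sum_distrib_left)
  also have "\<dots> \<le> \<rho> * (\<rho> ^ k * \<phi> n)" by (intro mult_left_mono Suc.IH) simp
  finally show ?case by (simp add: mult_ac)
qed

lemma card_level_eq: "real (card {v \<in> tree \<omega>. length v = k}) = (\<Sum>v | length v = k. if balls v \<omega> \<ge> 1 then 1 else 0)"
  by (subst sum.inter_filter[symmetric]) (auto intro!: arg_cong[where f = card] simp: split_tree_def)

lemma measurable_card_level [measurable]:
  "(\<lambda>\<omega>. real (card {v \<in> tree \<omega>. length v = k})) \<in> borel_measurable M"
  unfolding card_level_eq by measurable

lemma measurable_count_depth [measurable]: "(\<lambda>\<omega>. count_depth P (tree \<omega>)) \<in> borel_measurable M"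
  unfolding count_depth_def by measurable

text \<open>As \<phi> is at least 1 at positive arguments, \<phi> of the ball count dominates the
  indicator that a vertex belongs to the tree.\<close>

lemma nn_integral_count_depth_le:
  fixes \<phi> :: "nat \<Rightarrow> ennreal"
  assumes "\<phi> 0 = 0" and 1: "\<And>m. m \<ge> 1 \<Longrightarrow> \<phi> m \<ge> 1"
    and "\<And>m. m \<ge> 1 \<Longrightarrow> (\<integral>\<^sup>+x. (\<Sum>i\<in>UNIV. \<phi> (x (Some i))) \<partial>measure_pmf (N m)) \<le> \<rho> * \<phi> m"
  shows "(\<integral>\<^sup>+\<omega>. count_depth P (tree \<omega>) \<partial>M) \<le> (\<Sum>k. if P k then \<rho> ^ k * \<phi> n else 0)"
proof -
  have "(\<integral>\<^sup>+\<omega>. count_depth P (tree \<omega>) \<partial>M)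
      = (\<Sum>k. \<integral>\<^sup>+\<omega>. (if P k then ennreal (real (card {v \<in> tree \<omega>. length v = k})) else 0) \<partial>M)"
    unfolding count_depth_def by (rule nn_integral_suminf) measurable
  also have "\<dots> \<le> (\<Sum>k. if P k then \<rho> ^ k * \<phi> n else 0)"
  proof (intro suminf_le allI)
    fix k
    have "ennreal (real (card {v \<in> tree \<omega>. length v = k})) \<le> (\<Sum>v | length v = k. \<phi> (balls v \<omega>))" for \<omega>
    proof -
      have "ennreal (real (card {v \<in> tree \<omega>. length v = k})) = (\<Sum>v | length v = k. if balls v \<omega> \<ge> 1 then 1 else 0)"
        unfolding card_level_eq by (simp add: sum_ennreal[symmetric] if_distrib[where f = ennreal] del: sum_ennreal cong: if_cong)
      also have "\<dots> \<le> (\<Sum>v | length v = k. \<phi> (balls v \<omega>))"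
        by (intro sum_mono) (auto intro: 1)
      finally show ?thesis .
    qed
    then have "(\<integral>\<^sup>+\<omega>. ennreal (real (card {v \<in> tree \<omega>. length v = k})) \<partial>M)
        \<le> (\<integral>\<^sup>+\<omega>. (\<Sum>v | length v = k. \<phi> (balls v \<omega>)) \<partial>M)" by (intro nn_integral_mono) 
    also have "\<dots> \<le> \<rho> ^ k * \<phi> n" by (intro nn_integral_generation_le assms)
    finally show "(\<integral>\<^sup>+\<omega>. (if P k then ennreal (real (card {v \<in> tree \<omega>. length v = k})) else 0) \<partial>M)
        \<le> (if P k then \<rho> ^ k * \<phi> n else 0)" by auto
  qed auto
  finally show ?thesis .
qed

end

section \<open>Moments of the split vectors\<close>

text \<open>Both bounds come from \<open>ln y \<le> y - 1\<close>, at \<open>y = x\<close> and at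
  \<open>y = 1 / x\<close>. The lower one compares \<chi> with 1 - E \<Sum> V_i^2 and yields \<chi>
  > 0; the upper one gives integrability.\<close>

lemma entropy_term_bounds:
  fixes x :: real
  assumes "0 \<le> x" "x \<le> 1"
  shows "x * (1 - x) \<le> x * ln (1 / x)" "x * ln (1 / x) \<le> 1"
proof -
  have "x * (1 - x) \<le> x * ln (1 / x) \<and> x * ln (1 / x) \<le> 1"
  proof (cases "x = 0")
    case False
    then have "x > 0" using assms by simp
    then have l: "ln (1 / x) = - ln x" by (simp add: ln_div)
    have "ln x \<le> x - 1" "ln (1 / x) \<le> 1 / x - 1"
      using \<open>x > 0\<close> by (intro ln_le_minus_one; simp)+
    then have "1 - x \<le> ln (1 / x)" "x * ln (1 / x) \<le> x * (1 / x - 1)"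
      using l \<open>x > 0\<close> by (simp, intro mult_left_mono) auto
    moreover from this have "x * (1 - x) \<le> x * ln (1 / x)" using \<open>x > 0\<close> by (intro mult_left_mono) auto
    ultimately show ?thesis using \<open>x > 0\<close> by (auto simp: algebra_simps)
  qed simp
  then show "x * (1 - x) \<le> x * ln (1 / x)" "x * ln (1 / x) \<le> 1" by auto
qed

text \<open>With \<open>L = ln (1 / x)\<close>, expand \<open>exp (- t * L)\<close> to second order.
  The remainder is \<open>x * exp z * L^2 * t^2 / 2\<close> with \<open>z \<le> L / 2\<close>. Since
  \<open>L^2 / 8 \<le> exp (L / 2)\<close>, the factor \<open>x * exp z * L^2\<close> is at most 8,
  uniformly in \<open>x\<close> and for both signs of \<open>t\<close>.\<close>

lemma powr_one_plus_le:
  fixes x t :: real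
  assumes x: "0 \<le> x" "x \<le> 1" and t: "\<bar>t\<bar> \<le> 1 / 2"
  shows "x powr (1 + t) \<le> x - t * (x * ln (1 / x)) + 4 * t\<^sup>2"
proof (cases "x = 0")
  case False
  then have x0: "x > 0" using x by simp
  define L where "L = ln (1 / x)"
  have L: "L \<ge> 0" "ln x = - L" using x0 x by (auto simp: L_def ln_div)
  obtain z where z: "\<bar>z\<bar> \<le> \<bar>- t * L\<bar>" "exp (- t * L) = (\<Sum>m<2. (- t * L) ^ m / fact m) + exp z / fact 2 * (- t * L)\<^sup>2"
    using Maclaurin_exp_le by blast
  have "z \<le> \<bar>t\<bar> * L" using z(1) L by (simp add: abs_mult)
  also have "\<dots> \<le> 1 / 2 * L" using t L by (intro mult_right_mono) auto
  finally have "exp z \<le> exp (L / 2)" by simp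
  moreover have "L\<^sup>2 / 8 \<le> exp (L / 2)"
    using exp_lower_Taylor_quadratic[of "L / 2"] L by (simp add: power_divide)
  ultimately have "exp z * L\<^sup>2 / 8 \<le> exp (L / 2) * exp (L / 2)"
    using mult_mono[of "exp z" "exp (L / 2)" "L\<^sup>2 / 8" "exp (L / 2)"] by simp
  also have "\<dots> = 1 / x" using L x0 by (simp add: exp_add[symmetric] L_def)
  finally have "x * exp z * L\<^sup>2 \<le> 8" using x0 by (simp add: field_simps)
  then have b: "x * exp z * L\<^sup>2 * (t\<^sup>2 / 2) \<le> 8 * (t\<^sup>2 / 2)" by (intro mult_right_mono) auto
  have "x powr (1 + t) = x * exp (- t * L)"
    using x0 by (simp add: powr_add) (simp add: powr_def L)
  also have "\<dots> = x * (1 - t * L + exp z / 2 * (t\<^sup>2 * L\<^sup>2))"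
    unfolding z(2) by (simp add: numeral_2_eq_2 power_mult_distrib)
  also have "\<dots> = x - t * (x * L) + x * exp z * L\<^sup>2 * (t\<^sup>2 / 2)" by (simp add: algebra_simps)
  also have "\<dots> \<le> x - t * (x * L) + 4 * t\<^sup>2" using b by simp
  finally show ?thesis by (simp add: L_def)
qed simp

text \<open>Each square is at most its coordinate; if the squares still add up to 1, every
  coordinate is 0 or 1. This links second moments to the events excluded by (ST3).\<close>

lemma unit_coordinate_of_sum_squares:
  fixes y :: "'b::finite \<Rightarrow> real"
  assumes y: "\<And>i. 0 \<le> y i" and 1: "(\<Sum>i\<in>UNIV. y i) \<le> 1"
  shows "y i \<le> 1" "(\<Sum>i\<in>UNIV. (y i)\<^sup>2) \<le> 1" "(\<Sum>i\<in>UNIV. (y i)\<^sup>2) = 1 \<Longrightarrow> \<exists>i. y i = 1"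
proof -
  have le: "y i \<le> 1" for i
    using member_le_sum[of i UNIV y] y 1 by simp
  then show "y i \<le> 1" .
  have sq: "(y i)\<^sup>2 \<le> y i" for i
    using le[of i] y[of i] by (simp add: power2_eq_square mult_left_le)
  have "(\<Sum>i\<in>UNIV. (y i)\<^sup>2) \<le> (\<Sum>i\<in>UNIV. y i)" by (intro sum_mono sq)
  then show "(\<Sum>i\<in>UNIV. (y i)\<^sup>2) \<le> 1" using 1 by simp
  assume eq: "(\<Sum>i\<in>UNIV. (y i)\<^sup>2) = 1"
  have "(\<Sum>i\<in>UNIV. y i - (y i)\<^sup>2) \<le> 0" using eq 1 by (simp add: sum_subtractf)
  moreover have "(\<Sum>i\<in>UNIV. y i - (y i)\<^sup>2) \<ge> 0" using sq by (intro sum_nonneg) simp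
  ultimately have "(\<Sum>i\<in>UNIV. y i - (y i)\<^sup>2) = 0" by simp
  then have z: "y i - (y i)\<^sup>2 = 0" for i
    using sq by (subst (asm) sum_nonneg_eq_0_iff) auto
  show "\<exists>i. y i = 1"
  proof (rule ccontr)
    assume "\<not> ?thesis"
    then have "y i = 0" for i using z[of i] by (auto simp: power2_eq_square)
    then show False using eq by simp
  qed
qed

lemma finite_bounded_functions: "finite {x :: 'c::finite \<Rightarrow> nat. \<forall>i. x i \<le> m}"
proof -
  have "{x :: 'c \<Rightarrow> nat. \<forall>i. x i \<le> m} = (\<Pi>\<^sub>E i\<in>UNIV. {..m})" by (auto simp: PiE_UNIV_domain)
  then show ?thesis by (simp add: finite_PiE)
qed

section \<open>The limit law and its power moments\<close>

locale split_law =
  fixes N :: "nat \<Rightarrow> ('b::finite option \<Rightarrow> nat) pmf"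
    and V :: "('b option \<Rightarrow> real) measure"
  assumes split_vectors: "split_vectors N" and ST1: "ST1 N" and ST2: "ST2 N V" and ST3: "ST3 N V"
begin

text \<open>The mean factor by which the weight \<open>m powr (1 + t)\<close> changes when it is
  passed from a vertex with \<open>m\<close> balls to its children.\<close>

definition power_mean :: "real \<Rightarrow> nat \<Rightarrow> real" where
  "power_mean t m = (\<integral>x. (\<Sum>i\<in>UNIV. (real (x (Some i)) / real m) powr (1 + t)) \<partial>measure_pmf (N m))"

definition limit_power_mean :: "real \<Rightarrow> real" where
  "limit_power_mean t = (\<integral>x. (\<Sum>i\<in>UNIV. x (Some i) powr (1 + t)) \<partial>V)"

lemma sum_split_vector:
  assumes "m \<ge> 1" "x \<in> set_pmf (N m)"
  shows "x None + (\<Sum>i\<in>UNIV. x (Some i)) = m"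
proof -
  have "(\<Sum>i\<in>UNIV. x i) = m" using split_vectors assms by (auto simp: split_vectors_def)
  then show ?thesis by (simp add: sum_UNIV_option)
qed

lemma sum_children_le:
  assumes "m \<ge> 1" "x \<in> set_pmf (N m)"
  shows "(\<Sum>i\<in>UNIV. real (x (Some i)) / real m) \<le> 1"
proof -
  have "real (\<Sum>i\<in>UNIV. x (Some i)) \<le> real m" using sum_split_vector[OF assms] by linarith
  then show ?thesis using assms(1) by (simp add: sum_divide_distrib[symmetric])
qed

lemma finite_set_pmf_split [simp]: "m \<ge> 1 \<Longrightarrow> finite (set_pmf (N m))"
proof (rule finite_subset[OF _ finite_bounded_functions[of m]], rule subsetI)
  fix x assume "m \<ge> 1" "x \<in> set_pmf (N m)"
  then have "(\<Sum>i\<in>UNIV. x i) = m" using split_vectors by (auto simp: split_vectors_def)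
  then have "x i \<le> m" for i using member_le_sum[of i UNIV x] by simp
  then show "x \<in> {x. \<forall>i. x i \<le> m}" by simp
qed

lemma prob_space_V: "prob_space V" and sets_V: "sets V = sets borel"
proof -
  have "V \<in> topspace weak_topology" using ST2 by (simp add: ST2_def limitin_def)
  then show "prob_space V" "sets V = sets borel" by (auto simp: topspace_weak_topology)
qed

sublocale V: prob_space V by (rule prob_space_V)

lemma measurable_V [measurable]: "(\<lambda>x. x i) \<in> borel_measurable V"
  unfolding measurable_cong_sets[OF sets_V refl]
  by (intro borel_measurable_continuous_onI continuous_on_product_coordinates)

lemma weak_limit:
  fixes f :: "('b option \<Rightarrow> real) \<Rightarrow> real"
  assumes "continuous_on UNIV f" "bounded (range f)"
  shows "(\<lambda>m. \<integral>x. f (\<lambda>i. real (x i) / real m) \<partial>measure_pmf (N m)) \<longlonglongrightarrow> (\<integral>x. f x \<partial>V)"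
proof -
  have "\<forall>\<^sub>F m in sequentially. prob_space (distr (measure_pmf (N m)) borel (\<lambda>x i. real (x i) / real m))
      \<and> sets (distr (measure_pmf (N m)) borel (\<lambda>x i. real (x i) / real m)) = sets borel"
    by (intro always_eventually allI conjI measure_pmf.prob_space_distr) auto
  from limitin_weak_topology[OF this prob_space_V sets_V] ST2[unfolded ST2_def] assms
  have "(\<lambda>m. \<integral>x. f x \<partial>distr (measure_pmf (N m)) borel (\<lambda>x i. real (x i) / real m)) \<longlonglongrightarrow> (\<integral>x. f x \<partial>V)"
    by blast
  moreover have "f \<in> borel_measurable borel" using assms by (intro borel_measurable_continuous_onI)
  ultimately show ?thesis by (simp add: integral_distr)
qed

text \<open>Here \<open>f\<close> is a truncated measure of how far a vector violates some property.
  The expected violation for the rescaled \<open>N m\<close> is O(1 / m), so it vanishes in the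
  limit.\<close>

lemma AE_eq_0_of_weak_limit:
  fixes f :: "('b option \<Rightarrow> real) \<Rightarrow> real"
  assumes f: "continuous_on UNIV f" "\<And>x. 0 \<le> f x" "\<And>x. f x \<le> 1"
    and N: "\<And>m x. m \<ge> 1 \<Longrightarrow> x \<in> set_pmf (N m) \<Longrightarrow> f (\<lambda>i. real (x i) / real m) \<le> C / real m"
  shows "AE x in V. f x = 0"
proof -
  have b: "bounded (range f)" using f by (auto simp: bounded_iff intro!: exI[of _ 1])
  have meas: "f \<in> borel_measurable V"
    unfolding measurable_cong_sets[OF sets_V refl] using f by (intro borel_measurable_continuous_onI)
  have "(\<lambda>m. C / real m) \<longlonglongrightarrow> 0" by real_asymp
  moreover have "\<forall>\<^sub>F m in sequentially. (\<integral>x. f (\<lambda>i. real (x i) / real m) \<partial>measure_pmf (N m)) \<le> C / real m"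
    using eventually_ge_at_top[of 1]
  proof eventually_elim
    case (elim m)
    have "(\<integral>x. f (\<lambda>i. real (x i) / real m) \<partial>measure_pmf (N m)) \<le> (\<integral>x. C / real m \<partial>measure_pmf (N m))"
      using elim N by (intro integral_mono_AE integrable_measure_pmf_finite) (auto simp: AE_measure_pmf_iff)
    then show ?case by simp
  qed
  ultimately have "(\<integral>x. f x \<partial>V) \<le> 0"
    using weak_limit[OF f(1) b] by (intro tendsto_le[OF sequentially_bot, rotated]) 
  then have "(\<integral>x. f x \<partial>V) = 0" using f by (intro antisym integral_nonneg) auto
  moreover have "integrable V f" using f meas by (intro V.integrable_const_bound[of _ 1]) auto
  ultimately show ?thesis using f by (subst (asm) integral_nonneg_eq_0_iff_AE) auto
qed

lemma AE_V_nonneg: "AE x in V. \<forall>i. 0 \<le> x i"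
proof -
  have "AE x in V. 0 \<le> x i" for i
  proof -
    have "AE x in V. min 1 (max 0 (- x i)) = 0"
      by (rule AE_eq_0_of_weak_limit[where C = 0])
        (auto intro!: continuous_intros continuous_on_product_coordinates)
    then show ?thesis by eventually_elim (auto simp: min_def max_def split: if_splits)
  qed
  then show ?thesis by (simp add: AE_all_countable)
qed

lemma AE_V_sum: "AE x in V. (\<Sum>i\<in>UNIV. x (Some i)) = 1"
proof -
  obtain C where C: "\<And>m x. m \<ge> 1 \<Longrightarrow> x \<in> set_pmf (N m) \<Longrightarrow> x None \<le> C"
    using ST1 unfolding ST1_def by blast
  have "AE x in V. min 1 \<bar>(\<Sum>i\<in>UNIV. x (Some i)) - 1\<bar> = 0"
  \<comment> \<open>The children miss exactly the balls that stay at the vertex, a proportion of at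
    most \<open>C / m\<close> by (ST1).\<close>
  proof (rule AE_eq_0_of_weak_limit[where C = C])
    fix m and x :: "'b option \<Rightarrow> nat" assume m: "m \<ge> 1" "x \<in> set_pmf (N m)"
    have "real m = real (x None) + real (\<Sum>i\<in>UNIV. x (Some i))"
      unfolding of_nat_add[symmetric] sum_split_vector[OF m] ..
    then have "(\<Sum>i\<in>UNIV. real (x (Some i)) / real m) - 1 = - real (x None) / real m"
      using m(1) by (simp add: sum_divide_distrib[symmetric] field_simps)
    then have "\<bar>(\<Sum>i\<in>UNIV. real (x (Some i)) / real m) - 1\<bar> = real (x None) / real m" by simp
    also have "\<dots> \<le> C / real m" using C[OF m] by (intro divide_right_mono) auto
    finally show "min 1 \<bar>(\<Sum>i\<in>UNIV. real (x (Some i)) / real m) - 1\<bar> \<le> real C / real m" by simp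
  qed (auto intro!: continuous_intros continuous_on_product_coordinates)
  then show ?thesis by eventually_elim (auto simp: min_def split: if_splits)
qed

lemma AE_V: "AE x in V. (\<forall>i. 0 \<le> x (Some i) \<and> x (Some i) \<le> 1) \<and> (\<Sum>i\<in>UNIV. x (Some i)) = 1"
  using AE_V_nonneg AE_V_sum
proof eventually_elim
  case (elim x)
  then show ?case using unit_coordinate_of_sum_squares(1)[of "\<lambda>i. x (Some i)"] by auto
qed

lemma AE_V_coordinate: "AE x in V. 0 \<le> x (Some i) \<and> x (Some i) \<le> 1"
  using AE_V by eventually_elim auto

lemma power_mean_tendsto:
  assumes "t > -1"
  shows "power_mean t \<longlonglongrightarrow> limit_power_mean t"
proof -
  \<comment> \<open>Weak convergence tests only bounded continuous functions, hence the truncation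
    to [0, 1]. It changes neither the rescaled split vectors nor almost any vector under
    \<open>V\<close>. The condition \<open>t > -1\<close> makes the power continuous at 0.\<close>
  let ?q = "\<lambda>x :: 'b option \<Rightarrow> real. \<Sum>i\<in>UNIV. min 1 (max 0 (x (Some i))) powr (1 + t)"
  have le: "0 \<le> ?q x" "?q x \<le> real CARD('b)" for x
    using assms by (auto intro!: sum_nonneg) (rule sum_bounded_above[where K = 1, simplified], auto intro!: powr_le1)
  have "(\<lambda>m. \<integral>x. ?q (\<lambda>i. real (x i) / real m) \<partial>measure_pmf (N m)) \<longlonglongrightarrow> (\<integral>x. ?q x \<partial>V)"
  proof (rule weak_limit)
    show "continuous_on UNIV ?q"
      using assms by (intro continuous_on_sum continuous_on_powr' continuous_intros continuous_on_product_coordinates) auto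
    show "bounded (range ?q)"
      using le unfolding bounded_iff by (intro exI[of _ "real CARD('b)"]) auto
  qed
  also have "(\<integral>x. ?q x \<partial>V) = limit_power_mean t"
    unfolding limit_power_mean_def
  proof (rule integral_cong_AE)
    show "AE x in V. ?q x = (\<Sum>i\<in>UNIV. x (Some i) powr (1 + t))"
      using AE_V by eventually_elim (auto intro!: sum.cong simp: min_absorb2 max_absorb2)
  qed auto
  finally have *: "(\<lambda>m. \<integral>x. ?q (\<lambda>i. real (x i) / real m) \<partial>measure_pmf (N m)) \<longlonglongrightarrow> limit_power_mean t" .
  have "\<forall>\<^sub>F m in sequentially. (\<integral>x. ?q (\<lambda>i. real (x i) / real m) \<partial>measure_pmf (N m)) = power_mean t m"
    using eventually_ge_at_top[of 1]
  proof eventually_elim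
    case (elim m)
    show ?case
      unfolding power_mean_def
    proof (intro integral_cong_AE)
      show "AE x in measure_pmf (N m). ?q (\<lambda>i. real (x i) / real m)
          = (\<Sum>i\<in>UNIV. (real (x (Some i)) / real m) powr (1 + t))"
        unfolding AE_measure_pmf_iff
      proof
        fix x assume x: "x \<in> set_pmf (N m)"
        have "real (x (Some i)) / real m \<le> 1" for i
          by (rule unit_coordinate_of_sum_squares(1)[OF _ sum_children_le[OF elim x]]) simp
        then show "?q (\<lambda>i. real (x i) / real m) = (\<Sum>i\<in>UNIV. (real (x (Some i)) / real m) powr (1 + t))"
          by (intro sum.cong refl) (simp add: min_absorb2)
      qed
    qed auto
  qed
  from Lim_transform_eventually[OF * this] show ?thesis .
qed

lemma integrable_V_coordinate [simp]: "integrable V (\<lambda>x. x (Some i))"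
  using AE_V_coordinate[of i] by (intro V.integrable_const_bound[of _ 1]) auto

lemma integrable_V_powr [simp]:
  "t > -1 \<Longrightarrow> integrable V (\<lambda>x. x (Some i) powr (1 + t))"
  by (rule V.integrable_const_bound[of _ 1], rule AE_mp[OF AE_V_coordinate[of i] AE_I2])
    (auto intro: powr_le1)

lemma integrable_V_entropy [simp]: "integrable V (\<lambda>x. x (Some i) * ln (1 / x (Some i)))"
proof (rule V.integrable_const_bound[of _ 1])
  show "AE x in V. norm (x (Some i) * ln (1 / x (Some i))) \<le> 1"
    using AE_V_coordinate[of i]
  proof eventually_elim
    case (elim x)
    then have "0 \<le> x (Some i) * (1 - x (Some i))" by simp
    moreover have "x (Some i) * (1 - x (Some i)) \<le> x (Some i) * ln (1 / x (Some i))"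
      "x (Some i) * ln (1 / x (Some i)) \<le> 1" using elim by (auto intro: entropy_term_bounds)
    ultimately show ?case unfolding real_norm_def by linarith
  qed
qed simp

lemma sum_integral_V: "(\<Sum>i\<in>UNIV. \<integral>x. x (Some i) \<partial>V) = 1"
proof -
  have "(\<Sum>i\<in>UNIV. \<integral>x. x (Some i) \<partial>V) = (\<integral>x. (\<Sum>i\<in>UNIV. x (Some i)) \<partial>V)"
    by (rule Bochner_Integration.integral_sum[symmetric]) simp
  also have "\<dots> = (\<integral>x. 1 \<partial>V)" using AE_V_sum by (intro integral_cong_AE) auto
  finally show ?thesis by (simp add: V.prob_space)
qed

lemma limit_power_mean_le:
  assumes t: "\<bar>t\<bar> \<le> 1 / 2"
  shows "limit_power_mean t \<le> 1 - t * split_entropy V + 4 * real CARD('b) * t\<^sup>2"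
proof -
  have "t > -1" using t by linarith
  then have "limit_power_mean t = (\<Sum>i\<in>UNIV. \<integral>x. x (Some i) powr (1 + t) \<partial>V)"
    unfolding limit_power_mean_def by (intro Bochner_Integration.integral_sum) simp
  also have "\<dots> \<le> (\<Sum>i\<in>UNIV. \<integral>x. x (Some i) - t * (x (Some i) * ln (1 / x (Some i))) + 4 * t\<^sup>2 \<partial>V)"
  proof (intro sum_mono integral_mono_AE)
    fix i
    show "AE x in V. x (Some i) powr (1 + t) \<le> x (Some i) - t * (x (Some i) * ln (1 / x (Some i))) + 4 * t\<^sup>2"
      using AE_V_coordinate[of i] by eventually_elim (auto intro: powr_one_plus_le t)
  qed (use \<open>t > -1\<close> in auto)
  also have "\<dots> = (\<Sum>i\<in>UNIV. (\<integral>x. x (Some i) \<partial>V) - t * (\<integral>x. x (Some i) * ln (1 / x (Some i)) \<partial>V) + 4 * t\<^sup>2)"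
    by (simp add: V.prob_space)
  also have "\<dots> = 1 - t * split_entropy V + 4 * real CARD('b) * t\<^sup>2"
    by (simp add: sum.distrib sum_subtractf sum_integral_V split_entropy_def sum_distrib_left)
  finally show ?thesis .
qed

lemma limit_power_mean_1: "limit_power_mean 1 = (\<integral>x. (\<Sum>i\<in>UNIV. (x (Some i))\<^sup>2) \<partial>V)"
  unfolding limit_power_mean_def
proof (rule integral_cong_AE)
  show "AE x in V. (\<Sum>i\<in>UNIV. x (Some i) powr (1 + 1)) = (\<Sum>i\<in>UNIV. (x (Some i))\<^sup>2)"
    using AE_V by eventually_elim auto
qed auto

lemma integrable_V_squares [simp]: "integrable V (\<lambda>x. (x (Some i))\<^sup>2)"
  using AE_V_coordinate[of i] by (intro V.integrable_const_bound[of _ 1]) (auto simp: power_le_one)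

text \<open>Equality would force the sum of squares to be 1 almost surely, hence some
  \<open>V_i = 1\<close> almost surely, against (ST3).\<close>

lemma limit_power_mean_1_less: "limit_power_mean 1 < 1"
proof (rule ccontr)
  assume "\<not> ?thesis"
  then have ge: "(\<integral>x. (\<Sum>i\<in>UNIV. (x (Some i))\<^sup>2) \<partial>V) \<ge> 1" by (simp add: limit_power_mean_1)
  have nonneg: "AE x in V. 0 \<le> 1 - (\<Sum>i\<in>UNIV. (x (Some i))\<^sup>2)"
    using AE_V
  proof eventually_elim
    case (elim x)
    then show ?case using unit_coordinate_of_sum_squares(2)[of "\<lambda>i. x (Some i)"] by auto
  qed
  have "(\<integral>x. 1 - (\<Sum>i\<in>UNIV. (x (Some i))\<^sup>2) \<partial>V) \<le> 0" using ge by (simp add: V.prob_space)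
  moreover have "(\<integral>x. 1 - (\<Sum>i\<in>UNIV. (x (Some i))\<^sup>2) \<partial>V) \<ge> 0" using nonneg by (rule integral_nonneg_AE)
  ultimately have "(\<integral>x. 1 - (\<Sum>i\<in>UNIV. (x (Some i))\<^sup>2) \<partial>V) = 0" by linarith
  then have "AE x in V. 1 - (\<Sum>i\<in>UNIV. (x (Some i))\<^sup>2) = 0"
    using nonneg by (subst (asm) integral_nonneg_eq_0_iff_AE) auto
  then have "AE x in V. Max (range (\<lambda>i. x (Some i))) = 1"
    using AE_V
  proof eventually_elim
    case (elim x)
    then obtain i where "x (Some i) = 1"
      using unit_coordinate_of_sum_squares(3)[of "\<lambda>i. x (Some i)"] by auto
    then show ?case using elim by (intro Max_eqI) (auto simp: image_iff intro: exI[of _ i])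
  qed
  moreover have "{x \<in> space V. Max (range (\<lambda>i. x (Some i))) = 1} \<in> sets V" by measurable
  ultimately have "measure V {x \<in> space V. Max (range (\<lambda>i. x (Some i))) = 1} = 1"
    by (simp add: V.prob_Collect_eq_1)
  moreover have "space V = UNIV" using sets_eq_imp_space_eq[OF sets_V] by simp
  ultimately show False using ST3 by (simp add: ST3_def)
qed

text \<open>From \<open>x * (1 - x) \<le> x * ln (1 / x)\<close> one gets \<chi> \<ge> 1 - E \<Sum>
  V_i^2, which is positive.\<close>

lemma entropy_pos: "split_entropy V > 0"
proof -
  have "1 - limit_power_mean 1 = (\<Sum>i\<in>UNIV. \<integral>x. x (Some i) * (1 - x (Some i)) \<partial>V)"
  proof -
    have "x (Some i) * (1 - x (Some i)) = x (Some i) - (x (Some i))\<^sup>2" for i and x :: "'b option \<Rightarrow> real"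
      by (simp add: algebra_simps power2_eq_square)
    then show ?thesis by (simp add: limit_power_mean_1 sum_subtractf sum_integral_V)
  qed
  also have "\<dots> \<le> split_entropy V"
    unfolding split_entropy_def
  proof (intro sum_mono integral_mono_AE)
    fix i
    show "AE x in V. x (Some i) * (1 - x (Some i)) \<le> x (Some i) * ln (1 / x (Some i))"
      using AE_V_coordinate[of i] by eventually_elim (auto intro: entropy_term_bounds)
    show "integrable V (\<lambda>x. x (Some i) * (1 - x (Some i)))"
      using Bochner_Integration.integrable_diff[OF integrable_V_coordinate integrable_V_squares, of i i]
      by (simp add: algebra_simps power2_eq_square)
  qed simp
  finally show ?thesis using limit_power_mean_1_less by simp
qed

lemma power_mean_1: "m \<ge> 1 \<Longrightarrow> power_mean 1 m = (\<integral>x. (\<Sum>i\<in>UNIV. (real (x (Some i)) / real m)\<^sup>2) \<partial>measure_pmf (N m))"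
  unfolding power_mean_def by (intro Bochner_Integration.integral_cong refl sum.cong) simp

lemma power_mean_1_less:
  assumes m: "m \<ge> 1"
  shows "power_mean 1 m < 1"
proof (rule ccontr)
  let ?S = "\<lambda>x. \<Sum>i\<in>UNIV. (real (x (Some i)) / real m)\<^sup>2"
  assume "\<not> ?thesis"
  then have ge: "(\<integral>x. ?S x \<partial>measure_pmf (N m)) \<ge> 1" using m by (simp add: power_mean_1)
  have int: "integrable (measure_pmf (N m)) f" for f :: "_ \<Rightarrow> real"
    using m by (intro integrable_measure_pmf_finite) simp
  have nonneg: "AE x in measure_pmf (N m). 0 \<le> 1 - ?S x"
    unfolding AE_measure_pmf_iff
    using unit_coordinate_of_sum_squares(2)[OF _ sum_children_le[OF m]] by auto
  have "(\<integral>x. 1 - ?S x \<partial>measure_pmf (N m)) = 1 - (\<integral>x. ?S x \<partial>measure_pmf (N m))"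
    by (subst Bochner_Integration.integral_diff) (auto intro: int)
  then have "(\<integral>x. 1 - ?S x \<partial>measure_pmf (N m)) \<le> 0" using ge by simp
  moreover have "(\<integral>x. 1 - ?S x \<partial>measure_pmf (N m)) \<ge> 0" using nonneg by (rule integral_nonneg_AE)
  ultimately have "(\<integral>x. 1 - ?S x \<partial>measure_pmf (N m)) = 0" by linarith
  then have eq: "AE x in measure_pmf (N m). 1 - ?S x = 0"
    using nonneg by (subst (asm) integral_nonneg_eq_0_iff_AE) (auto intro: int)
  have "AE x in measure_pmf (N m). Max (range (\<lambda>i. x (Some i))) = m"
    unfolding AE_measure_pmf_iff
  proof
    fix x assume x: "x \<in> set_pmf (N m)"
    have "?S x = 1" using eq x by (auto simp: AE_measure_pmf_iff)
    then obtain i where i: "real (x (Some i)) / real m = 1"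
      using unit_coordinate_of_sum_squares(3)[OF _ sum_children_le[OF m x]] by auto
    have "real (x (Some j)) / real m \<le> 1" for j
      by (rule unit_coordinate_of_sum_squares(1)[OF _ sum_children_le[OF m x]]) simp
    then have "x (Some j) \<le> m" for j using m by simp
    moreover have "x (Some i) = m" using i m by (simp add: field_simps)
    ultimately show "Max (range (\<lambda>i. x (Some i))) = m"
      by (intro Max_eqI) (auto simp: image_iff intro: exI[of _ i])
  qed
  then have "measure_pmf.prob (N m) {x. Max (range (\<lambda>i. x (Some i))) = m} = 1"
    by (subst measure_pmf.prob_eq_1) (auto simp: AE_measure_pmf_iff)
  moreover have "measure_pmf.prob (N m) {x. Max (range (\<lambda>i. x (Some i))) = m} < 1"
    using ST3 m unfolding ST3_def by blast
  ultimately show False by linarith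
qed

text \<open>The limit lies below 1, which settles all large \<open>m\<close>; for each of the
  finitely many others (ST3) gives a value below 1, and a finite maximum stays below 1.\<close>

lemma power_mean_1_uniform:
  "\<exists>s. 0 \<le> s \<and> s < 1 \<and> (\<forall>m\<ge>1. power_mean 1 m \<le> s)"
proof -
  obtain r where r: "limit_power_mean 1 < r" "r < 1" using limit_power_mean_1_less dense by blast
  have "\<forall>\<^sub>F m in sequentially. power_mean 1 m < r"
    using order_tendstoD(2)[OF power_mean_tendsto r(1)] by simp
  then obtain m0 where m0: "\<And>m. m \<ge> m0 \<Longrightarrow> power_mean 1 m < r"
    by (auto simp: eventually_sequentially)
  define s where "s = Max (insert 0 (insert r (power_mean 1 ` {1..<m0})))"
  have fin: "finite (insert 0 (insert r (power_mean 1 ` {1..<m0})))" by simp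
  have "s \<in> insert 0 (insert r (power_mean 1 ` {1..<m0}))" unfolding s_def by (rule Max_in) auto
  then have "s < 1" using r power_mean_1_less by auto
  moreover have "power_mean 1 m \<le> s" if "m \<ge> 1" for m
  proof (cases "m < m0")
    case True
    then show ?thesis using that unfolding s_def by (intro Max_ge fin) auto
  next
    case False
    then have "power_mean 1 m \<le> r" using m0[of m] by simp
    also have "r \<le> s" unfolding s_def by (intro Max_ge fin) auto
    finally show ?thesis .
  qed
  moreover have "0 \<le> s" unfolding s_def by (intro Max_ge fin) auto
  ultimately show ?thesis by blast
qed

lemma power_mean_0_le: "m \<ge> 1 \<Longrightarrow> power_mean 0 m \<le> 1"
proof -
  assume m: "m \<ge> 1"
  have "power_mean 0 m \<le> (\<integral>x. 1 \<partial>measure_pmf (N m))"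
    unfolding power_mean_def using m sum_children_le[OF m]
    by (intro integral_mono_AE integrable_measure_pmf_finite) (auto simp: AE_measure_pmf_iff)
  then show ?thesis by simp
qed

section \<open>Lyapunov functions for the ball counts\<close>

lemma nn_integral_children_powr:
  assumes m: "m \<ge> 1" and c: "c \<ge> 0"
  shows "(\<integral>\<^sup>+x. (\<Sum>i\<in>UNIV. ennreal (c * real (x (Some i)) powr q)) \<partial>measure_pmf (N m))
    = ennreal (c * real m powr q * power_mean (q - 1) m)"
proof -
  have "(\<integral>\<^sup>+x. (\<Sum>i\<in>UNIV. ennreal (c * real (x (Some i)) powr q)) \<partial>measure_pmf (N m))
      = (\<integral>\<^sup>+x. ennreal (\<Sum>i\<in>UNIV. c * real (x (Some i)) powr q) \<partial>measure_pmf (N m))"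
    using c by (simp add: sum_ennreal)
  also have "\<dots> = ennreal (\<integral>x. (\<Sum>i\<in>UNIV. c * real (x (Some i)) powr q) \<partial>measure_pmf (N m))"
    using c m by (intro nn_integral_eq_integral integrable_measure_pmf_finite) (auto intro!: sum_nonneg)
  also have "(\<integral>x. (\<Sum>i\<in>UNIV. c * real (x (Some i)) powr q) \<partial>measure_pmf (N m))
      = (\<integral>x. c * real m powr q * (\<Sum>i\<in>UNIV. (real (x (Some i)) / real m) powr q) \<partial>measure_pmf (N m))"
    using m by (intro Bochner_Integration.integral_cong refl) (simp add: sum_distrib_left powr_divide)
  also have "\<dots> = c * real m powr q * power_mean (q - 1) m"
    unfolding power_mean_def by simp
  finally show ?thesis .
qed

text \<open>Empty vertices weigh nothing and vertices of the tree at least 1, so that the total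
  weight of a generation bounds its size; \<open>r\<close> is the growth rate per
  generation.\<close>

definition lyapunov :: "real \<Rightarrow> (nat \<Rightarrow> real) \<Rightarrow> bool" where
  "lyapunov r \<phi> \<longleftrightarrow> \<phi> 0 = 0 \<and> (\<forall>m\<ge>1. 1 \<le> \<phi> m \<and>
     (\<integral>\<^sup>+x. (\<Sum>i\<in>UNIV. ennreal (\<phi> (x (Some i)))) \<partial>measure_pmf (N m))
       \<le> ennreal r * ennreal (\<phi> m))"

text \<open>The exponent \<open>q\<close> has a rate below \<open>r\<close> only for large arguments.  The minimum of the two powers switches
  to the exponent \<open>p\<close>, whose rate is uniform, for the small ones.\<close>

lemma lyapunov_function:
  assumes pq: "0 < q" "q \<le> p" and r: "limit_power_mean (q - 1) < r" "0 \<le> r"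
    and p: "\<And>m. m \<ge> 1 \<Longrightarrow> power_mean (p - 1) m \<le> r"
  shows "\<exists>K \<phi>. K > 0 \<and> lyapunov r \<phi> \<and> (\<forall>m. \<phi> m \<le> K * real m powr q)"
proof -
  have "power_mean (q - 1) \<longlonglongrightarrow> limit_power_mean (q - 1)" using pq by (intro power_mean_tendsto) simp
  from order_tendstoD(2)[OF this r(1)] obtain m1 where m1: "\<And>m. m \<ge> m1 \<Longrightarrow> power_mean (q - 1) m < r"
    by (auto simp: eventually_sequentially)
  \<comment> \<open>The factor \<open>K\<close> makes the two powers cross exactly at
    \<open>m0\<close>; the lower bound 1 on \<open>m0\<close> ensures \<open>K \<ge> 1\<close> and
    hence \<open>\<phi> m \<ge> 1\<close>.\<close>
  define m0 where "m0 = max 1 m1"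
  define K where "K = real m0 powr (p - q)"
  have K: "K \<ge> 1" unfolding K_def m0_def using pq by (intro ge_one_powr_ge_zero) auto
  define \<phi> where "\<phi> m = min (real m powr p) (K * real m powr q)" for m
  have split: "real m powr p = real m powr (p - q) * real m powr q" if "m \<ge> 1" for m
    using that by (simp add: powr_add[symmetric])
  show ?thesis
    unfolding lyapunov_def
  proof (intro exI[of _ K] exI[of _ \<phi>] conjI allI impI)
    show "\<phi> 0 = 0" "K > 0" using K by (auto simp: \<phi>_def)
    show "\<phi> m \<le> K * real m powr q" for m by (simp add: \<phi>_def)
    fix m :: nat assume m: "m \<ge> 1"
    have "1 \<le> real m powr p" "1 \<le> real m powr q"
      using m pq by (auto intro!: ge_one_powr_ge_zero)
    moreover have "1 * 1 \<le> K * real m powr q" using K \<open>1 \<le> real m powr q\<close> by (intro mult_mono) auto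
    ultimately show "1 \<le> \<phi> m" by (simp add: \<phi>_def)
    show "(\<integral>\<^sup>+x. (\<Sum>i\<in>UNIV. ennreal (\<phi> (x (Some i)))) \<partial>measure_pmf (N m)) \<le> ennreal r * ennreal (\<phi> m)"
    \<comment> \<open>The minimum lies below both powers everywhere and equals one of them at
      \<open>m\<close>. So the children are estimated by the power that is exact at the
      parent.\<close>
    proof (cases "m < m0")
      case True
      have "(\<integral>\<^sup>+x. (\<Sum>i\<in>UNIV. ennreal (\<phi> (x (Some i)))) \<partial>measure_pmf (N m))
          \<le> (\<integral>\<^sup>+x. (\<Sum>i\<in>UNIV. ennreal (1 * real (x (Some i)) powr p)) \<partial>measure_pmf (N m))"
        by (intro nn_integral_mono sum_mono ennreal_leI) (simp add: \<phi>_def)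
      also have "\<dots> = ennreal (1 * real m powr p * power_mean (p - 1) m)"
        by (rule nn_integral_children_powr) (use m in auto)
      also have "\<dots> \<le> ennreal (1 * real m powr p * r)"
        using p[OF m] by (intro ennreal_leI mult_left_mono) auto
      also have "real m powr p = \<phi> m"
      proof -
        have "real m powr (p - q) \<le> K" unfolding K_def using True pq by (intro powr_mono2) auto
        then have "real m powr p \<le> K * real m powr q" unfolding split[OF m] by (intro mult_right_mono) auto
        then show ?thesis by (simp add: \<phi>_def)
      qed
      finally show ?thesis using r(2) by (simp add: ennreal_mult''[symmetric] mult.commute \<phi>_def K_def)
    next
      case False
      have "(\<integral>\<^sup>+x. (\<Sum>i\<in>UNIV. ennreal (\<phi> (x (Some i)))) \<partial>measure_pmf (N m))
          \<le> (\<integral>\<^sup>+x. (\<Sum>i\<in>UNIV. ennreal (K * real (x (Some i)) powr q)) \<partial>measure_pmf (N m))"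
        by (intro nn_integral_mono sum_mono ennreal_leI) (simp add: \<phi>_def)
      also have "\<dots> = ennreal (K * real m powr q * power_mean (q - 1) m)"
        by (rule nn_integral_children_powr) (use m K in auto)
      also have "\<dots> \<le> ennreal (K * real m powr q * r)"
        using m1[of m] False K by (intro ennreal_leI mult_left_mono) (auto simp: m0_def less_imp_le)
      also have "K * real m powr q = \<phi> m"
      proof -
        have "K \<le> real m powr (p - q)" unfolding K_def using False pq by (intro powr_mono2) auto
        then have "K * real m powr q \<le> real m powr p" unfolding split[OF m] by (intro mult_right_mono) auto
        then show ?thesis by (simp add: \<phi>_def)
      qed
      finally show ?thesis using r(2) by (simp add: ennreal_mult''[symmetric] mult.commute \<phi>_def K_def)
    qed
  qed
qed

text \<open>Exponent slightly above 1, used for vertices that are too deep. Below the threshold the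
  exponent 2 takes over, whose rate \<open>s\<close> is uniformly below 1.\<close>

lemma lyapunov_upper:
  assumes a: "0 < a" "a < split_entropy V"
  shows "\<exists>\<theta> K \<phi>. \<theta> > 0 \<and> K > 0 \<and> lyapunov (exp (- \<theta> * a)) \<phi> \<and> (\<forall>m. \<phi> m \<le> K * real m powr (1 + \<theta>))"
proof -
  obtain s where s: "0 \<le> s" "s < 1" "\<And>m. m \<ge> 1 \<Longrightarrow> power_mean 1 m \<le> s"
    using power_mean_1_uniform by blast
  define C where "C = 4 * real CARD('b)"
  have C: "C > 0" by (simp add: C_def)
  \<comment> \<open>The three bounds in turn: the expansion of the power mean requires 1/2; the
    quadratic error must stay below the gain \<theta>(\<chi> - a); and
    \<open>s \<le> 1 - \<theta> * a\<close> puts the uniform rate of the squares below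
    \<open>exp (- \<theta> * a)\<close>.\<close>
  define \<theta> where "\<theta> = min (1 / 2) (min ((split_entropy V - a) / (2 * C)) ((1 - s) / a))"
  have "\<theta> > 0" using a s C by (simp add: \<theta>_def)
  moreover have "\<theta> \<le> 1 / 2" unfolding \<theta>_def by (rule min.cobounded1)
  moreover have "\<theta> \<le> (split_entropy V - a) / (2 * C)" "\<theta> \<le> (1 - s) / a" by (simp_all add: \<theta>_def)
  ultimately have \<theta>: "\<theta> > 0" "\<theta> \<le> 1 / 2" "\<theta> \<le> (split_entropy V - a) / (2 * C)" "\<theta> \<le> (1 - s) / a" .
  have e: "1 - \<theta> * a \<le> exp (- \<theta> * a)" using exp_ge_add_one_self[of "- \<theta> * a"] by simp
  have "\<exists>K \<phi>. K > 0 \<and> lyapunov (exp (- \<theta> * a)) \<phi> \<and> (\<forall>m. \<phi> m \<le> K * real m powr (1 + \<theta>))"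
  proof (rule lyapunov_function[of _ 2])
    have "\<theta> * C < split_entropy V - a" using \<theta>(3) C a by (simp add: field_simps)
    then have "\<theta> * (\<theta> * C) < \<theta> * (split_entropy V - a)" using \<theta>(1) by (intro mult_strict_left_mono)
    then have "1 - \<theta> * split_entropy V + C * \<theta>\<^sup>2 < 1 - \<theta> * a" by (simp add: power2_eq_square algebra_simps)
    moreover have "limit_power_mean \<theta> \<le> 1 - \<theta> * split_entropy V + C * \<theta>\<^sup>2"
      unfolding C_def using \<theta> by (intro limit_power_mean_le) auto
    ultimately show "limit_power_mean (1 + \<theta> - 1) < exp (- \<theta> * a)" using e by simp
    fix m :: nat assume "m \<ge> 1"
    have "s \<le> 1 - \<theta> * a" using \<theta>(4) a by (simp add: field_simps)
    then show "power_mean (2 - 1) m \<le> exp (- \<theta> * a)" using s(3)[OF \<open>m \<ge> 1\<close>] e by simp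
  qed (use \<theta> in auto)
  with \<theta>(1) show ?thesis by blast
qed

text \<open>Exponent slightly below 1, used for vertices that are too shallow. The rate exceeds 1,
  so below the threshold the exponent 1 works: the children receive at most \<open>m\<close> balls
  in total.\<close>

lemma lyapunov_lower:
  assumes a: "split_entropy V < a"
  shows "\<exists>\<theta> K \<phi>. \<theta> > 0 \<and> K > 0 \<and> lyapunov (exp (\<theta> * a)) \<phi> \<and> (\<forall>m. \<phi> m \<le> K * real m powr (1 - \<theta>))"
proof -
  define C where "C = 4 * real CARD('b)"
  have C: "C > 0" by (simp add: C_def)
  define \<theta> where "\<theta> = min (1 / 2) ((a - split_entropy V) / (2 * C))"
  have \<theta>: "\<theta> > 0" "\<theta> \<le> 1 / 2" "\<theta> \<le> (a - split_entropy V) / (2 * C)" using a C by (auto simp: \<theta>_def)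
  have "a > 0" using a entropy_pos by simp
  have e: "1 + \<theta> * a \<le> exp (\<theta> * a)" using exp_ge_add_one_self[of "\<theta> * a"] by simp
  have "\<exists>K \<phi>. K > 0 \<and> lyapunov (exp (\<theta> * a)) \<phi> \<and> (\<forall>m. \<phi> m \<le> K * real m powr (1 - \<theta>))"
  proof (rule lyapunov_function[of _ 1])
    have "\<theta> * C < a - split_entropy V" using \<theta>(3) C a by (simp add: field_simps)
    then have "\<theta> * (\<theta> * C) < \<theta> * (a - split_entropy V)" using \<theta>(1) by (intro mult_strict_left_mono)
    then have "1 - (- \<theta>) * split_entropy V + C * (- \<theta>)\<^sup>2 < 1 + \<theta> * a" by (simp add: power2_eq_square algebra_simps)
    moreover have "limit_power_mean (- \<theta>) \<le> 1 - (- \<theta>) * split_entropy V + C * (- \<theta>)\<^sup>2"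
      unfolding C_def using \<theta> by (intro limit_power_mean_le) auto
    ultimately show "limit_power_mean (1 - \<theta> - 1) < exp (\<theta> * a)" using e by (simp, linarith)
    fix m :: nat assume "m \<ge> 1"
    have "1 \<le> exp (\<theta> * a)" using \<theta> \<open>a > 0\<close> by simp
    then show "power_mean (1 - 1) m \<le> exp (\<theta> * a)"
      using power_mean_0_le[OF \<open>m \<ge> 1\<close>] unfolding diff_self by linarith
  qed (use \<theta> in auto)
  with \<theta>(1) show ?thesis by blast
qed

lemma lyapunov_squares:
  "\<exists>s. 0 < s \<and> s < 1 \<and> lyapunov s (\<lambda>m. (real m)\<^sup>2)"
proof -
  obtain s where s: "0 \<le> s" "s < 1" "\<And>m. m \<ge> 1 \<Longrightarrow> power_mean 1 m \<le> s"
    using power_mean_1_uniform by blast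
  \<comment> \<open>Enlarged to be strictly positive, because \<open>ln s\<close> is taken
    later.\<close>
  obtain s' where s': "s < s'" "s' < 1" using s(2) dense by blast
  have pw: "(real k)\<^sup>2 = 1 * real k powr 2" for k by (cases "k = 0") auto
  show ?thesis
    unfolding lyapunov_def
  proof (intro exI[of _ s'] conjI allI impI)
    fix m :: nat assume m: "m \<ge> 1"
    have "(\<integral>\<^sup>+x. (\<Sum>i\<in>UNIV. ennreal ((real (x (Some i)))\<^sup>2)) \<partial>measure_pmf (N m))
        = ennreal (1 * real m powr 2 * power_mean (2 - 1) m)"
      unfolding pw by (rule nn_integral_children_powr[OF m]) simp
    also have "\<dots> \<le> ennreal (1 * real m powr 2 * s')"
      using s(3)[OF m] s' by (intro ennreal_leI mult_left_mono) auto
    finally show "(\<integral>\<^sup>+x. (\<Sum>i\<in>UNIV. ennreal ((real (x (Some i)))\<^sup>2)) \<partial>measure_pmf (N m)) \<le> ennreal s' * ennreal ((real m)\<^sup>2)"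
      using s s' unfolding pw[of m] by (simp add: ennreal_mult''[symmetric] mult.commute)
  qed (use s s' one_le_power in auto)
qed

end

section \<open>Pairs of vertices at an untypical distance\<close>

lemma suminf_exp_tail_le:
  fixes b h y :: real
  assumes b: "b > 0" and y: "y \<ge> 0"
  shows "(\<Sum>k. if h \<le> real k then ennreal (exp (- b)) ^ k * ennreal y else 0)
    \<le> ennreal (exp (- b * h) * y / (1 - exp (- b)))"
proof -
  let ?r = "exp (- b)"
  define k0 where "k0 = nat \<lceil>h\<rceil>"
  have iff: "h \<le> real k \<longleftrightarrow> k0 \<le> k" for k by (simp add: k0_def nat_le_iff ceiling_le_iff)
  have r: "?r < 1" using b by simp
  have "(\<lambda>k. ?r ^ k * (?r ^ k0 * y)) sums (1 / (1 - ?r) * (?r ^ k0 * y))"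
    using r by (intro sums_mult2 geometric_sums) simp
  then have "(\<lambda>k. (if k0 \<le> k + k0 then ?r ^ (k + k0) * y else 0)) sums (?r ^ k0 * y / (1 - ?r))"
    by (simp add: power_add mult_ac)
  then have sums: "(\<lambda>k. if k0 \<le> k then ?r ^ k * y else 0) sums (?r ^ k0 * y / (1 - ?r))"
    by (subst (asm) sums_zero_iff_shift) auto
  have "(\<Sum>k. if h \<le> real k then ennreal ?r ^ k * ennreal y else 0)
      = (\<Sum>k. ennreal (if k0 \<le> k then ?r ^ k * y else 0))"
    using y by (intro suminf_cong) (simp add: iff ennreal_power ennreal_mult)
  also have "\<dots> = ennreal (?r ^ k0 * y / (1 - ?r))"
    using y sums by (subst suminf_ennreal2) (auto simp: sums_iff)
  also have "\<dots> \<le> ennreal (exp (- b * h) * y / (1 - ?r))"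
  proof (intro ennreal_leI divide_right_mono mult_right_mono)
    have "?r ^ k0 = exp (- b * real k0)" by (simp add: exp_of_nat_mult[symmetric] mult.commute)
    also have "\<dots> \<le> exp (- b * h)" using b iff[of k0] by simp
    finally show "?r ^ k0 \<le> exp (- b * h)" .
  qed (use y r in auto)
  finally show ?thesis .
qed

text \<open>The terms grow with \<open>k\<close>, so the sum is bounded by the number of terms times
  the largest one. The absolute value covers a negative \<open>h\<close>, where the sum is
  empty.\<close>

lemma suminf_exp_head_le:
  fixes b h y :: real
  assumes b: "b \<ge> 0" and y: "y \<ge> 0"
  shows "(\<Sum>k. if real k \<le> h then ennreal (exp b) ^ k * ennreal y else 0)
    \<le> ennreal ((\<bar>h\<bar> + 1) * (exp (b * h) * y))"
proof -
  let ?K = "{k. real k \<le> h}"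
  have fin: "finite ?K" by (rule finite_subset[of _ "{..nat \<lfloor>h\<rfloor>}"]) (auto simp: le_nat_floor)
  have card: "real (card ?K) \<le> \<bar>h\<bar> + 1"
  proof (cases "h < 0")
    case True
    then have "?K = {}" by (auto simp: not_le)
    then show ?thesis by simp
  next
    case False
    have "card ?K \<le> card {..nat \<lfloor>h\<rfloor>}" by (rule card_mono) (auto simp: le_nat_floor)
    then have "real (card ?K) \<le> real (nat \<lfloor>h\<rfloor>) + 1" by simp
    also have "real (nat \<lfloor>h\<rfloor>) \<le> h" using False by simp
    finally show ?thesis by simp
  qed
  have "(\<Sum>k. if real k \<le> h then ennreal (exp b) ^ k * ennreal y else 0)
      = (\<Sum>k\<in>?K. ennreal (exp b) ^ k * ennreal y)"
    by (subst suminf_finite[OF fin]) auto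
  also have "\<dots> \<le> (\<Sum>k\<in>?K. ennreal (exp (b * h) * y))"
  proof (intro sum_mono)
    fix k assume "k \<in> ?K"
    then have "exp b ^ k * y \<le> exp (b * h) * y"
      using b y by (intro mult_right_mono) (auto simp: exp_of_nat2_mult[symmetric] mult_left_mono)
    then show "ennreal (exp b) ^ k * ennreal y \<le> ennreal (exp (b * h) * y)"
      using y by (simp add: ennreal_power ennreal_mult[symmetric] ennreal_leI)
  qed
  also have "\<dots> = ennreal (real (card ?K) * (exp (b * h) * y))"
    using y by (simp add: ennreal_mult ennreal_of_nat_eq_real_of_nat)
  also have "\<dots> \<le> ennreal ((\<bar>h\<bar> + 1) * (exp (b * h) * y))"
    using card y by (intro ennreal_leI mult_right_mono) auto
  finally show ?thesis .
qed

section \<open>Expected numbers of vertices at untypical depths\<close>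

context split_law
begin

text \<open>At depth \<beta> ln n the bound \<rho>^k \<phi>(n) has become n^(1 - c). The constants
  are chosen before \<open>n\<close>, \<open>M\<close> and \<open>X\<close>, since every tree lives
  on its own probability space.\<close>

lemma count_depth_upper:
  assumes \<epsilon>: "\<epsilon> > 0"
  shows "\<exists>c K. c > 0 \<and> K > 0 \<and> (\<forall>n\<ge>1. \<forall>(M :: 'a measure) X. split_environment M N X \<longrightarrow>
    (\<integral>\<^sup>+\<omega>. count_depth (\<lambda>k. (1 / split_entropy V + \<epsilon>) * ln (real n) \<le> real k) (split_tree n (\<lambda>u m. X u m \<omega>)) \<partial>M)
      \<le> ennreal (K * (real n * exp (- c * ln (real n)))))"
proof -
  define e where "e = \<epsilon> * split_entropy V"
  have e: "e > 0" using \<epsilon> entropy_pos by (simp add: e_def)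
  \<comment> \<open>Between \<open>1 / \<beta>\<close> and \<chi>: below \<chi> a Lyapunov function
    with rate \<open>exp (- \<theta> * a)\<close> exists, and \<open>a * \<beta> > 1\<close> makes
    the bound at depth \<open>\<beta> * ln n\<close> smaller than \<open>n\<close> by a
    power.\<close>
  define a where "a = split_entropy V / (1 + e / 2)"
  have a: "0 < a" "a < split_entropy V" using e entropy_pos by (auto simp: a_def field_simps)
  from lyapunov_upper[OF a] obtain \<theta> K \<phi> where \<theta>: "\<theta> > 0" and K: "K > 0" and ly: "lyapunov (exp (- \<theta> * a)) \<phi>"
    and \<phi>K: "\<And>m. \<phi> m \<le> K * real m powr (1 + \<theta>)" by blast
  from ly have \<phi>0: "\<phi> 0 = 0" and \<phi>1: "\<And>m. m \<ge> 1 \<Longrightarrow> 1 \<le> \<phi> m"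
    and step: "\<And>m. m \<ge> 1 \<Longrightarrow> (\<integral>\<^sup>+x. (\<Sum>i\<in>UNIV. ennreal (\<phi> (x (Some i)))) \<partial>measure_pmf (N m))
       \<le> ennreal (exp (- \<theta> * a)) * ennreal (\<phi> m)"
    by (auto simp: lyapunov_def)
  define \<beta> where "\<beta> = 1 / split_entropy V + \<epsilon>"
  define c where "c = \<theta> * (a * \<beta> - 1)"
  have "\<beta> = (1 + e) / split_entropy V" using entropy_pos by (simp add: \<beta>_def e_def field_simps)
  then have "a * \<beta> = (1 + e) / (1 + e / 2)" using entropy_pos by (simp add: a_def)
  also have "\<dots> > 1" using e by (simp add: field_simps)
  finally have "a * \<beta> > 1" .
  then have c: "c > 0" using \<theta> by (simp add: c_def)
  have b: "\<theta> * a > 0" using \<theta> a by simp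
  define K' where "K' = K / (1 - exp (- (\<theta> * a)))"
  have K': "K' > 0" using K b by (simp add: K'_def)
  show ?thesis
  proof (rule exI[of _ c], rule exI[of _ K'], intro conjI allI impI c K')
    fix n :: nat and M :: "'a measure" and X
    assume n: "n \<ge> 1" and "split_environment M N X"
    then interpret split_environment M N X n by simp
    have "(\<integral>\<^sup>+\<omega>. count_depth (\<lambda>k. \<beta> * ln (real n) \<le> real k) (tree \<omega>) \<partial>M)
        \<le> (\<Sum>k. if \<beta> * ln (real n) \<le> real k then ennreal (exp (- (\<theta> * a))) ^ k * ennreal (\<phi> n) else 0)"
      using step \<phi>0 \<phi>1 by (intro nn_integral_count_depth_le[where \<phi> = "\<lambda>m. ennreal (\<phi> m)"]) auto
    also have "\<dots> \<le> ennreal (exp (- (\<theta> * a) * (\<beta> * ln (real n))) * \<phi> n / (1 - exp (- (\<theta> * a))))"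
      using \<phi>1[OF n] by (intro suminf_exp_tail_le b) simp
    also have "\<dots> \<le> ennreal (exp (- (\<theta> * a) * (\<beta> * ln (real n))) * (K * real n powr (1 + \<theta>)) / (1 - exp (- (\<theta> * a))))"
      using b by (intro ennreal_leI divide_right_mono mult_left_mono \<phi>K) auto
    also have "real n powr (1 + \<theta>) = real n * exp (\<theta> * ln (real n))"
      using n by (simp add: powr_add) (simp add: powr_def)
    also have "exp (- (\<theta> * a) * (\<beta> * ln (real n))) * (K * (real n * exp (\<theta> * ln (real n)))) / (1 - exp (- (\<theta> * a)))
        = K' * (real n * exp (- c * ln (real n)))"
    proof -
      have "- (\<theta> * a) * (\<beta> * ln (real n)) + \<theta> * ln (real n) = - c * ln (real n)"
        by (simp add: c_def algebra_simps)
      then have "exp (- (\<theta> * a) * (\<beta> * ln (real n))) * exp (\<theta> * ln (real n)) = exp (- c * ln (real n))"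
        by (simp only: exp_add[symmetric])
      then show ?thesis by (simp add: K'_def mult_ac)
    qed
    finally show "(\<integral>\<^sup>+\<omega>. count_depth (\<lambda>k. (1 / split_entropy V + \<epsilon>) * ln (real n) \<le> real k) (tree \<omega>) \<partial>M)
        \<le> ennreal (K' * (real n * exp (- c * ln (real n))))" by (simp add: \<beta>_def)
  qed
qed

lemma count_depth_lower:
  assumes \<epsilon>: "\<epsilon> > 0"
  shows "\<exists>c K. c > 0 \<and> K > 0 \<and> (\<forall>n\<ge>1. \<forall>(M :: 'a measure) X. split_environment M N X \<longrightarrow>
    (\<integral>\<^sup>+\<omega>. count_depth (\<lambda>k. real k \<le> (1 / split_entropy V - \<epsilon>) * ln (real n)) (split_tree n (\<lambda>u m. X u m \<omega>)) \<partial>M)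
      \<le> ennreal (K * (ln (real n) + 1) * (real n * exp (- c * ln (real n)))))"
proof -
  define e where "e = \<epsilon> * split_entropy V"
  have e: "e > 0" using \<epsilon> entropy_pos by (simp add: e_def)
  \<comment> \<open>Above \<chi>, as the Lyapunov function requires, but with
    \<open>a * \<beta> = 1 - e^2 < 1\<close>, so that the growth up to depth
    \<open>\<beta> * ln n\<close> does not make up for the smaller exponent. This also covers
    \<beta> \<le> 0.\<close>
  define a where "a = split_entropy V * (1 + e)"
  have a: "split_entropy V < a" using e entropy_pos by (auto simp: a_def)
  from lyapunov_lower[OF a] obtain \<theta> K \<phi> where \<theta>: "\<theta> > 0" and K: "K > 0" and ly: "lyapunov (exp (\<theta> * a)) \<phi>"
    and \<phi>K: "\<And>m. \<phi> m \<le> K * real m powr (1 - \<theta>)" by blast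
  from ly have \<phi>0: "\<phi> 0 = 0" and \<phi>1: "\<And>m. m \<ge> 1 \<Longrightarrow> 1 \<le> \<phi> m"
    and step: "\<And>m. m \<ge> 1 \<Longrightarrow> (\<integral>\<^sup>+x. (\<Sum>i\<in>UNIV. ennreal (\<phi> (x (Some i)))) \<partial>measure_pmf (N m))
       \<le> ennreal (exp (\<theta> * a)) * ennreal (\<phi> m)"
    by (auto simp: lyapunov_def)
  define \<beta> where "\<beta> = 1 / split_entropy V - \<epsilon>"
  define c where "c = \<theta> * (1 - a * \<beta>)"
  have "\<beta> = (1 - e) / split_entropy V" using entropy_pos by (simp add: \<beta>_def e_def field_simps)
  then have "a * \<beta> = (1 + e) * (1 - e)" using entropy_pos by (simp add: a_def)
  also have "\<dots> = 1 - e * e" by (simp add: algebra_simps)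
  also have "\<dots> < 1" using e by simp
  finally have "a * \<beta> < 1" .
  then have c: "c > 0" using \<theta> by (simp add: c_def)
  have b: "\<theta> * a \<ge> 0" using \<theta> a entropy_pos by simp
  define K' where "K' = (\<bar>\<beta>\<bar> + 1) * K"
  have K': "K' > 0" using K by (simp add: K'_def)
  show ?thesis
  proof (rule exI[of _ c], rule exI[of _ K'], intro conjI allI impI c K')
    fix n :: nat and M :: "'a measure" and X
    assume n: "n \<ge> 1" and "split_environment M N X"
    then interpret split_environment M N X n by simp
    let ?L = "ln (real n)"
    have L: "?L \<ge> 0" using n by simp
    have "(\<integral>\<^sup>+\<omega>. count_depth (\<lambda>k. real k \<le> \<beta> * ?L) (tree \<omega>) \<partial>M)
        \<le> (\<Sum>k. if real k \<le> \<beta> * ?L then ennreal (exp (\<theta> * a)) ^ k * ennreal (\<phi> n) else 0)"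
      using step \<phi>0 \<phi>1 by (intro nn_integral_count_depth_le[where \<phi> = "\<lambda>m. ennreal (\<phi> m)"]) auto
    also have "\<dots> \<le> ennreal ((\<bar>\<beta> * ?L\<bar> + 1) * (exp (\<theta> * a * (\<beta> * ?L)) * \<phi> n))"
      using \<phi>1[OF n] by (intro suminf_exp_head_le b) simp
    also have "\<dots> \<le> ennreal (((\<bar>\<beta>\<bar> + 1) * (?L + 1)) * (exp (\<theta> * a * (\<beta> * ?L)) * (K * real n powr (1 - \<theta>))))"
      using L \<phi>1[OF n] K by (intro ennreal_leI mult_mono \<phi>K mult_nonneg_nonneg) (auto simp: abs_mult algebra_simps)
    also have "real n powr (1 - \<theta>) = real n * exp (- \<theta> * ?L)"
      using n powr_add[of "real n" 1 "- \<theta>"] by (simp add: powr_def[of _ "- \<theta>"])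
    also have "((\<bar>\<beta>\<bar> + 1) * (?L + 1)) * (exp (\<theta> * a * (\<beta> * ?L)) * (K * (real n * exp (- \<theta> * ?L))))
        = K' * (?L + 1) * (real n * exp (- c * ?L))"
    proof -
      have "\<theta> * a * (\<beta> * ?L) + - \<theta> * ?L = - c * ?L" by (simp add: c_def algebra_simps)
      then have "exp (\<theta> * a * (\<beta> * ?L)) * exp (- \<theta> * ?L) = exp (- c * ?L)"
        by (simp only: exp_add[symmetric])
      then show ?thesis by (simp add: K'_def mult_ac)
    qed
    finally show "(\<integral>\<^sup>+\<omega>. count_depth (\<lambda>k. real k \<le> (1 / split_entropy V - \<epsilon>) * ?L) (tree \<omega>) \<partial>M)
        \<le> ennreal (K' * (?L + 1) * (real n * exp (- c * ?L)))" by (simp add: \<beta>_def)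
  qed
qed

end

section \<open>The random tree and its pairs at an untypical distance\<close>

locale random_split = split_law N V + split_environment M N X n
  for N :: "nat \<Rightarrow> ('b::finite option \<Rightarrow> nat) pmf" and V and M :: "'a measure" and X and n +
  assumes n_pos: "n \<ge> 1"
begin

text \<open>The squared ball counts decay geometrically in mean, so the expected number of vertices
  is at most n^2 \<Sum> s^k < \<infinity>.\<close>

lemma AE_finite_tree: "AE \<omega> in M. finite (tree \<omega>)"
proof -
  obtain s where s: "0 < s" "s < 1" and "lyapunov s (\<lambda>m. (real m)\<^sup>2)"
    using lyapunov_squares by blast
  then have step: "\<And>m. m \<ge> 1 \<Longrightarrow>
    (\<integral>\<^sup>+x. (\<Sum>i\<in>UNIV. ennreal ((real (x (Some i)))\<^sup>2)) \<partial>measure_pmf (N m)) \<le> ennreal s * ennreal ((real m)\<^sup>2)"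
    by (auto simp: lyapunov_def)
  have "(\<integral>\<^sup>+\<omega>. count_depth (\<lambda>_. True) (tree \<omega>) \<partial>M) \<le> (\<Sum>k. if True then ennreal s ^ k * ennreal ((real n)\<^sup>2) else 0)"
    using step by (intro nn_integral_count_depth_le[where \<phi> = "\<lambda>m. ennreal ((real m)\<^sup>2)"]) auto
  also have "\<dots> = (\<Sum>k. ennreal (s ^ k * (real n)\<^sup>2))"
    using s by (simp add: ennreal_power ennreal_mult)
  also have "\<dots> = ennreal (\<Sum>k. s ^ k * (real n)\<^sup>2)"
    using s by (intro suminf_ennreal2 summable_mult2 summable_geometric) auto
  also have "\<dots> < \<infinity>" by simp
  finally have "(\<integral>\<^sup>+\<omega>. count_depth (\<lambda>_. True) (tree \<omega>) \<partial>M) \<noteq> \<infinity>" by simp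
  from nn_integral_PInf_AE[OF measurable_count_depth this]
  show ?thesis
    by eventually_elim (auto intro!: finite_of_count_depth simp: less_top)
qed

lemma AE_ball_conserving: "AE \<omega> in M. ball_conserving (\<lambda>u m. X u m \<omega>)"
  using AE_X_in_set_pmf
  by eventually_elim (use split_vectors in \<open>auto simp: ball_conserving_def split_vectors_def\<close>)

end


text \<open>The probability, for a fixed finite tree, that two independent uniform vertices are at
  an untypical rescaled distance. It is 0 for infinite \<open>t\<close>, as \<open>card\<close> then
  is 0.\<close>

definition bad_fraction :: "real \<Rightarrow> real \<Rightarrow> real \<Rightarrow> 'b list set \<Rightarrow> real" where
  "bad_fraction L a \<epsilon> t =
     real (card {(u, v) \<in> t \<times> t. \<epsilon> \<le> \<bar>real (graph_dist t u v) / L - a\<bar>}) / (real (card t))\<^sup>2"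

lemma bad_fraction_nonneg: "0 \<le> bad_fraction L a \<epsilon> t"
  by (simp add: bad_fraction_def)

lemma bad_fraction_infinite: "infinite t \<Longrightarrow> bad_fraction L a \<epsilon> t = 0"
  by (simp add: bad_fraction_def)

text \<open>The tolerance \<open>4 * \<epsilon>\<close> adds up an error \<epsilon> for each of the
  two depths and 2\<epsilon> for a common ancestor of depth up to \<epsilon> L. The lower bound
  \<open>n / C\<close> for the size of the tree replaces the random denominator.\<close>

lemma bad_fraction_le:
  fixes L a \<epsilon> :: real
  assumes x: "ball_conserving x" and C: "\<And>v m. m \<ge> 1 \<Longrightarrow> x v m None \<le> C"
    and fin: "finite (split_tree n x)" and n: "n \<ge> 1" and L: "L > 0" and \<epsilon>: "\<epsilon> > 0"
  defines "t \<equiv> split_tree n x" and "lo \<equiv> (a - \<epsilon>) * L" and "hi \<equiv> (a + \<epsilon>) * L"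
  shows "bad_fraction L (2 * a) (4 * \<epsilon>) t
    \<le> 2 * real C / real n * real (card {v \<in> t. hi \<le> real (length v) \<or> real (length v) \<le> lo})
      + (real C * real (nat \<lceil>hi\<rceil>) / real n)\<^sup>2 * (\<Sum>w | length w = nat \<lfloor>\<epsilon> * L\<rfloor>. (real (num_balls n x w))\<^sup>2)"
proof -
  let ?k = "nat \<lfloor>\<epsilon> * L\<rfloor>" and ?ct = "real (card t)"
  let ?D = "real (card {v \<in> t. hi \<le> real (length v) \<or> real (length v) \<le> lo})"
  let ?S = "\<Sum>w | length w = ?k. (real (nat \<lceil>hi\<rceil>) * real (num_balls n x w))\<^sup>2"
  have k: "real ?k \<le> \<epsilon> * L" using L \<epsilon> by simp
  have "{(u, v) \<in> t \<times> t. 4 * \<epsilon> \<le> \<bar>real (graph_dist t u v) / L - 2 * a\<bar>}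
      \<subseteq> {(u, v) \<in> t \<times> t. real (graph_dist t u v) \<notin> {2 * lo - 2 * real ?k <..< 2 * hi}}"
  proof clarsimp
    fix u v
    assume bad: "4 * \<epsilon> \<le> \<bar>real (graph_dist t u v) / L - 2 * a\<bar>"
      and d: "2 * lo - 2 * real ?k < real (graph_dist t u v)" "real (graph_dist t u v) < 2 * hi"
    have "(2 * a - 4 * \<epsilon>) * L < real (graph_dist t u v)" using d(1) k by (simp add: lo_def algebra_simps)
    moreover have "real (graph_dist t u v) < (2 * a + 4 * \<epsilon>) * L"
    proof -
      have "2 * hi = 2 * a * L + 2 * (\<epsilon> * L)" "(2 * a + 4 * \<epsilon>) * L = 2 * a * L + 4 * (\<epsilon> * L)"
        by (simp_all add: hi_def algebra_simps)
      then show ?thesis using d(2) mult_pos_pos[OF \<epsilon> L] by linarith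
    qed
    ultimately have "2 * a - 4 * \<epsilon> < real (graph_dist t u v) / L" "real (graph_dist t u v) / L < 2 * a + 4 * \<epsilon>"
      using L by (simp_all add: field_simps)
    with bad show False by linarith
  qed
  then have "real (card {(u, v) \<in> t \<times> t. 4 * \<epsilon> \<le> \<bar>real (graph_dist t u v) / L - 2 * a\<bar>})
      \<le> real (card {(u, v) \<in> t \<times> t. real (graph_dist t u v) \<notin> {2 * lo - 2 * real ?k <..< 2 * hi}})"
    by (intro of_nat_mono card_mono) (rule finite_subset[of _ "t \<times> t"], use fin in \<open>auto simp: t_def\<close>)
  also have "\<dots> \<le> 2 * ?ct * real (card {v \<in> t. real (length v) \<notin> {lo <..< hi}}) + ?S"
    unfolding t_def by (rule card_bad_pairs_le[OF x fin])
  also have "{v \<in> t. real (length v) \<notin> {lo <..< hi}} = {v \<in> t. hi \<le> real (length v) \<or> real (length v) \<le> lo}"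
    by auto
  finally have "bad_fraction L (2 * a) (4 * \<epsilon>) t \<le> (2 * ?ct * ?D + ?S) / ?ct\<^sup>2"
    unfolding bad_fraction_def by (intro divide_right_mono) auto
  moreover have ct: "?ct > 0"
    using fin Nil_in_split_tree[OF n, of x] by (auto simp: t_def card_gt_0_iff)
  have "n \<le> C * card t" unfolding t_def by (rule num_balls_le_card_tree[OF x C fin])
  then have "real n \<le> real C * ?ct" by (metis of_nat_le_iff of_nat_mult)
  then have inv: "1 / ?ct \<le> real C / real n" using ct n by (simp add: field_simps)
  have "(2 * ?ct * ?D + ?S) / ?ct\<^sup>2 = 2 * ?D * (1 / ?ct) + ?S * (1 / ?ct)\<^sup>2"
    using ct by (simp add: field_simps power2_eq_square)
  moreover have "\<dots> \<le> 2 * ?D * (real C / real n) + ?S * (real C / real n)\<^sup>2"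
    using inv ct by (intro add_mono mult_left_mono power_mono sum_nonneg) auto
  moreover have "?S * (real C / real n)\<^sup>2
      = (real C * real (nat \<lceil>hi\<rceil>) / real n)\<^sup>2 * (\<Sum>w | length w = ?k. (real (num_balls n x w))\<^sup>2)"
    by (simp add: power_mult_distrib sum_distrib_left sum_distrib_right sum_divide_distrib power_divide mult_ac)
  ultimately show ?thesis by (simp add: mult_ac)
qed

context random_split
begin

text \<open>There are uncountably many vertex sets but only countably many finite ones. A property
  that is constant on infinite sets is therefore measurable, whatever it says about finite
  trees.\<close>

lemma sets_tree_Collect:
  assumes "\<And>t. infinite t \<Longrightarrow> Q t = q"
  shows "{\<omega> \<in> space M. Q (tree \<omega>)} \<in> sets M"
proof -
  let ?U = "\<lambda>R. \<Union>t\<in>{t. finite t \<and> R t}. {\<omega> \<in> space M. tree \<omega> = t}"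
  have U: "?U R \<in> sets M" for R
    by (rule sets.countable_UN'')
      (auto intro: sets_tree_eq countable_subset[OF _ countable_Collect_finite[where 'a = "'b list"]])
  have "{\<omega> \<in> space M. Q (tree \<omega>)} = ?U Q \<union> (if q then space M - ?U (\<lambda>_. True) else {})"
    using assms by (cases q) auto
  also have "\<dots> \<in> sets M" using U[of Q] U[of "\<lambda>_. True"] by (cases q) auto
  finally show ?thesis .
qed

lemma measurable_bad_fraction [measurable]: "(\<lambda>\<omega>. bad_fraction L a \<epsilon> (tree \<omega>)) \<in> borel_measurable M"
proof (rule borel_measurableI)
  fix S :: "real set"
  have "{\<omega> \<in> space M. bad_fraction L a \<epsilon> (tree \<omega>) \<in> S} \<in> sets M"
    by (rule sets_tree_Collect[where q = "0 \<in> S"]) (simp add: bad_fraction_infinite)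
  then show "(\<lambda>\<omega>. bad_fraction L a \<epsilon> (tree \<omega>)) -` S \<inter> space M \<in> sets M"
    by (simp add: vimage_def Int_def conj_commute)
qed

text \<open>In the second term the \<open>n^2\<close> from the initial squared ball count cancels
  the \<open>1 / n^2\<close> from the denominator, leaving the decay \<open>s ^ k\<close>.\<close>

lemma nn_integral_bad_fraction_le:
  fixes L a \<epsilon> :: real
  assumes C: "\<And>m x. m \<ge> 1 \<Longrightarrow> x \<in> set_pmf (N m) \<Longrightarrow> x None \<le> C" and L: "L > 0" and \<epsilon>: "\<epsilon> > 0"
    and s: "s > 0" "lyapunov s (\<lambda>m. (real m)\<^sup>2)"
    and D1: "(\<integral>\<^sup>+\<omega>. count_depth (\<lambda>k. (a + \<epsilon>) * L \<le> real k) (tree \<omega>) \<partial>M) \<le> ennreal d1" "d1 \<ge> 0"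
    and D2: "(\<integral>\<^sup>+\<omega>. count_depth (\<lambda>k. real k \<le> (a - \<epsilon>) * L) (tree \<omega>) \<partial>M) \<le> ennreal d2" "d2 \<ge> 0"
  shows "(\<integral>\<^sup>+\<omega>. ennreal (bad_fraction L (2 * a) (4 * \<epsilon>) (tree \<omega>)) \<partial>M)
    \<le> ennreal (2 * real C / real n * (d1 + d2)
        + (real C * real (nat \<lceil>(a + \<epsilon>) * L\<rceil>))\<^sup>2 * s ^ nat \<lfloor>\<epsilon> * L\<rfloor>)"
proof -
  define c where "c = 2 * real C / real n"
  define e where "e = (real C * real (nat \<lceil>(a + \<epsilon>) * L\<rceil>) / real n)\<^sup>2"
  define k where "k = nat \<lfloor>\<epsilon> * L\<rfloor>"
  have ce: "c \<ge> 0" "e \<ge> 0" by (simp_all add: c_def e_def)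
  let ?c1 = "\<lambda>\<omega>. count_depth (\<lambda>k. (a + \<epsilon>) * L \<le> real k) (tree \<omega>)"
  let ?c2 = "\<lambda>\<omega>. count_depth (\<lambda>k. real k \<le> (a - \<epsilon>) * L) (tree \<omega>)"
  let ?S = "\<lambda>\<omega>. \<Sum>w | length w = k. ennreal ((real (balls w \<omega>))\<^sup>2)"
  have [measurable]: "?S \<in> borel_measurable M"
    by (intro borel_measurable_sum measurable_compose[OF measurable_balls]) simp
  have "AE \<omega> in M. ennreal (bad_fraction L (2 * a) (4 * \<epsilon>) (tree \<omega>))
      \<le> ennreal c * (?c1 \<omega> + ?c2 \<omega>) + ennreal e * ?S \<omega>"
    using AE_finite_tree AE_ball_conserving AE_X_in_set_pmf
  proof eventually_elim
    case (elim \<omega>)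
    let ?D = "real (card {v \<in> tree \<omega>. (a + \<epsilon>) * L \<le> real (length v) \<or> real (length v) \<le> (a - \<epsilon>) * L})"
    have "bad_fraction L (2 * a) (4 * \<epsilon>) (tree \<omega>) \<le> c * ?D + e * (\<Sum>w | length w = k. (real (balls w \<omega>))\<^sup>2)"
      unfolding c_def e_def k_def using elim C n_pos L \<epsilon> by (intro bad_fraction_le) auto
    then have "ennreal (bad_fraction L (2 * a) (4 * \<epsilon>) (tree \<omega>))
        \<le> ennreal (c * ?D + e * (\<Sum>w | length w = k. (real (balls w \<omega>))\<^sup>2))" by (rule ennreal_leI)
    also have "\<dots> = ennreal c * ennreal ?D + ennreal e * ?S \<omega>"
      using ce by (simp add: ennreal_plus ennreal_mult sum_nonneg sum_ennreal)
    also have "\<dots> \<le> ennreal c * (?c1 \<omega> + ?c2 \<omega>) + ennreal e * ?S \<omega>"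
      by (intro add_right_mono mult_left_mono order_trans[OF card_depth_le[OF elim(1)] count_depth_disj_le]) simp
    finally show ?case .
  qed
  then have "(\<integral>\<^sup>+\<omega>. ennreal (bad_fraction L (2 * a) (4 * \<epsilon>) (tree \<omega>)) \<partial>M)
      \<le> (\<integral>\<^sup>+\<omega>. ennreal c * (?c1 \<omega> + ?c2 \<omega>) + ennreal e * ?S \<omega> \<partial>M)" by (rule nn_integral_mono_AE)
  also have "\<dots> = ennreal c * ((\<integral>\<^sup>+\<omega>. ?c1 \<omega> \<partial>M) + (\<integral>\<^sup>+\<omega>. ?c2 \<omega> \<partial>M)) + ennreal e * (\<integral>\<^sup>+\<omega>. ?S \<omega> \<partial>M)"
    by (subst nn_integral_add) (auto simp: nn_integral_add nn_integral_cmult simp del: sum_ennreal)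
  also have "\<dots> \<le> ennreal c * (ennreal d1 + ennreal d2) + ennreal e * (ennreal s ^ k * ennreal ((real n)\<^sup>2))"
    using s by (intro add_mono mult_left_mono D1 D2 nn_integral_generation_le) (auto simp: lyapunov_def)
  also have "\<dots> = ennreal (c * (d1 + d2) + e * (s ^ k * (real n)\<^sup>2))"
    using ce s D1 D2 by (simp add: ennreal_plus ennreal_mult ennreal_power)
  also have "e * (s ^ k * (real n)\<^sup>2) = (real C * real (nat \<lceil>(a + \<epsilon>) * L\<rceil>))\<^sup>2 * s ^ k"
    using n_pos by (simp add: e_def power_divide)
  finally show ?thesis by (simp add: c_def k_def)
qed

end

lemma (in split_law) random_split_I:
  "split_environment M N X \<Longrightarrow> n \<ge> 1 \<Longrightarrow> random_split N V M X n"
  unfolding random_split_def random_split_axioms_def using split_law_axioms by simp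

lemma (in split_law) expected_bad_fraction_tendsto:
  assumes \<epsilon>: "\<epsilon> > 0"
  shows "\<exists>g. g \<longlonglongrightarrow> 0 \<and> (\<forall>n\<ge>2. \<forall>(M :: 'a measure) X. split_environment M N X \<longrightarrow>
    (\<integral>\<^sup>+\<omega>. ennreal (bad_fraction (ln (real n)) (2 / split_entropy V) \<epsilon> (split_tree n (\<lambda>u m. X u m \<omega>))) \<partial>M)
      \<le> ennreal (g n))"
proof -
  \<comment> \<open>Matches the tolerance four times \<delta> in the bound for the bad
    fraction.\<close>
  define \<delta> where "\<delta> = \<epsilon> / 4"
  define a where "a = 1 / split_entropy V"
  have \<delta>: "\<delta> > 0" using \<epsilon> by (simp add: \<delta>_def)
  have a: "a > 0" using entropy_pos by (simp add: a_def)
  obtain C where C: "\<And>m x. m \<ge> 1 \<Longrightarrow> x \<in> set_pmf (N m) \<Longrightarrow> x None \<le> C"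
    using ST1 unfolding ST1_def by blast
  obtain s where s: "0 < s" "s < 1" "lyapunov s (\<lambda>m. (real m)\<^sup>2)" using lyapunov_squares by blast
  from count_depth_upper[OF \<delta>, where 'a = 'a] obtain c1 K1 where c1: "c1 > 0" "K1 > 0"
    and D1: "\<And>n (M :: 'a measure) X. n \<ge> 1 \<Longrightarrow> split_environment M N X \<Longrightarrow>
      (\<integral>\<^sup>+\<omega>. count_depth (\<lambda>k. (a + \<delta>) * ln (real n) \<le> real k) (split_tree n (\<lambda>u m. X u m \<omega>)) \<partial>M)
        \<le> ennreal (K1 * (real n * exp (- c1 * ln (real n))))"
    unfolding a_def by blast
  from count_depth_lower[OF \<delta>, where 'a = 'a] obtain c2 K2 where c2: "c2 > 0" "K2 > 0"
    and D2: "\<And>n (M :: 'a measure) X. n \<ge> 1 \<Longrightarrow> split_environment M N X \<Longrightarrow>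
      (\<integral>\<^sup>+\<omega>. count_depth (\<lambda>k. real k \<le> (a - \<delta>) * ln (real n)) (split_tree n (\<lambda>u m. X u m \<omega>)) \<partial>M)
        \<le> ennreal (K2 * (ln (real n) + 1) * (real n * exp (- c2 * ln (real n))))"
    unfolding a_def by blast
  define c3 where "c3 = - ln s"
  have c3: "c3 > 0" using s by (simp add: c3_def)
  \<comment> \<open>The bound as a function of \<open>L = ln n\<close>, after the factor
    \<open>n\<close> has cancelled. The summands 1 and -1 absorb the ceiling and the floor.\<close>
  define h where "h L = 2 * real C * (K1 * exp (- c1 * L) + K2 * (L + 1) * exp (- c2 * L))
    + (real C * ((a + \<delta>) * L + 1))\<^sup>2 * exp (- c3 * (\<delta> * L - 1))" for L :: real
  define A where "A = a + \<delta>"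
  have A: "A > 0" using a \<delta> by (simp add: A_def)
  have exp0: "((\<lambda>L. L ^ k * exp (- (c * L))) \<longlongrightarrow> 0) at_top" if "c > 0" for c :: real and k :: nat
    using that by real_asymp
  \<comment> \<open>The function \<open>h\<close> expanded into terms
    \<open>L ^ k * exp (- (c * L))\<close>, each of which tends to 0 by \<open>exp0\<close>.\<close>
  have "((\<lambda>L. 2 * real C * (K1 * (L ^ 0 * exp (- (c1 * L)))
        + K2 * (L ^ 1 * exp (- (c2 * L)) + L ^ 0 * exp (- (c2 * L))))
      + (real C)\<^sup>2 * exp c3 * (A\<^sup>2 * (L ^ 2 * exp (- (c3 * \<delta> * L)))
        + 2 * A * (L ^ 1 * exp (- (c3 * \<delta> * L))) + L ^ 0 * exp (- (c3 * \<delta> * L)))) \<longlongrightarrow>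
      2 * real C * (K1 * 0 + K2 * (0 + 0)) + (real C)\<^sup>2 * exp c3 * (A\<^sup>2 * 0 + 2 * A * 0 + 0)) at_top"
    by (intro tendsto_intros exp0) (use c1 c2 c3 \<delta> in auto)
  moreover have "2 * real C * (K1 * (L ^ 0 * exp (- (c1 * L)))
        + K2 * (L ^ 1 * exp (- (c2 * L)) + L ^ 0 * exp (- (c2 * L))))
      + (real C)\<^sup>2 * exp c3 * (A\<^sup>2 * (L ^ 2 * exp (- (c3 * \<delta> * L)))
        + 2 * A * (L ^ 1 * exp (- (c3 * \<delta> * L))) + L ^ 0 * exp (- (c3 * \<delta> * L))) = h L" for L
  proof -
    have "exp (- c3 * (\<delta> * L - 1)) = exp c3 * exp (- (c3 * \<delta> * L))"
      by (simp add: exp_add[symmetric] algebra_simps)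
    then show ?thesis unfolding h_def A_def[symmetric]
      by (simp only: power_mult_distrib) (simp add: power2_eq_square algebra_simps)
  qed
  ultimately have "(h \<longlongrightarrow> 0) at_top" by simp
  moreover have "filterlim (\<lambda>n. ln (real n)) at_top sequentially" by real_asymp
  ultimately have "(\<lambda>n. h (ln (real n))) \<longlonglongrightarrow> 0" by (rule filterlim_compose)
  moreover have "(\<integral>\<^sup>+\<omega>. ennreal (bad_fraction (ln (real n)) (2 / split_entropy V) \<epsilon> (split_tree n (\<lambda>u m. X u m \<omega>))) \<partial>M)
      \<le> ennreal (h (ln (real n)))"
    if n: "n \<ge> 2" and env: "split_environment M N X" for n and M :: "'a measure" and X
  proof -
    interpret random_split N V M X n using env n by (intro random_split_I) auto
    define L where "L = ln (real n)"
    have L: "L > 0" using n by (simp add: L_def)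
    have n1: "n \<ge> 1" using n by simp
    define d1 where "d1 = K1 * (real n * exp (- c1 * L))"
    define d2 where "d2 = K2 * (L + 1) * (real n * exp (- c2 * L))"
    have "(\<integral>\<^sup>+\<omega>. ennreal (bad_fraction L (2 * a) (4 * \<delta>) (tree \<omega>)) \<partial>M)
        \<le> ennreal (2 * real C / real n * (d1 + d2)
          + (real C * real (nat \<lceil>(a + \<delta>) * L\<rceil>))\<^sup>2 * s ^ nat \<lfloor>\<delta> * L\<rfloor>)"
    proof (rule nn_integral_bad_fraction_le[of C L \<delta> s a d1 d2])
      show "(\<integral>\<^sup>+\<omega>. count_depth (\<lambda>k. (a + \<delta>) * L \<le> real k) (tree \<omega>) \<partial>M) \<le> ennreal d1"
        unfolding d1_def L_def by (rule D1[OF n1 env])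
      show "(\<integral>\<^sup>+\<omega>. count_depth (\<lambda>k. real k \<le> (a - \<delta>) * L) (tree \<omega>) \<partial>M) \<le> ennreal d2"
        unfolding d2_def L_def by (rule D2[OF n1 env])
    qed (use C L \<delta> s c1 c2 in \<open>auto simp: d1_def d2_def\<close>)
    also have "\<dots> \<le> ennreal (h L)"
    proof (rule ennreal_leI)
      have "2 * real C / real n * (d1 + d2) = 2 * real C * (K1 * exp (- c1 * L) + K2 * (L + 1) * exp (- c2 * L))"
        using n1 by (simp add: d1_def d2_def field_simps)
      moreover have "(real C * real (nat \<lceil>(a + \<delta>) * L\<rceil>))\<^sup>2 * s ^ nat \<lfloor>\<delta> * L\<rfloor>
          \<le> (real C * ((a + \<delta>) * L + 1))\<^sup>2 * exp (- c3 * (\<delta> * L - 1))"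
      proof (intro mult_mono power_mono mult_left_mono)
        have "0 \<le> (a + \<delta>) * L" using a \<delta> L by simp
        then show "real (nat \<lceil>(a + \<delta>) * L\<rceil>) \<le> (a + \<delta>) * L + 1" by linarith
        have "0 \<le> \<delta> * L" using \<delta> L by simp
        then have k: "\<delta> * L - 1 \<le> real (nat \<lfloor>\<delta> * L\<rfloor>)" by linarith
        have "s ^ nat \<lfloor>\<delta> * L\<rfloor> = exp (- c3 * real (nat \<lfloor>\<delta> * L\<rfloor>))"
          using s by (simp add: c3_def powr_realpow[symmetric] powr_def mult.commute)
        also have "\<dots> \<le> exp (- c3 * (\<delta> * L - 1))" using k c3 by simp
        finally show "s ^ nat \<lfloor>\<delta> * L\<rfloor> \<le> exp (- c3 * (\<delta> * L - 1))" .
      qed (use s in auto)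
      ultimately show "2 * real C / real n * (d1 + d2)
          + (real C * real (nat \<lceil>(a + \<delta>) * L\<rceil>))\<^sup>2 * s ^ nat \<lfloor>\<delta> * L\<rfloor> \<le> h L"
        by (simp add: h_def)
    qed
    finally show ?thesis by (simp add: L_def a_def \<delta>_def)
  qed
  ultimately show ?thesis by (intro exI[of _ "\<lambda>n. h (ln (real n))"]) blast
qed

section \<open>Sampled vertices\<close>

text \<open>The hypothesis only fixes probabilities of pairs inside \<open>t\<close>. Subtracting
  the good pairs from \<open>A\<close>, instead of adding up the bad ones, also covers values
  outside \<open>t\<close>.\<close>

lemma (in prob_space) prob_bad_pair_le:
  fixes Z1 Z2 :: "'a \<Rightarrow> 'c::countable"
  assumes A: "A \<in> events"
    and [measurable]: "Z1 \<in> measurable M (count_space UNIV)" "Z2 \<in> measurable M (count_space UNIV)"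
    and t: "finite t" "t \<noteq> {}"
    and unif: "\<And>u v. u \<in> t \<Longrightarrow> v \<in> t \<Longrightarrow>
      prob {\<omega> \<in> A. Z1 \<omega> = u \<and> Z2 \<omega> = v} = prob A * (1 / real (card t)) * (1 / real (card t))"
  shows "prob {\<omega> \<in> A. R (Z1 \<omega>) (Z2 \<omega>)} \<le> prob A * (real (card {(u, v) \<in> t \<times> t. R u v}) / (real (card t))\<^sup>2)"
proof -
  define G where "G = {(u, v) \<in> t \<times> t. \<not> R u v}"
  define F where "F = (\<lambda>(u, v). {\<omega> \<in> A. Z1 \<omega> = u \<and> Z2 \<omega> = v})"
  note [measurable] = A
  have event: "{\<omega> \<in> A. P (Z1 \<omega>) (Z2 \<omega>)} \<in> events" for P
  proof -
    have "{\<omega> \<in> A. P (Z1 \<omega>) (Z2 \<omega>)} = {\<omega> \<in> space M. \<omega> \<in> A \<and> P (Z1 \<omega>) (Z2 \<omega>)}"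
      using sets.sets_into_space[OF A] by auto
    also have "\<dots> \<in> events" by measurable
    finally show ?thesis .
  qed
  have finG: "finite G" "finite {(u, v) \<in> t \<times> t. R u v}"
    unfolding G_def by (rule finite_subset[of _ "t \<times> t"]; use t in auto)+
  have F: "F p \<in> events" for p unfolding F_def by (cases p) (simp add: event)
  have "prob (\<Union>p\<in>G. F p) = (\<Sum>p\<in>G. prob (F p))"
    by (intro finite_measure_finite_Union finG) (auto simp: F disjoint_family_on_def, auto simp: F_def)
  also have "\<dots> = (\<Sum>p\<in>G. prob A / (real (card t))\<^sup>2)"
    by (intro sum.cong refl) (auto simp: G_def F_def unif power2_eq_square)
  finally have good: "prob (\<Union>p\<in>G. F p) = prob A * (real (card G) / (real (card t))\<^sup>2)" by simp
  have "card (t \<times> t) = card {(u, v) \<in> t \<times> t. R u v} + card G"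
    using finG by (subst card_Un_disjoint[symmetric]) (auto simp: G_def intro!: arg_cong[where f = card])
  then have "(real (card t))\<^sup>2 = real (card {(u, v) \<in> t \<times> t. R u v}) + real (card G)"
    by (simp add: card_cartesian_product power2_eq_square flip: of_nat_mult of_nat_add)
  moreover have "(real (card t))\<^sup>2 > 0" using t by (simp add: card_gt_0_iff)
  ultimately have card: "real (card {(u, v) \<in> t \<times> t. R u v}) / (real (card t))\<^sup>2
      = 1 - real (card G) / (real (card t))\<^sup>2"
    by (simp add: field_simps)
  have sub: "(\<Union>p\<in>G. F p) \<subseteq> A" by (auto simp: F_def)
  have "prob {\<omega> \<in> A. R (Z1 \<omega>) (Z2 \<omega>)} \<le> prob (A - (\<Union>p\<in>G. F p))"
    using F finG by (intro finite_measure_mono) (auto simp: F_def G_def)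
  also have "\<dots> = prob A - prob (\<Union>p\<in>G. F p)"
    using F finG sub by (intro finite_measure_Diff A) auto
  finally show ?thesis unfolding card good by (simp add: algebra_simps)
qed

lemma prob_sampled_bad_pair_le:
  fixes t :: "'c::countable set"
  assumes t: "finite t" "t \<noteq> {}" and ij: "i \<noteq> j"
  defines "P \<equiv> \<Pi>\<^sub>M i\<in>(UNIV :: nat set). measure_pmf (pmf_of_set t)"
  shows "measure P {\<xi> \<in> space P. R (\<xi> i) (\<xi> j)} \<le> real (card {(u, v) \<in> t \<times> t. R u v}) / (real (card t))\<^sup>2"
proof -
  interpret product_prob_space "\<lambda>_. measure_pmf (pmf_of_set t)" "UNIV :: nat set" ..
  interpret Q: prob_space P unfolding P_def by (rule prob_space_PiM) (rule prob_space_measure_pmf)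
  have coord: "(\<lambda>\<xi>. \<xi> k) \<in> measurable P (count_space UNIV)" for k
    unfolding P_def by (rule measurable_compose[OF measurable_component_singleton]) auto
  have "measure P {\<xi> \<in> space P. \<xi> i = u \<and> \<xi> j = v} = 1 * (1 / real (card t)) * (1 / real (card t))"
    if "u \<in> t" "v \<in> t" for u v
  proof -
    have "{\<xi> \<in> space P. \<xi> i = u \<and> \<xi> j = v} = {\<xi> \<in> space P. \<forall>l\<in>{i, j}. \<xi> l \<in> (if l = i then {u} else {v})}"
      using ij by auto
    then have "emeasure P {\<xi> \<in> space P. \<xi> i = u \<and> \<xi> j = v}
        = (\<Prod>l\<in>{i, j}. emeasure (measure_pmf (pmf_of_set t)) (if l = i then {u} else {v}))"
      unfolding P_def by (simp only:) (rule emeasure_PiM_Collect, auto)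
    also have "\<dots> = ennreal (1 / real (card t) * (1 / real (card t)))"
      using ij t that by (simp add: emeasure_pmf_single ennreal_mult[symmetric])
    finally show ?thesis by (simp add: measure_def)
  qed
  then have "measure P {\<xi> \<in> space P. R (\<xi> i) (\<xi> j)}
      \<le> Q.prob (space P) * (real (card {(u, v) \<in> t \<times> t. R u v}) / (real (card t))\<^sup>2)"
    using t by (intro Q.prob_bad_pair_le coord) (auto simp: Q.prob_space)
  then show ?thesis by (simp add: Q.prob_space)
qed

section \<open>Random distance matrices\<close>

lemma tendsto_matrixI:
  fixes x :: "nat \<Rightarrow> nat \<Rightarrow> nat \<Rightarrow> real"
  assumes "\<And>i j. (\<lambda>n. x n i j) \<longlonglongrightarrow> c i j"
  shows "x \<longlonglongrightarrow> c"
proof -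
  have pw: "f \<longlonglongrightarrow> l" if "\<And>i. (\<lambda>n. f n i) \<longlonglongrightarrow> l i"
    for f :: "nat \<Rightarrow> nat \<Rightarrow> 'z::topological_space" and l
    using that
    by (simp add: limitin_componentwise euclidean_product_topology[symmetric] flip: limitin_canonical_iff)
  show ?thesis by (intro pw assms)
qed

text \<open>A neighbourhood in the product topology restricts finitely many entries. Otherwise there
  would be matrices \<open>x r\<close> whose leading \<open>r\<close> by \<open>r\<close> block is
  within \<open>1 / (r + 1)\<close> of \<open>c\<close> although \<open>f (x r)\<close> stays away
  from \<open>f c\<close>; but they converge to \<open>c\<close> entrywise.\<close>

lemma continuous_matrix_neighbourhood:
  fixes f :: "(nat \<Rightarrow> nat \<Rightarrow> real) \<Rightarrow> real"
  assumes f: "continuous_on UNIV f" and \<eta>: "\<eta> > 0"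
  shows "\<exists>r \<delta>. \<delta> > 0 \<and> (\<forall>x. (\<forall>i<r. \<forall>j<r. \<bar>x i j - c i j\<bar> < \<delta>) \<longrightarrow> \<bar>f x - f c\<bar> < \<eta>)"
proof (rule ccontr)
  assume "\<not> ?thesis"
  then have "\<forall>r :: nat. \<exists>x. (\<forall>i<r. \<forall>j<r. \<bar>x i j - c i j\<bar> < 1 / real (Suc r)) \<and> \<not> \<bar>f x - f c\<bar> < \<eta>"
    by (metis of_nat_0_less_iff zero_less_Suc zero_less_divide_1_iff)
  then obtain x where x: "\<And>r i j. i < r \<Longrightarrow> j < r \<Longrightarrow> \<bar>x r i j - c i j\<bar> < 1 / real (Suc r)"
    "\<And>r. \<not> \<bar>f (x r) - f c\<bar> < \<eta>" by metis
  have "x \<longlonglongrightarrow> c"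
  proof (rule tendsto_matrixI)
    fix i j
    have "\<forall>\<^sub>F r in sequentially. norm (x r i j - c i j) \<le> 1 / real (Suc r)"
      using eventually_gt_at_top[of "max i j"]
      by eventually_elim (use x(1) in \<open>auto intro: less_imp_le\<close>)
    moreover have "(\<lambda>r. 1 / real (Suc r)) \<longlonglongrightarrow> 0" by real_asymp
    ultimately have "(\<lambda>r. x r i j - c i j) \<longlonglongrightarrow> 0" by (rule Lim_null_comparison)
    then show "(\<lambda>r. x r i j) \<longlonglongrightarrow> c i j" by (simp add: LIM_zero_iff)
  qed
  then have "(\<lambda>r. f (x r)) \<longlonglongrightarrow> f c"
    using f by (intro isCont_tendsto_compose[of c f]) (simp_all add: continuous_on_eq_continuous_at)
  then have "\<forall>\<^sub>F r in sequentially. dist (f (x r)) (f c) < \<eta>" using \<eta> by (rule tendstoD)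
  then show False using x(2) by (auto simp: dist_real_def eventually_sequentially)
qed

lemma measurable_sampled_matrix:
  fixes t :: "'b::finite list set"
  defines "P \<equiv> \<Pi>\<^sub>M i\<in>(UNIV :: nat set). measure_pmf (pmf_of_set t)"
  shows "(\<lambda>\<xi>. real (graph_dist t (\<xi> i) (\<xi> j))) \<in> borel_measurable P"
    and "(\<lambda>\<xi> i j. if i = j then 0 else c * real (graph_dist t (\<xi> i) (\<xi> j))) \<in> borel_measurable P"
proof -
  have coord: "(\<lambda>\<xi>. \<xi> k) \<in> measurable P (count_space UNIV)" for k
    unfolding P_def by (rule measurable_compose[OF measurable_component_singleton]) auto
  have dist [measurable]: "(\<lambda>\<xi>. real (graph_dist t (\<xi> i) (\<xi> j))) \<in> borel_measurable P" for i j
  proof (rule measurable_compose_countable[where f = "\<lambda>u \<xi>. real (graph_dist t u (\<xi> j))", OF _ coord])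
    show "(\<lambda>\<xi>. real (graph_dist t u (\<xi> j))) \<in> borel_measurable P" for u
      by (rule measurable_compose[OF coord]) simp
  qed
  then show "(\<lambda>\<xi>. real (graph_dist t (\<xi> i) (\<xi> j))) \<in> borel_measurable P" .
  show "(\<lambda>\<xi> i j. if i = j then 0 else c * real (graph_dist t (\<xi> i) (\<xi> j))) \<in> borel_measurable P"
    by (rule measurable_matrixI) simp
qed

text \<open>If all sampled distances among the first \<open>r\<close> vertices are typical,
  \<open>f\<close> is within \<eta> of its value at \<open>c\<close>; otherwise the difference is at
  most \<open>2 * B\<close>. The union bound over \<open>r^2\<close> pairs gives the last term. The
  diagonal entries agree exactly.\<close>

lemma integral_sampling_measure_close:
  fixes f :: "(nat \<Rightarrow> nat \<Rightarrow> real) \<Rightarrow> real" and t :: "'b::finite list set" and a L :: real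
  assumes t: "finite t" "t \<noteq> {}" and f: "continuous_on UNIV f" and B: "\<And>x. \<bar>f x\<bar> \<le> B" and "\<delta> > 0" "\<eta> \<ge> 0"
  defines "c \<equiv> \<lambda>i j. if i = j then 0 else a"
  assumes close: "\<And>x. (\<forall>i<r. \<forall>j<r. \<bar>x i j - c i j\<bar> < \<delta>) \<Longrightarrow> \<bar>f x - f c\<bar> \<le> \<eta>"
  shows "\<bar>(\<integral>x. f x \<partial>sampling_measure (1 / L) t) - f c\<bar> \<le> \<eta> + 2 * B * (real r)\<^sup>2 * bad_fraction L a \<delta> t"
proof -
  define P where "P = (\<Pi>\<^sub>M i\<in>(UNIV :: nat set). measure_pmf (pmf_of_set t))"
  define F where "F \<xi> i j = (if i = j then 0 else 1 / L * real (graph_dist t (\<xi> i) (\<xi> j)))"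
    for \<xi> :: "nat \<Rightarrow> 'b list" and i j :: nat
  define E where "E i j = {\<xi> \<in> space P. i \<noteq> j \<and> \<delta> \<le> \<bar>real (graph_dist t (\<xi> i) (\<xi> j)) / L - a\<bar>}" for i j
  interpret P: prob_space P unfolding P_def by (rule prob_space_PiM) (rule prob_space_measure_pmf)
  have B0: "B \<ge> 0" using B[of undefined] by linarith
  note [measurable] = measurable_sampled_matrix(1)[of t, folded P_def]
  have F: "F \<in> borel_measurable P"
    unfolding F_def P_def by (rule measurable_sampled_matrix(2))
  have fm: "f \<in> borel_measurable borel" using f by (rule borel_measurable_continuous_onI)
  have [measurable]: "(\<lambda>\<xi>. f (F \<xi>)) \<in> borel_measurable P" by (rule measurable_compose[OF F fm])
  have E: "E i j \<in> P.events" for i j unfolding E_def by measurable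
  have int_ind: "integrable P (\<lambda>\<xi>. indicator (E i j) \<xi> :: real)" for i j
    using E[of i j] by (simp add: P.emeasure_eq_measure)
  then have integrable_E: "integrable P (\<lambda>\<xi>. \<eta> + 2 * B * (\<Sum>i<r. \<Sum>j<r. indicator (E i j) \<xi>))"
    by (intro Bochner_Integration.integrable_add integrable_mult_right Bochner_Integration.integrable_sum) auto
  have "P.prob (E i j) \<le> bad_fraction L a \<delta> t" for i j
  proof (cases "i = j")
    case False
    then show ?thesis
      using prob_sampled_bad_pair_le[OF t False, of "\<lambda>u v. \<delta> \<le> \<bar>real (graph_dist t u v) / L - a\<bar>"]
      by (simp add: E_def P_def bad_fraction_def)
  qed (simp add: E_def bad_fraction_nonneg)
  then have PE: "(\<Sum>i<r. \<Sum>j<r. P.prob (E i j)) \<le> (\<Sum>i<r. \<Sum>j<r. bad_fraction L a \<delta> t)"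
    by (intro sum_mono)
  have int: "integrable P (\<lambda>\<xi>. f (F \<xi>))" using B by (intro P.integrable_const_bound[of _ B]) auto
  have "(\<integral>x. f x \<partial>sampling_measure (1 / L) t) = (\<integral>\<xi>. f (F \<xi>) \<partial>P)"
    using t F fm unfolding sampling_measure_def F_def P_def by (simp add: integral_distr)
  then have "\<bar>(\<integral>x. f x \<partial>sampling_measure (1 / L) t) - f c\<bar> = \<bar>\<integral>\<xi>. f (F \<xi>) - f c \<partial>P\<bar>"
    using int by (simp add: P.prob_space)
  also have "\<dots> \<le> (\<integral>\<xi>. \<bar>f (F \<xi>) - f c\<bar> \<partial>P)" by (rule integral_abs_bound)
  also have "\<dots> \<le> (\<integral>\<xi>. \<eta> + 2 * B * (\<Sum>i<r. \<Sum>j<r. indicator (E i j) \<xi>) \<partial>P)"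
  proof (rule integral_mono)
    fix \<xi> assume \<xi>: "\<xi> \<in> space P"
    have S: "0 \<le> (\<Sum>i<r. \<Sum>j<r. indicator (E i j) \<xi> :: real)" by (intro sum_nonneg) auto
    show "\<bar>f (F \<xi>) - f c\<bar> \<le> \<eta> + 2 * B * (\<Sum>i<r. \<Sum>j<r. indicator (E i j) \<xi>)"
    proof (cases "\<exists>i<r. \<exists>j<r. \<xi> \<in> E i j")
      case True
      then obtain i j where ij: "i < r" "j < r" "\<xi> \<in> E i j" by blast
      have "1 \<le> (\<Sum>j<r. indicator (E i j) \<xi> :: real)"
        using member_le_sum[of j "{..<r}" "\<lambda>j. indicator (E i j) \<xi> :: real"] ij by auto
      also have "\<dots> \<le> (\<Sum>i<r. \<Sum>j<r. indicator (E i j) \<xi>)"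
        using member_le_sum[of i "{..<r}" "\<lambda>i. \<Sum>j<r. indicator (E i j) \<xi> :: real"] ij by (auto intro: sum_nonneg)
      finally have "2 * B * 1 \<le> 2 * B * (\<Sum>i<r. \<Sum>j<r. indicator (E i j) \<xi>)" using B0 by (intro mult_left_mono) auto
      moreover have "\<bar>f (F \<xi>) - f c\<bar> \<le> 2 * B" using B[of "F \<xi>"] B[of c] by linarith
      ultimately show ?thesis using \<open>\<eta> \<ge> 0\<close> by linarith
    next
      case False
      then have "\<bar>F \<xi> i j - c i j\<bar> < \<delta>" if "i < r" "j < r" for i j
        using that \<xi> \<open>\<delta> > 0\<close> by (auto simp: E_def F_def c_def not_le)
      then have "\<bar>f (F \<xi>) - f c\<bar> \<le> \<eta>" by (intro close) auto
      moreover have "0 \<le> 2 * B * (\<Sum>i<r. \<Sum>j<r. indicator (E i j) \<xi>)" using B0 S by simp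
      ultimately show ?thesis by linarith
    qed
  next
    show "integrable P (\<lambda>\<xi>. \<bar>f (F \<xi>) - f c\<bar>)" using int by simp
    show "integrable P (\<lambda>\<xi>. \<eta> + 2 * B * (\<Sum>i<r. \<Sum>j<r. indicator (E i j) \<xi>))"
      by (rule integrable_E)
  qed
  also have "\<dots> = \<eta> + 2 * B * (\<Sum>i<r. \<Sum>j<r. P.prob (E i j))"
  proof -
    have "(\<integral>\<xi>. \<eta> + 2 * B * (\<Sum>i<r. \<Sum>j<r. indicator (E i j) \<xi>) \<partial>P)
        = \<eta> + 2 * B * (\<Sum>i<r. \<Sum>j<r. \<integral>\<xi>. indicator (E i j) \<xi> \<partial>P)"
      using int_ind by (simp add: P.prob_space)
    then show ?thesis using E by simp
  qed
  also have "\<dots> \<le> \<eta> + 2 * B * (\<Sum>i<r. \<Sum>j<r. bad_fraction L a \<delta> t)"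
    using B0 PE by (intro add_left_mono mult_left_mono) auto
  finally show ?thesis by (simp add: power2_eq_square mult_ac)
qed

lemma sampling_measure_is_prob: "prob_space (sampling_measure c t)" "sets (sampling_measure c t) = sets borel"
  for t :: "'b::finite list set"
proof -
  let ?P = "\<Pi>\<^sub>M i\<in>(UNIV :: nat set). measure_pmf (pmf_of_set t)"
  interpret P: prob_space ?P by (rule prob_space_PiM) (rule prob_space_measure_pmf)
  have "(\<lambda>\<xi> i j. if i = j then 0 else c * real (graph_dist t (\<xi> i) (\<xi> j))) \<in> borel_measurable ?P"
    by (rule measurable_sampled_matrix)
  then show "prob_space (sampling_measure c t)" "sets (sampling_measure c t) = sets borel"
    by (auto simp: sampling_measure_def P.prob_space_distr prob_space_return)
qed


section \<open>Vertices sampled from the random tree\<close>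

lemma (in split_law) random_split_tree_imp_random_split:
  fixes M :: "'a measure"
  assumes "random_split_tree N n M T" "n \<ge> 1"
  shows "\<exists>X. random_split N V M X n \<and> (\<forall>\<omega>\<in>space M. T \<omega> = split_tree n (\<lambda>v m. X v m \<omega>))"
proof -
  from assms(1) obtain X where X: "prob_space M"
    "prob_space.indep_vars M (\<lambda>_. count_space UNIV) (\<lambda>(v, m). X v m) (UNIV \<times> {1..})"
    "\<forall>v. \<forall>m\<ge>1. distr M (count_space UNIV) (X v m) = measure_pmf (N m)"
    "\<forall>\<omega>\<in>space M. T \<omega> = split_tree n (\<lambda>v m. X v m \<omega>)"
    unfolding random_split_tree_def by blast
  have "split_environment M N X"
    using X(1-3) by (simp add: split_environment_def split_environment_axioms_def)
  with random_split_I[OF this assms(2)] X(4) show ?thesis by blast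
qed

context random_split
begin

text \<open>For fixed \<open>u\<close> and \<open>v\<close> the distance takes only two values, that
  of the infinite tree or the default, according to whether both vertices belong to the tree. The
  random vertices range over a countable set.\<close>

lemma measurable_graph_dist:
  assumes [measurable]: "\<xi>\<^sub>1 \<in> measurable M (count_space UNIV)" "\<xi>\<^sub>2 \<in> measurable M (count_space UNIV)"
  shows "(\<lambda>\<omega>. real (graph_dist (tree \<omega>) (\<xi>\<^sub>1 \<omega>) (\<xi>\<^sub>2 \<omega>))) \<in> borel_measurable M"
proof -
  have in_tree: "{\<omega> \<in> space M. u \<in> tree \<omega>} \<in> sets M" for u
  proof -
    have "{\<omega> \<in> space M. u \<in> tree \<omega>} = {\<omega> \<in> space M. balls u \<omega> \<ge> 1}" by (simp add: split_tree_def)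
    also have "\<dots> \<in> sets M" by measurable
    finally show ?thesis .
  qed
  have eq: "real (graph_dist (tree \<omega>) u v)
      = (if u \<in> tree \<omega> \<and> v \<in> tree \<omega> then real (graph_dist UNIV u v) else real (graph_dist {} u v))" for u v \<omega>
  proof (cases "u \<in> tree \<omega> \<and> v \<in> tree \<omega>")
    case True
    have "suffix_closed (UNIV :: 'b list set)" by (simp add: suffix_closed_def)
    then have "graph_dist (tree \<omega>) u v = graph_dist UNIV u v"
      using True by (subst (1 2) graph_dist_common_suffix) auto
    with True show ?thesis by simp
  next
    case False
    with graph_dist_outside[of u "tree \<omega>" v] show ?thesis by presburger
  qed
  have both: "{\<omega> \<in> space M. u \<in> tree \<omega> \<and> v \<in> tree \<omega>} \<in> sets M" for u v
    using sets.Int[OF in_tree[of u] in_tree[of v]] by (simp add: Int_def conj_ac)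
  have fixed: "(\<lambda>\<omega>. real (graph_dist (tree \<omega>) u v)) \<in> borel_measurable M" for u v
    unfolding eq by (intro measurable_If both) simp_all
  show ?thesis
    by (rule measurable_compose_countable[OF measurable_compose_countable[OF fixed assms(2)] assms(1)])
qed

text \<open>Total probability over the countably many finite nonempty trees: on the event that the
  tree is \<open>t\<close>, the elementary conditioning in \<open>iid_uniform_vertices\<close>
  bounds the conditional probability by the bad fraction of \<open>t\<close>.\<close>

lemma emeasure_bad_pair_le:
  assumes "iid_uniform_vertices M tree \<xi>\<^sub>1 \<xi>\<^sub>2"
  shows "emeasure M {\<omega> \<in> space M. \<epsilon> \<le> \<bar>real (graph_dist (tree \<omega>) (\<xi>\<^sub>1 \<omega>) (\<xi>\<^sub>2 \<omega>)) / L - a\<bar>}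
    \<le> (\<integral>\<^sup>+\<omega>. ennreal (bad_fraction L a \<epsilon> (tree \<omega>)) \<partial>M)"
proof -
  from assms have \<xi> [measurable]: "\<xi>\<^sub>1 \<in> measurable M (count_space UNIV)" "\<xi>\<^sub>2 \<in> measurable M (count_space UNIV)"
    and unif: "\<And>t u v. finite t \<Longrightarrow> u \<in> t \<Longrightarrow> v \<in> t \<Longrightarrow> prob {\<omega> \<in> space M. tree \<omega> = t \<and> \<xi>\<^sub>1 \<omega> = u \<and> \<xi>\<^sub>2 \<omega> = v}
      = prob {\<omega> \<in> space M. tree \<omega> = t} * (1 / real (card t)) * (1 / real (card t))"
    unfolding iid_uniform_vertices_def by auto
  note [measurable] = measurable_graph_dist[OF \<xi>]
  define F where "F = {t :: 'b list set. finite t \<and> t \<noteq> {}}"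
  define A where "A t = {\<omega> \<in> space M. tree \<omega> = t}" for t
  define R where "R t u v \<longleftrightarrow> \<epsilon> \<le> \<bar>real (graph_dist t u v) / L - a\<bar>" for t :: "'b list set" and u v
  let ?B = "{\<omega> \<in> space M. R (tree \<omega>) (\<xi>\<^sub>1 \<omega>) (\<xi>\<^sub>2 \<omega>)}"
  have B: "?B \<in> sets M" unfolding R_def by measurable
  have A: "A t \<in> sets M" for t unfolding A_def by (rule sets_tree_eq)
  have countF: "countable F"
    unfolding F_def by (rule countable_subset[OF _ countable_Collect_finite]) auto
  have AE_F: "AE \<omega> in M. tree \<omega> \<in> F"
    using AE_finite_tree Nil_in_split_tree[OF n_pos] unfolding F_def by fastforce
  have AB: "{\<omega> \<in> A t. R t (\<xi>\<^sub>1 \<omega>) (\<xi>\<^sub>2 \<omega>)} = A t \<inter> ?B" for t by (auto simp: A_def)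
  have step: "emeasure M (A t \<inter> ?B) \<le> (\<integral>\<^sup>+\<omega>. ennreal (bad_fraction L a \<epsilon> t) * indicator (A t) \<omega> \<partial>M)"
    if t: "t \<in> F" for t
  proof -
    have "prob {\<omega> \<in> A t. R t (\<xi>\<^sub>1 \<omega>) (\<xi>\<^sub>2 \<omega>)} \<le> prob (A t) * (real (card {(u, v) \<in> t \<times> t. R t u v}) / (real (card t))\<^sup>2)"
    proof (rule prob_bad_pair_le[OF A \<xi>])
      show "prob {\<omega> \<in> A t. \<xi>\<^sub>1 \<omega> = u \<and> \<xi>\<^sub>2 \<omega> = v} = prob (A t) * (1 / real (card t)) * (1 / real (card t))"
        if "u \<in> t" "v \<in> t" for u v
        using unif[OF _ that] t by (simp add: A_def F_def conj_assoc)
    qed (use t in \<open>auto simp: F_def\<close>)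
    also have "\<dots> = prob (A t) * bad_fraction L a \<epsilon> t" by (simp add: bad_fraction_def R_def)
    finally have "prob (A t \<inter> ?B) \<le> prob (A t) * bad_fraction L a \<epsilon> t" by (simp only: AB)
    then have "ennreal (prob (A t \<inter> ?B)) \<le> ennreal (bad_fraction L a \<epsilon> t) * ennreal (prob (A t))"
      by (simp add: ennreal_mult[symmetric] bad_fraction_nonneg mult.commute ennreal_leI)
    then show ?thesis using A by (simp add: emeasure_eq_measure nn_integral_cmult)
  qed
  have "emeasure M ?B = emeasure M (\<Union>t\<in>F. A t \<inter> ?B)"
    using AE_F B A countF by (intro emeasure_eq_AE sets.countable_UN'') (auto simp: A_def elim: eventually_mono)
  also have "\<dots> = (\<integral>\<^sup>+t. emeasure M (A t \<inter> ?B) \<partial>count_space F)"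
    using A B countF by (intro emeasure_UN_countable) (auto simp: disjoint_family_on_def A_def)
  also have "\<dots> \<le> (\<integral>\<^sup>+t. \<integral>\<^sup>+\<omega>. ennreal (bad_fraction L a \<epsilon> t) * indicator (A t) \<omega> \<partial>M \<partial>count_space F)"
    using step by (intro nn_integral_mono) simp
  also have "\<dots> = (\<integral>\<^sup>+\<omega>. \<integral>\<^sup>+t. ennreal (bad_fraction L a \<epsilon> t) * indicator (A t) \<omega> \<partial>count_space F \<partial>M)"
    using A countF by (intro nn_integral_count_space_nn_integral[symmetric]) auto
  also have "\<dots> \<le> (\<integral>\<^sup>+\<omega>. ennreal (bad_fraction L a \<epsilon> (tree \<omega>)) \<partial>M)"
  proof (rule nn_integral_mono)
    fix \<omega>
    have "(\<integral>\<^sup>+t. ennreal (bad_fraction L a \<epsilon> t) * indicator (A t) \<omega> \<partial>count_space F)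
        \<le> (\<integral>\<^sup>+t. ennreal (bad_fraction L a \<epsilon> (tree \<omega>)) * indicator {tree \<omega>} t \<partial>count_space F)"
      by (intro nn_integral_mono) (auto simp: A_def indicator_def)
    also have "\<dots> \<le> ennreal (bad_fraction L a \<epsilon> (tree \<omega>))"
    proof (cases "tree \<omega> \<in> F")
      case True
      then show ?thesis by (simp add: nn_integral_cmult)
    next
      case False
      then have "(\<integral>\<^sup>+t. indicator {tree \<omega>} t \<partial>count_space F) = (\<integral>\<^sup>+t. 0 \<partial>count_space F)"
        by (intro nn_integral_cong) (auto simp: indicator_def)
      then show ?thesis by (simp add: nn_integral_cmult)
    qed
    finally show "(\<integral>\<^sup>+t. ennreal (bad_fraction L a \<epsilon> t) * indicator (A t) \<omega> \<partial>count_space F)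
        \<le> ennreal (bad_fraction L a \<epsilon> (tree \<omega>))" .
  qed
  finally show ?thesis by (simp add: R_def)
qed

end

lemma (in split_law) random_split_tree_facts:
  fixes M :: "'a measure"
  assumes "random_split_tree N n M T" "n \<ge> 1"
  shows "prob_space M"
    and "(\<And>t. infinite t \<Longrightarrow> Q t = q) \<Longrightarrow> {\<omega> \<in> space M. Q (T \<omega>)} \<in> sets M"
    and "AE \<omega> in M. finite (T \<omega>) \<and> T \<omega> \<noteq> {}"
proof -
  from random_split_tree_imp_random_split[OF assms] obtain X where "random_split N V M X n"
    and T: "\<forall>\<omega>\<in>space M. T \<omega> = split_tree n (\<lambda>v m. X v m \<omega>)" by blast
  interpret random_split N V M X n by fact
  show "prob_space M" by (rule prob_space_axioms)
  show "AE \<omega> in M. finite (T \<omega>) \<and> T \<omega> \<noteq> {}"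
    using AE_finite_tree AE_space
  proof eventually_elim
    case (elim \<omega>)
    then show ?case using T Nil_in_split_tree[OF n_pos] by fastforce
  qed
  assume "\<And>t. infinite t \<Longrightarrow> Q t = q"
  then have "{\<omega> \<in> space M. Q (tree \<omega>)} \<in> sets M" by (rule sets_tree_Collect)
  also have "{\<omega> \<in> space M. Q (tree \<omega>)} = {\<omega> \<in> space M. Q (T \<omega>)}" using T by auto
  finally show "{\<omega> \<in> space M. Q (T \<omega>)} \<in> sets M" .
qed

section \<open>Convergence along the sequence of trees\<close>

locale split_tree_sequence = split_law N V
  for N :: "nat \<Rightarrow> ('b::finite option \<Rightarrow> nat) pmf" and V +
  fixes M :: "nat \<Rightarrow> 'a measure" and T :: "nat \<Rightarrow> 'a \<Rightarrow> 'b list set"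
  assumes T: "n \<ge> 1 \<Longrightarrow> random_split_tree N n (M n) (T n)"
begin

lemma expected_bad_fraction:
  assumes "\<epsilon> > 0"
  obtains g where "g \<longlonglongrightarrow> 0" "\<And>n. n \<ge> 2 \<Longrightarrow>
    (\<integral>\<^sup>+\<omega>. ennreal (bad_fraction (ln (real n)) (2 / split_entropy V) \<epsilon> (T n \<omega>)) \<partial>M n) \<le> ennreal (g n)"
proof -
  from expected_bad_fraction_tendsto[OF assms, where 'a = 'a] obtain g where g: "g \<longlonglongrightarrow> 0"
    "\<And>n (M :: 'a measure) X. n \<ge> 2 \<Longrightarrow> split_environment M N X \<Longrightarrow>
      (\<integral>\<^sup>+\<omega>. ennreal (bad_fraction (ln (real n)) (2 / split_entropy V) \<epsilon> (split_tree n (\<lambda>u m. X u m \<omega>))) \<partial>M)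
        \<le> ennreal (g n)"
    by blast
  show thesis
  proof (rule that[OF g(1)])
    fix n :: nat assume n: "n \<ge> 2"
    then have n1: "n \<ge> 1" by simp
    from random_split_tree_imp_random_split[OF T[OF n1] n1] obtain X where "random_split N V (M n) X n"
      and eq: "\<forall>\<omega>\<in>space (M n). T n \<omega> = split_tree n (\<lambda>v m. X v m \<omega>)" by blast
    then have "split_environment (M n) N X" by (simp add: random_split_def)
    from g(2)[OF n this]
    show "(\<integral>\<^sup>+\<omega>. ennreal (bad_fraction (ln (real n)) (2 / split_entropy V) \<epsilon> (T n \<omega>)) \<partial>M n) \<le> ennreal (g n)"
      by (simp add: eq cong: nn_integral_cong)
  qed
qed

lemma distance_tends_in_prob:
  assumes \<xi>: "\<And>n. n \<ge> 1 \<Longrightarrow> iid_uniform_vertices (M n) (T n) (\<xi>\<^sub>1 n) (\<xi>\<^sub>2 n)"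
  shows "tends_in_prob euclidean M
    (\<lambda>n \<omega>. real (graph_dist (T n \<omega>) (\<xi>\<^sub>1 n \<omega>) (\<xi>\<^sub>2 n \<omega>)) / ln (real n)) (2 / split_entropy V)"
proof (subst tends_in_prob_metric, goal_cases)
  case (1 n)
  then show ?case using random_split_tree_facts(1)[OF T] by blast
next
  case 2
  show ?case
  proof (intro conjI allI impI)
    fix n :: nat assume n: "1 \<le> n"
    from random_split_tree_imp_random_split[OF T[OF n] n] obtain X where "random_split N V (M n) X n"
      and eq: "\<forall>\<omega>\<in>space (M n). T n \<omega> = split_tree n (\<lambda>v m. X v m \<omega>)" by blast
    then interpret random_split N V "M n" X n by simp
    have "\<xi>\<^sub>1 n \<in> measurable (M n) (count_space UNIV)" "\<xi>\<^sub>2 n \<in> measurable (M n) (count_space UNIV)"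
      using \<xi>[OF n] by (auto simp: iid_uniform_vertices_def)
    note [measurable] = measurable_graph_dist[OF this]
    have "(\<lambda>\<omega>. real (graph_dist (tree \<omega>) (\<xi>\<^sub>1 n \<omega>) (\<xi>\<^sub>2 n \<omega>)) / ln (real n)) \<in> borel_measurable (M n)"
      by measurable
    then show "(\<lambda>\<omega>. real (graph_dist (T n \<omega>) (\<xi>\<^sub>1 n \<omega>) (\<xi>\<^sub>2 n \<omega>)) / ln (real n)) \<in> borel_measurable (M n)"
      by (simp add: eq cong: measurable_cong)
  next
    fix \<epsilon> :: real assume "\<epsilon> > 0"
    then obtain g where g: "g \<longlonglongrightarrow> 0" "\<And>n. n \<ge> 2 \<Longrightarrow>
      (\<integral>\<^sup>+\<omega>. ennreal (bad_fraction (ln (real n)) (2 / split_entropy V) \<epsilon> (T n \<omega>)) \<partial>M n) \<le> ennreal (g n)"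
      by (rule expected_bad_fraction) blast
    let ?D = "\<lambda>n. {\<omega> \<in> space (M n). dist (real (graph_dist (T n \<omega>) (\<xi>\<^sub>1 n \<omega>) (\<xi>\<^sub>2 n \<omega>)) / ln (real n)) (2 / split_entropy V) \<ge> \<epsilon>}"
    have "\<forall>\<^sub>F n in sequentially. norm (measure (M n) (?D n)) \<le> \<bar>g n\<bar>"
      \<comment> \<open>The bound starts at 2, as \<open>ln 1 = 0\<close>.\<close>
      using eventually_ge_at_top[of 2]
    proof eventually_elim
      case (elim n)
      then have n: "n \<ge> 1" by simp
      from random_split_tree_imp_random_split[OF T[OF n] n] obtain X where "random_split N V (M n) X n"
        and eq: "\<forall>\<omega>\<in>space (M n). T n \<omega> = split_tree n (\<lambda>v m. X v m \<omega>)" by blast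
      then interpret random_split N V "M n" X n by simp
      have "iid_uniform_vertices (M n) tree (\<xi>\<^sub>1 n) (\<xi>\<^sub>2 n)"
        using \<xi>[OF n] unfolding iid_uniform_vertices_def by (simp add: eq cong: conj_cong)
      from emeasure_bad_pair_le[OF this, of \<epsilon> "ln (real n)" "2 / split_entropy V"]
      have "emeasure (M n) (?D n) \<le> (\<integral>\<^sup>+\<omega>. ennreal (bad_fraction (ln (real n)) (2 / split_entropy V) \<epsilon> (T n \<omega>)) \<partial>M n)"
        by (simp add: eq dist_real_def cong: conj_cong nn_integral_cong)
      also have "\<dots> \<le> ennreal (g n)" by (rule g(2)[OF elim])
      also have "\<dots> \<le> ennreal \<bar>g n\<bar>" by (intro ennreal_leI) simp
      finally show ?case by (simp add: emeasure_eq_measure)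
    qed
    moreover have "(\<lambda>n. \<bar>g n\<bar>) \<longlonglongrightarrow> 0" using g(1) by (rule tendsto_rabs_zero)
    ultimately show "(\<lambda>n. measure (M n) (?D n)) \<longlonglongrightarrow> 0" by (rule Lim_null_comparison)
  qed
qed

text \<open>Markov's inequality for the expected bad fraction.\<close>

lemma prob_bad_fraction_tendsto:
  assumes "\<epsilon> > 0" and x: "x > 0"
  shows "(\<lambda>n. measure (M n) {\<omega> \<in> space (M n). x \<le> bad_fraction (ln (real n)) (2 / split_entropy V) \<epsilon> (T n \<omega>)}) \<longlonglongrightarrow> 0"
proof -
  obtain g where g: "g \<longlonglongrightarrow> 0" "\<And>n. n \<ge> 2 \<Longrightarrow>
    (\<integral>\<^sup>+\<omega>. ennreal (bad_fraction (ln (real n)) (2 / split_entropy V) \<epsilon> (T n \<omega>)) \<partial>M n) \<le> ennreal (g n)"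
    using assms(1) by (rule expected_bad_fraction) blast
  let ?b = "\<lambda>n \<omega>. bad_fraction (ln (real n)) (2 / split_entropy V) \<epsilon> (T n \<omega>)"
  let ?D = "\<lambda>n. {\<omega> \<in> space (M n). x \<le> ?b n \<omega>}"
  have "\<forall>\<^sub>F n in sequentially. norm (measure (M n) (?D n)) \<le> \<bar>g n\<bar> / x"
    using eventually_ge_at_top[of 2]
  proof eventually_elim
    case (elim n)
    then have n: "n \<ge> 1" by simp
    interpret prob_space "M n" by (rule random_split_tree_facts(1)[OF T[OF n] n])
    have D: "?D n \<in> sets (M n)"
      by (rule random_split_tree_facts(2)[OF T[OF n] n]) (simp add: bad_fraction_infinite)
    have "ennreal (x * measure (M n) (?D n)) = (\<integral>\<^sup>+\<omega>. ennreal x * indicator (?D n) \<omega> \<partial>M n)"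
      using D x by (simp add: nn_integral_cmult emeasure_eq_measure ennreal_mult)
    also have "\<dots> \<le> (\<integral>\<^sup>+\<omega>. ennreal (?b n \<omega>) \<partial>M n)"
      by (intro nn_integral_mono) (auto simp: indicator_def ennreal_leI)
    also have "\<dots> \<le> ennreal (g n)" by (rule g(2)[OF elim])
    also have "\<dots> \<le> ennreal \<bar>g n\<bar>" by (intro ennreal_leI) simp
    finally have "x * measure (M n) (?D n) \<le> \<bar>g n\<bar>" by simp
    then show ?case using x by (simp add: field_simps)
  qed
  moreover have "(\<lambda>n. \<bar>g n\<bar> / x) \<longlonglongrightarrow> 0" using g(1) by (intro tendsto_divide_zero tendsto_rabs_zero)
  ultimately show ?thesis by (rule Lim_null_comparison)
qed

text \<open>Induction over the generation of open sets: the probability of missing a set is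
  subadditive under intersections and decreases under unions, so only the subbasic sets require the
  bad fraction. Every event in question is measurable, because all infinite trees share one default
  sampling measure.\<close>

lemma sampling_measure_tends_in_prob:
  "tends_in_prob weak_topology M (\<lambda>n \<omega>. sampling_measure (1 / ln (real n)) (T n \<omega>))
    (return borel (\<lambda>i j. if i = j then 0 else 2 / split_entropy V))"
    (is "tends_in_prob _ _ ?Y (return borel ?c)")
proof -
  have meas: "{\<omega> \<in> space (M n). ?Y n \<omega> \<in> W} \<in> sets (M n)" "{\<omega> \<in> space (M n). ?Y n \<omega> \<notin> W} \<in> sets (M n)"
    if n: "n \<ge> 1" for n W
    by (rule random_split_tree_facts(2)[OF T[OF n] n], simp add: sampling_measure_def)+
  let ?S = "{{\<mu>. prob_space \<mu> \<and> sets \<mu> = sets borel \<and> (\<integral>x. f x \<partial>\<mu>) \<in> U} | (f :: (nat \<Rightarrow> nat \<Rightarrow> real) \<Rightarrow> real) U.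
        continuous_on UNIV f \<and> bounded (range f) \<and> open U}"
  let ?p = "\<lambda>W n. measure (M n) {\<omega> \<in> space (M n). ?Y n \<omega> \<notin> W}"
  have "?p W \<longlonglongrightarrow> 0" if "generate_topology_on ?S W" "return borel ?c \<in> W" for W
    using that
  proof (induction rule: generate_topology_on.induct)
    case Empty
    then show ?case by simp
  next
    case (Int a b)
    have "\<forall>\<^sub>F n in sequentially. norm (?p (a \<inter> b) n) \<le> ?p a n + ?p b n"
      using eventually_ge_at_top[of 1]
    proof eventually_elim
      case (elim n)
      interpret prob_space "M n" by (rule random_split_tree_facts(1)[OF T[OF elim] elim])
      have "{\<omega> \<in> space (M n). ?Y n \<omega> \<notin> a \<inter> b} = {\<omega> \<in> space (M n). ?Y n \<omega> \<notin> a} \<union> {\<omega> \<in> space (M n). ?Y n \<omega> \<notin> b}"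
        by auto
      then show ?case using meas(2)[OF elim] by (simp add: measure_Un_le)
    qed
    moreover have "(\<lambda>n. ?p a n + ?p b n) \<longlonglongrightarrow> 0"
      using Int by (intro tendsto_add_zero) auto
    ultimately show ?case by (rule Lim_null_comparison)
  next
    case (UN K)
    then obtain k where k: "k \<in> K" "return borel ?c \<in> k" by blast
    have "\<forall>\<^sub>F n in sequentially. norm (?p (\<Union>K) n) \<le> ?p k n"
      using eventually_ge_at_top[of 1]
    proof eventually_elim
      case (elim n)
      interpret prob_space "M n" by (rule random_split_tree_facts(1)[OF T[OF elim] elim])
      show ?case using k meas(2)[OF elim] by (auto intro!: finite_measure_mono)
    qed
    moreover have "?p k \<longlonglongrightarrow> 0" using UN.IH k by blast
    ultimately show ?case by (rule Lim_null_comparison)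
  next
    case (Basis W)
    then obtain f :: "(nat \<Rightarrow> nat \<Rightarrow> real) \<Rightarrow> real" and U where
      W: "W = {\<mu>. prob_space \<mu> \<and> sets \<mu> = sets borel \<and> (\<integral>x. f x \<partial>\<mu>) \<in> U}"
      and f: "continuous_on UNIV f" "bounded (range f)" and U: "open U"
      by auto
    have "f \<in> borel_measurable borel" using f(1) by (rule borel_measurable_continuous_onI)
    then have "(\<integral>x. f x \<partial>return borel ?c) = f ?c" by (intro integral_return) auto
    then have "f ?c \<in> U" using Basis.prems by (simp add: W)
    then obtain \<eta> where \<eta>: "\<eta> > 0" "ball (f ?c) \<eta> \<subseteq> U" using U open_contains_ball by blast
    obtain B where B: "B > 0" "\<And>x. \<bar>f x\<bar> \<le> B"
      using f(2) unfolding bounded_pos by auto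
    obtain r \<delta> where \<delta>: "\<delta> > 0" "\<And>x. (\<forall>i<r. \<forall>j<r. \<bar>x i j - ?c i j\<bar> < \<delta>) \<Longrightarrow> \<bar>f x - f ?c\<bar> < \<eta> / 2"
      using continuous_matrix_neighbourhood[OF f(1), of "\<eta> / 2" ?c] \<eta>(1) by auto
    \<comment> \<open>Chosen so that a bad fraction below \<open>x\<close> contributes less than
      \<eta>/2 to the error; the other half comes from the neighbourhood of \<open>?c\<close>. The
      summand 1 avoids a zero denominator when \<open>r = 0\<close>.\<close>
    define x where "x = \<eta> / (4 * B * ((real r)\<^sup>2 + 1))"
    have r: "(real r)\<^sup>2 + 1 > 0" by (simp add: add_nonneg_pos)
    have x: "x > 0" using \<eta> B r by (simp add: x_def)
    have xb: "2 * B * (real r)\<^sup>2 * x < \<eta> / 2"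
    proof -
      have "2 * B * R * (\<eta> / (4 * B * R)) = \<eta> / 2" if "R > 0" for R using B that by simp
      from this[OF r] have "2 * B * ((real r)\<^sup>2 + 1) * x = \<eta> / 2" by (simp only: x_def)
      moreover have "2 * B * (real r)\<^sup>2 * x < 2 * B * ((real r)\<^sup>2 + 1) * x" using B x by simp
      ultimately show ?thesis by simp
    qed
    let ?b = "\<lambda>n \<omega>. bad_fraction (ln (real n)) (2 / split_entropy V) \<delta> (T n \<omega>)"
    have "\<forall>\<^sub>F n in sequentially. norm (?p W n) \<le> measure (M n) {\<omega> \<in> space (M n). x \<le> ?b n \<omega>}"
      using eventually_ge_at_top[of 1]
    proof eventually_elim
      case (elim n)
      note facts = random_split_tree_facts[OF T[OF elim] elim]
      interpret prob_space "M n" by (rule facts(1))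
      have "AE \<omega> in M n. \<omega> \<in> {\<omega> \<in> space (M n). ?Y n \<omega> \<notin> W} \<longrightarrow> \<omega> \<in> {\<omega> \<in> space (M n). x \<le> ?b n \<omega>}"
        using facts(3)
      proof eventually_elim
        case (elim \<omega>)
        have "x \<le> ?b n \<omega>" if "?Y n \<omega> \<notin> W"
        proof (rule ccontr)
          assume "\<not> x \<le> ?b n \<omega>"
          then have "2 * B * (real r)\<^sup>2 * ?b n \<omega> \<le> 2 * B * (real r)\<^sup>2 * x"
            using B by (intro mult_left_mono) auto
          moreover have "\<bar>(\<integral>z. f z \<partial>?Y n \<omega>) - f ?c\<bar> \<le> \<eta> / 2 + 2 * B * (real r)\<^sup>2 * ?b n \<omega>"
            using elim \<delta> \<eta>(1) by (intro integral_sampling_measure_close f B(2)) (auto intro: less_imp_le)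
          ultimately have "dist (f ?c) (\<integral>z. f z \<partial>?Y n \<omega>) < \<eta>"
            using xb by (simp add: dist_real_def abs_minus_commute)
          then have "(\<integral>z. f z \<partial>?Y n \<omega>) \<in> U" using \<eta>(2) by (auto simp: subset_iff)
          then show False using that by (simp add: W sampling_measure_is_prob)
        qed
        then show ?case by auto
      qed
      moreover have "{\<omega> \<in> space (M n). x \<le> ?b n \<omega>} \<in> sets (M n)"
        by (rule facts(2)) (simp add: bad_fraction_infinite)
      ultimately show ?case by (simp add: finite_measure_mono_AE)
    qed
    then show ?case using prob_bad_fraction_tendsto[OF \<delta>(1) x] by (rule Lim_null_comparison)
  qed
  then show ?thesis
    unfolding tends_in_prob_def using meas(1)
    by (auto simp: topspace_weak_topology prob_space_return)
      (simp add: weak_topology_def openin_topology_generated_by_iff)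
qed

end

theorem theorem13p4:
  fixes N :: "nat \<Rightarrow> ('b::finite option \<Rightarrow> nat) pmf"
    and V :: "('b option \<Rightarrow> real) measure"
    and M :: "nat \<Rightarrow> 'a measure"
    and T :: "nat \<Rightarrow> 'a \<Rightarrow> 'b list set"
  assumes "CARD('b) \<ge> 2"
    and "split_vectors N"
    and "ST1 N"
    and "ST2 N V"
    and "ST3 N V"
    and "\<forall>n\<ge>1. random_split_tree N n (M n) (T n)"
  shows "(\<forall>\<xi>\<^sub>1 \<xi>\<^sub>2 :: nat \<Rightarrow> 'a \<Rightarrow> 'b list.
            (\<forall>n\<ge>1. iid_uniform_vertices (M n) (T n) (\<xi>\<^sub>1 n) (\<xi>\<^sub>2 n)) \<longrightarrow>
            tends_in_prob euclidean M
              (\<lambda>n \<omega>. real (graph_dist (T n \<omega>) (\<xi>\<^sub>1 n \<omega>) (\<xi>\<^sub>2 n \<omega>)) / ln (real n))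
              (2 / split_entropy V)) \<and>
         tends_in_prob weak_topology M
           (\<lambda>n \<omega>. sampling_measure (1 / ln (real n)) (T n \<omega>))
           (dendron_sampling_measure (Upsilon (1 / split_entropy V)))"
proof -
  interpret split_tree_sequence N V M T
    using assms by unfold_locales auto
  \<comment> \<open>Two sample points of \<open>Upsilon a\<close> are at distance
    \<open>2 * a\<close>; for a = 1/\<chi> this is the limit 2/\<chi> of the rescaled
    distances.\<close>
  show ?thesis
    unfolding dendron_sampling_measure_Upsilon times_divide_eq_right mult_1_right
    using distance_tends_in_prob sampling_measure_tends_in_prob by blast
qed

end
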